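(* (1) Let $P$ be a ranked poset and let $\ell=d(\widehat{0},\widehat{1})$ in $\widehat{P}$. Then for every $n\ge1$ there exists an embedding of abelian groups $\widetilde{H}_{n-2}(\Delta(P))\hookrightarrow H_n^{\Sigma,\ell}(\widehat{P})$. (2) Let $M$ be a compact $C^\infty$-manifold. Then there exist a finite metric space $X$ and $\ell>0$ such that, for each $n>0$, $H_n^{\Sigma,\ell}(X)$ contains a subgroup isomorphic to $H_{n-2}(M,\mathbb{Z})$. (3) There exist a graph $X$ and positive integers $n,\ell>0$ such that $H_n^{\Sigma,\ell}(X)$ has torsion.
   Context: Let $(X,d)$ be a metric space. For $x,y,z\in X$ write $x\prec y\prec z$ if $d(x,y)+d(y,z)=d(x,z)$, $x\neq y$ and $y\neq z$. A tuple $\boldsymbol{x}=(x_0,\dots,x_n)\in X^{n+1}$ is a proper chain of degree $n$ if $x_{i-1}\neq x_i$ for all $i=1,\dots,n$; its length is $|\boldsymbol{x}|=\sum_{i=1}^n d(x_{i-1},x_i)$. $P_n^{\ell}(X)$ is the set of proper chains of degree $n$ and length $\ell$. The magnitude chain complex in grading $\ell$ is $B_n^{\ell}(X)=\bigoplus_{\boldsymbol{x}\in P_n^{\ell}(X)}\mathbb{Z}\cdot\langle\boldsymbol{x}\rangle$ with boundary $\partial_n=\sum_i(-1)^i\partial_{n,i}$, where $\partial_{n,i}\langle x_0,\dots,x_n\rangle=\langle x_0,\dots,\widehat{x_i},\dots,x_n\rangle$ if $1\le i\le n-1$ and $x_{i-1}\prec x_i\prec x_{i+1}$, and $0$ otherwise.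 Its homology is the magnitude homology $H_n^{\Sigma,\ell}(X)$. A (connected) graph is regarded as the metric space given by its vertex set with the shortest path metric (each edge having length $1$). A poset $P$ is ranked if all maximal chains of $P$ have the same finite length. $\widehat{P}=P\sqcup\{\widehat{0},\widehat{1}\}$ is the poset obtained from $P$ by adjoining a minimum $\widehat{0}$ and a maximum $\widehat{1}$. $\widehat{P}$ is regarded as a metric space with the shortest path metric of its Hasse diagram: $d(a,b)$ is the minimum $n$ such that there is a sequence $a=x_0,x_1,\dots,x_n=b$ in $\widehat{P}$ where for each $i$ either $x_i$ covers $x_{i-1}$ or $x_{i-1}$ covers $x_i$. $\Delta(P)$ is the order complex of $P$, the simplicial complex whose simplices are the finite nonempty chains $x_0<\cdots<x_n$ of $P$. $\widetilde{H}_*(\Delta(P))$ is its reduced homology with $\mathbb{Z}$ coefficients, i.e. the homology of the chain complex augmented by $\mathbb{Z}$ in degree $-1$; in particular $\widetilde{H}_{-1}$ is $\mathbb{Z}$ if $P=\emptyset$ and $0$ otherwise. *)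

theory Defs
  imports "HOL-Analysis.Analysis" "HOL-Homology.Homology"
begin

section \<open>Homology of based chain complexes\<close>

text \<open>
  \<open>S\<close> and \<open>T\<close> are the bases of the chain groups in some degree and in the next higher degree,
  and \<open>bd\<close> is the boundary on basis elements. The result is the kernel in the degree of \<open>S\<close>
  modulo the image of the degree of \<open>T\<close>.
\<close>

definition chain_homology ::
    "'c set \<Rightarrow> 'c set \<Rightarrow> ('c \<Rightarrow> 'c \<Rightarrow>\<^sub>0 int) \<Rightarrow> ('c \<Rightarrow>\<^sub>0 int) set monoid" where
  "chain_homology S T bd =
     subgroup_generated (free_Abelian_group S)
       {c \<in> carrier (free_Abelian_group S). frag_extend bd c = 0}
     Mod (frag_extend bd ` carrier (free_Abelian_group T))"

definition has_torsion :: "('a, 'b) monoid_scheme \<Rightarrow> bool" where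
  "has_torsion G \<longleftrightarrow>
     (\<exists>x\<in>carrier G. x \<noteq> \<one>\<^bsub>G\<^esub> \<and> (\<exists>k::nat. k > 0 \<and> x [^]\<^bsub>G\<^esub> k = \<one>\<^bsub>G\<^esub>))"

definition delete_nth :: "nat \<Rightarrow> 'a list \<Rightarrow> 'a list" where
  "delete_nth i xs = take i xs @ drop (Suc i) xs"


section \<open>Magnitude homology\<close>

definition strictly_between :: "('a \<Rightarrow> 'a \<Rightarrow> real) \<Rightarrow> 'a \<Rightarrow> 'a \<Rightarrow> 'a \<Rightarrow> bool" where
  "strictly_between d x y z \<longleftrightarrow> d x y + d y z = d x z \<and> x \<noteq> y \<and> y \<noteq> z"

text \<open>A tuple \<open>(x\<^sub>0, \<dots>, x\<^sub>n)\<close> is encoded as a list of length \<open>n + 1\<close>.\<close>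

definition proper_chains ::
    "'a set \<Rightarrow> ('a \<Rightarrow> 'a \<Rightarrow> real) \<Rightarrow> nat \<Rightarrow> real \<Rightarrow> 'a list set" where
  "proper_chains M d n l =
     {xs. length xs = n + 1 \<and> set xs \<subseteq> M \<and> (\<forall>i\<in>{1..n}. xs ! (i - 1) \<noteq> xs ! i) \<and>
          (\<Sum>i=1..n. d (xs ! (i - 1)) (xs ! i)) = l}"

definition magnitude_face ::
    "('a \<Rightarrow> 'a \<Rightarrow> real) \<Rightarrow> nat \<Rightarrow> nat \<Rightarrow> 'a list \<Rightarrow> 'a list \<Rightarrow>\<^sub>0 int" where
  "magnitude_face d n i xs =
     (if 1 \<le> i \<and> i + 1 \<le> n \<and> strictly_between d (xs ! (i - 1)) (xs ! i) (xs ! (i + 1))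
      then frag_of (delete_nth i xs) else 0)"

text \<open>The degree of a list \<open>xs\<close> is \<open>length xs - 1\<close>.\<close>

definition magnitude_boundary :: "('a \<Rightarrow> 'a \<Rightarrow> real) \<Rightarrow> 'a list \<Rightarrow> 'a list \<Rightarrow>\<^sub>0 int" where
  "magnitude_boundary d xs =
     (let n = length xs - 1 in \<Sum>i=0..n. frag_cmul ((- 1) ^ i) (magnitude_face d n i xs))"

definition magnitude_homology ::
    "'a set \<Rightarrow> ('a \<Rightarrow> 'a \<Rightarrow> real) \<Rightarrow> nat \<Rightarrow> real \<Rightarrow> ('a list \<Rightarrow>\<^sub>0 int) set monoid" where
  "magnitude_homology M d n l =
     chain_homology (proper_chains M d n l) (proper_chains M d (n + 1) l) (magnitude_boundary d)"


section \<open>Shortest path metrics and graphs\<close>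

definition walk :: "'a set \<Rightarrow> ('a \<Rightarrow> 'a \<Rightarrow> bool) \<Rightarrow> 'a \<Rightarrow> 'a \<Rightarrow> nat \<Rightarrow> bool" where
  "walk V adj a b n \<longleftrightarrow>
     (\<exists>x::nat \<Rightarrow> 'a. x 0 = a \<and> x n = b \<and> (\<forall>i\<le>n. x i \<in> V) \<and> (\<forall>i<n. adj (x i) (x (Suc i))))"

text \<open>Only meaningful for points that are joined by a walk.\<close>

definition path_dist :: "'a set \<Rightarrow> ('a \<Rightarrow> 'a \<Rightarrow> bool) \<Rightarrow> 'a \<Rightarrow> 'a \<Rightarrow> real" where
  "path_dist V adj a b = real (LEAST n. walk V adj a b n)"

definition simple_graph :: "'a set \<Rightarrow> 'a set set \<Rightarrow> bool" where
  "simple_graph V E \<longleftrightarrow> (\<forall>e\<in>E. \<exists>u\<in>V. \<exists>v\<in>V. u \<noteq> v \<and> e = {u, v})"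

definition edge_adj :: "'a set set \<Rightarrow> 'a \<Rightarrow> 'a \<Rightarrow> bool" where
  "edge_adj E u v \<longleftrightarrow> {u, v} \<in> E"

definition graph_connected :: "'a set \<Rightarrow> 'a set set \<Rightarrow> bool" where
  "graph_connected V E \<longleftrightarrow> (\<forall>u\<in>V. \<forall>v\<in>V. \<exists>n. walk V (edge_adj E) u v n)"

definition graph_dist :: "'a set \<Rightarrow> 'a set set \<Rightarrow> 'a \<Rightarrow> 'a \<Rightarrow> real" where
  "graph_dist V E = path_dist V (edge_adj E)"


section \<open>Ranked posets and order complexes\<close>

definition maximal_chains :: "('a \<times> 'a) set \<Rightarrow> 'a set set" where
  "maximal_chains r = {C \<in> Chains r. \<forall>D\<in>Chains r. C \<subseteq> D \<longrightarrow> D = C}"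

text \<open>
  The length of a chain with \<open>k\<close> elements is \<open>k - 1\<close>; comparing cardinalities also covers
  the empty poset, whose only maximal chain is empty.
\<close>

definition ranked_poset :: "'a set \<Rightarrow> ('a \<times> 'a) set \<Rightarrow> bool" where
  "ranked_poset P r \<longleftrightarrow>
     partial_order_on P r \<and> (\<exists>k. \<forall>C\<in>maximal_chains r. finite C \<and> card C = k)"

datatype 'a hat = Hat0 | Elem 'a | Hat1

definition hat_carrier :: "'a set \<Rightarrow> 'a hat set" where
  "hat_carrier P = {Hat0, Hat1} \<union> Elem ` P"

definition hat_order :: "'a set \<Rightarrow> ('a \<times> 'a) set \<Rightarrow> ('a hat \<times> 'a hat) set" where
  "hat_order P r =
     {(a, b). a \<in> hat_carrier P \<and> b \<in> hat_carrier P \<and>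
              (a = Hat0 \<or> b = Hat1 \<or> (\<exists>x y. a = Elem x \<and> b = Elem y \<and> (x, y) \<in> r))}"

definition covers :: "('a \<times> 'a) set \<Rightarrow> 'a \<Rightarrow> 'a \<Rightarrow> bool" where
  "covers r b a \<longleftrightarrow>
     (a, b) \<in> r \<and> a \<noteq> b \<and> \<not> (\<exists>c. c \<noteq> a \<and> c \<noteq> b \<and> (a, c) \<in> r \<and> (c, b) \<in> r)"

definition hasse_dist :: "'a set \<Rightarrow> ('a \<times> 'a) set \<Rightarrow> 'a \<Rightarrow> 'a \<Rightarrow> real" where
  "hasse_dist P r = path_dist P (\<lambda>a b. covers r b a \<or> covers r a b)"

definition hat_dist :: "'a set \<Rightarrow> ('a \<times> 'a) set \<Rightarrow> 'a hat \<Rightarrow> 'a hat \<Rightarrow> real" where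
  "hat_dist P r = hasse_dist (hat_carrier P) (hat_order P r)"

text \<open>A simplex \<open>x\<^sub>0 < \<dots> < x\<^sub>p\<close> is encoded as the list of its vertices in increasing order.\<close>

definition order_complex :: "'a set \<Rightarrow> ('a \<times> 'a) set \<Rightarrow> 'a list set" where
  "order_complex P r =
     {xs. xs \<noteq> [] \<and> set xs \<subseteq> P \<and> sorted_wrt (\<lambda>x y. (x, y) \<in> r \<and> x \<noteq> y) xs}"

text \<open>
  The augmented simplicial chain complex: the generator of the group \<open>\<int>\<close> in degree \<open>-1\<close> is the
  empty list, so that the boundary of a vertex, given by the general formula, is the augmentation.
\<close>

definition augmented_simplices :: "'a set \<Rightarrow> ('a \<times> 'a) set \<Rightarrow> int \<Rightarrow> 'a list set" where
  "augmented_simplices P r p = {xs \<in> insert [] (order_complex P r). int (length xs) = p + 1}"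

definition simplicial_boundary :: "'a list \<Rightarrow> 'a list \<Rightarrow>\<^sub>0 int" where
  "simplicial_boundary xs =
     (\<Sum>i<length xs. frag_cmul ((- 1) ^ i) (frag_of (delete_nth i xs)))"

definition reduced_order_homology ::
    "'a set \<Rightarrow> ('a \<times> 'a) set \<Rightarrow> int \<Rightarrow> ('a list \<Rightarrow>\<^sub>0 int) set monoid" where
  "reduced_order_homology P r p =
     chain_homology (augmented_simplices P r p) (augmented_simplices P r (p + 1))
       simplicial_boundary"


section \<open>Smooth manifolds\<close>

text \<open>
  \<open>Ck_on m k S f\<close>: the real function \<open>f\<close> is of class \<open>C\<^sup>k\<close> on the set \<open>S\<close>, which is meant to be
  open in \<open>Euclidean_space m\<close>. The point \<open>x(i := t)\<close> varies only in the \<open>i\<close>-th coordinate, so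
  \<open>g i\<close> is the \<open>i\<close>-th partial derivative of \<open>f\<close> on \<open>S\<close>.
\<close>

primrec Ck_on :: "nat \<Rightarrow> nat \<Rightarrow> (nat \<Rightarrow> real) set \<Rightarrow> ((nat \<Rightarrow> real) \<Rightarrow> real) \<Rightarrow> bool" where
  "Ck_on m 0 S f \<longleftrightarrow> continuous_map (subtopology (Euclidean_space m) S) euclideanreal f"
| "Ck_on m (Suc k) S f \<longleftrightarrow>
     continuous_map (subtopology (Euclidean_space m) S) euclideanreal f \<and>
     (\<exists>g. \<forall>i<m.
        (\<forall>x\<in>S. ((\<lambda>t. f (x(i := t))) has_real_derivative g i x) (at (x i))) \<and>
        Ck_on m k S (g i))"

definition smooth_map_on ::
    "nat \<Rightarrow> (nat \<Rightarrow> real) set \<Rightarrow> ((nat \<Rightarrow> real) \<Rightarrow> nat \<Rightarrow> real) \<Rightarrow> bool" where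
  "smooth_map_on m S F \<longleftrightarrow> (\<forall>j<m. \<forall>k. Ck_on m k S (\<lambda>x. F x j))"

definition chart_of :: "nat \<Rightarrow> 'a topology \<Rightarrow> 'a set \<Rightarrow> ('a \<Rightarrow> nat \<Rightarrow> real) \<Rightarrow> bool" where
  "chart_of m M U \<phi> \<longleftrightarrow>
     openin M U \<and> openin (Euclidean_space m) (\<phi> ` U) \<and>
     homeomorphic_map (subtopology M U) (subtopology (Euclidean_space m) (\<phi> ` U)) \<phi>"

definition smooth_atlas ::
    "nat \<Rightarrow> 'a topology \<Rightarrow> ('a set \<times> ('a \<Rightarrow> nat \<Rightarrow> real)) set \<Rightarrow> bool" where
  "smooth_atlas m M A \<longleftrightarrow>
     (\<forall>(U, \<phi>)\<in>A. chart_of m M U \<phi>) \<and>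
     (\<Union>(U, \<phi>)\<in>A. U) = topspace M \<and>
     (\<forall>(U, \<phi>)\<in>A. \<forall>(V, \<psi>)\<in>A. smooth_map_on m (\<phi> ` (U \<inter> V)) (\<psi> \<circ> inv_into U \<phi>))"

text \<open>
  A \<open>C\<^sup>\<infinity>\<close>-manifold without boundary of dimension \<open>m\<close> (where \<open>m = 0\<close> is allowed). The atlas is not
  required to be maximal: it determines its smooth structure in any case.
\<close>

definition smooth_manifold ::
    "nat \<Rightarrow> 'a topology \<Rightarrow> ('a set \<times> ('a \<Rightarrow> nat \<Rightarrow> real)) set \<Rightarrow> bool" where
  "smooth_manifold m M A \<longleftrightarrow> Hausdorff_space M \<and> second_countable M \<and> smooth_atlas m M A"

end

(*
  A path of minimal length from Hat0 to Hat1 in a graded poset with top and bottom is a chain, so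
  adjoining the two ends to a chain of P identifies the augmented chain complex of the order complex,
  up to sign and a degree shift, with a direct summand of the magnitude chain complex.

  For (2) only the homology groups of M matter. They are finitely generated and almost all zero:
  by a Mayer-Vietoris argument on cycles, the property that a compact set K has, inside each
  neighbourhood U, a smaller neighbourhood V for which H(V) -> H(U) has these properties passes from
  K, L and their intersection to their union, and it holds for boxes in charts. So each H_p(M) is a
  finite sum of cyclic groups. For each summand there is a finite poset with a cycle of that order
  (suspensions of a Moore space or of the empty poset, the latter sufficing in degree 0 since H_0 is
  torsion-free), and a metric on the disjoint union of these posets with common ends embeds their
  order complexes as above. The Moore space for the integer 2 gives the graph in (3).
*)
theory Submission
  imports Defs
begin

section \<open>Quotients of groups of finite formal sums\<close>

text \<open>The manifold is not triangulated, so finite generation has to come from charts, where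
  two difficulties meet: an intersection of chart domains may have homology that is not finitely
  generated, and Mayer-Vietoris needs control of intersections. Measuring only the image of
  \<open>H(V)\<close> in \<open>H(U)\<close> removes both, since a connecting class of
  \<open>V1 \<union> V2\<close> is allowed to be filled in the larger set
  \<open>U1 \<inter> U2\<close>. What remains of \<open>M\<close> is a list of orders of cyclic
  groups, and the poset is built from that list. It need not be ranked, so its metric is not a
  shortest path metric: it is the difference of ranks, with 2 added for incomparable pairs. The
  locale \<open>hat_embedding\<close> keeps what both metrics share, a distance that is at least the
  rise of rank and equals it exactly for ordered pairs. Several maps on homology depend on choices
  (coefficients modulo orders, splittings of cycles); they are therefore relations between
  representatives, and \<open>frag_quotient_mon\<close> and \<open>fg_mod_extension\<close> are
  stated for relations.\<close>

definition frag_subgroup :: "('c \<Rightarrow>\<^sub>0 int) set \<Rightarrow> bool" where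
  "frag_subgroup A \<longleftrightarrow> 0 \<in> A \<and> (\<forall>x\<in>A. \<forall>y\<in>A. x - y \<in> A)"

definition frag_group :: "('c \<Rightarrow>\<^sub>0 int) set \<Rightarrow> ('c \<Rightarrow>\<^sub>0 int) monoid" where
  "frag_group A = \<lparr>carrier = A, monoid.mult = (+), one = 0\<rparr>"

lemma frag_subgroup_zero: "frag_subgroup A \<Longrightarrow> 0 \<in> A"
  by (simp add: frag_subgroup_def)

lemma frag_subgroup_diff: "frag_subgroup A \<Longrightarrow> x \<in> A \<Longrightarrow> y \<in> A \<Longrightarrow> x - y \<in> A"
  by (simp add: frag_subgroup_def)

lemma frag_subgroup_uminus: "frag_subgroup A \<Longrightarrow> x \<in> A \<Longrightarrow> - x \<in> A"
  using frag_subgroup_diff[of A 0 x] frag_subgroup_zero by fastforce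

lemma frag_subgroup_add: "frag_subgroup A \<Longrightarrow> x \<in> A \<Longrightarrow> y \<in> A \<Longrightarrow> x + y \<in> A"
  using frag_subgroup_diff[of A x "- y"] frag_subgroup_uminus[of A y] by simp

lemma frag_subgroup_sum:
  "frag_subgroup A \<Longrightarrow> (\<And>i. i \<in> I \<Longrightarrow> f i \<in> A) \<Longrightarrow> sum f I \<in> A"
  by (induction I rule: infinite_finite_induct)
    (auto intro: frag_subgroup_zero frag_subgroup_add)

lemma frag_subgroup_cmul:
  assumes "frag_subgroup A" "x \<in> A"
  shows "frag_cmul k x \<in> A"
proof -
  have nn: "frag_cmul (int n) x \<in> A" for n
    by (induction n)
      (use assms in \<open>auto simp: frag_cmul_distrib intro: frag_subgroup_zero frag_subgroup_add\<close>)
  show ?thesis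
  proof (cases "k \<ge> 0")
    case True
    then show ?thesis using nn[of "nat k"] by simp
  next
    case False
    then have "frag_cmul k x = - frag_cmul (int (nat (-k))) x" by simp
    then show ?thesis using nn frag_subgroup_uminus assms by metis
  qed
qed

lemma frag_subgroup_diff_iff:
  "frag_subgroup A \<Longrightarrow> x - y \<in> A \<Longrightarrow> x \<in> A \<longleftrightarrow> y \<in> A"
  by (metis diff_add_cancel diff_diff_eq2 add_diff_cancel_left' frag_subgroup_add frag_subgroup_diff)

lemma frag_subgroup_extend:
  assumes "frag_subgroup A" "\<And>x. x \<in> Poly_Mapping.keys c \<Longrightarrow> f x \<in> A"
  shows "frag_extend f c \<in> A"
  unfolding frag_extend_def using assms by (auto intro!: frag_subgroup_sum frag_subgroup_cmul)

lemma comm_group_frag_group: "frag_subgroup A \<Longrightarrow> comm_group (frag_group A)"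
proof (rule comm_groupI)
  fix x assume "frag_subgroup A" "x \<in> carrier (frag_group A)"
  then show "\<exists>y\<in>carrier (frag_group A). y \<otimes>\<^bsub>frag_group A\<^esub> x = \<one>\<^bsub>frag_group A\<^esub>"
    by (auto simp: frag_group_def intro!: bexI[of _ "- x"] frag_subgroup_uminus)
qed (auto simp: frag_group_def algebra_simps intro: frag_subgroup_add frag_subgroup_zero)

lemma frag_group_inv:
  "frag_subgroup A \<Longrightarrow> x \<in> A \<Longrightarrow> inv\<^bsub>frag_group A\<^esub> x = - x"
  by (rule group.inv_equality)
    (auto simp: frag_group_def frag_subgroup_uminus comm_group.axioms(2)
        comm_group_frag_group[unfolded frag_group_def])

lemma subgroup_frag_group:
  assumes "frag_subgroup A" "frag_subgroup B" "B \<subseteq> A"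
  shows "subgroup B (frag_group A)"
proof
  show "inv\<^bsub>frag_group A\<^esub> x \<in> B" if "x \<in> B" for x
    using that assms frag_group_inv[of A x] frag_subgroup_uminus[of B x] by auto
qed (use assms in \<open>auto simp: frag_group_def intro: frag_subgroup_add frag_subgroup_zero\<close>)

lemma normal_frag_group:
  assumes "frag_subgroup A" "frag_subgroup B" "B \<subseteq> A"
  shows "B \<lhd> frag_group A"
  by (meson assms comm_group.normal_iff_subgroup comm_group_frag_group subgroup_frag_group)

lemma group_frag_quotient:
  "frag_subgroup A \<Longrightarrow> frag_subgroup B \<Longrightarrow> B \<subseteq> A \<Longrightarrow> group (frag_group A Mod B)"
  by (simp add: normal.factorgroup_is_group normal_frag_group)

lemma subgroup_generated_eq_frag_group:
  assumes "frag_subgroup A" "A \<subseteq> {c. Poly_Mapping.keys c \<subseteq> S}"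
  shows "subgroup_generated (free_Abelian_group S) A = frag_group A"
proof -
  have "subgroup A (free_Abelian_group S)"
  proof
    show "inv\<^bsub>free_Abelian_group S\<^esub> x \<in> A" if "x \<in> A" for x
      using that assms frag_subgroup_uminus[of A x] by auto
  qed (use assms in \<open>auto intro: frag_subgroup_add frag_subgroup_zero\<close>)
  then have "carrier (subgroup_generated (free_Abelian_group S) A) = A"
    by (rule subgroup.carrier_subgroup_generated_subgroup)
  then show ?thesis
    by (auto simp: subgroup_generated_def frag_group_def free_Abelian_group_def)
qed

lemma frag_coset_eq: "B #>\<^bsub>frag_group A\<^esub> a = {c. c - a \<in> B}"
proof -
  have "c \<in> (\<Union>h\<in>B. {h + a}) \<longleftrightarrow> c - a \<in> B" for c
  proof
    assume "c - a \<in> B"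
    then show "c \<in> (\<Union>h\<in>B. {h + a})" by (rule UN_I) simp
  qed auto
  then show ?thesis by (simp only: r_coset_def frag_group_def monoid.simps) blast
qed

lemma frag_coset_eq_iff:
  assumes "frag_subgroup A" "frag_subgroup B" "B \<subseteq> A" "a \<in> A" "b \<in> A"
  shows "B #>\<^bsub>frag_group A\<^esub> a = B #>\<^bsub>frag_group A\<^esub> b \<longleftrightarrow> a - b \<in> B"
proof
  assume "B #>\<^bsub>frag_group A\<^esub> a = B #>\<^bsub>frag_group A\<^esub> b"
  moreover have "a \<in> B #>\<^bsub>frag_group A\<^esub> a"
    using frag_subgroup_zero[OF assms(2)] by (auto simp: r_coset_def frag_group_def intro: bexI[of _ 0])
  ultimately show "a - b \<in> B" by (auto simp: r_coset_def frag_group_def)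
next
  assume ab: "a - b \<in> B"
  have "c - a \<in> B \<longleftrightarrow> c - b \<in> B" for c
    using frag_subgroup_diff_iff[OF assms(2), of "c - b" "c - a"] ab by simp
  then show "B #>\<^bsub>frag_group A\<^esub> a = B #>\<^bsub>frag_group A\<^esub> b"
    by (simp add: frag_coset_eq)
qed

lemma frag_coset_mult:
  assumes "frag_subgroup A" "frag_subgroup B" "B \<subseteq> A" "a \<in> A" "b \<in> A"
  shows "(B #>\<^bsub>frag_group A\<^esub> a) \<otimes>\<^bsub>frag_group A Mod B\<^esub> (B #>\<^bsub>frag_group A\<^esub> b)
       = B #>\<^bsub>frag_group A\<^esub> (a + b)"
  using normal.rcos_sum[OF normal_frag_group[OF assms(1-3)], of a b] assms(4,5)
  by (simp add: FactGroup_def frag_group_def)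

lemma carrier_frag_quotient:
  "carrier (frag_group A Mod B) = (\<lambda>a. B #>\<^bsub>frag_group A\<^esub> a) ` A"
  by (auto simp: FactGroup_def RCOSETS_def frag_group_def)

text \<open>The relation \<open>R\<close> plays the part of a homomorphism that need not single out
  one value. Applied to differences, \<open>R_iff\<close> from left to right makes the induced map
  on cosets well defined, and from right to left it makes the map injective.\<close>

lemma frag_quotient_mon:
  assumes A: "frag_subgroup A" "frag_subgroup B" "B \<subseteq> A"
    and A': "frag_subgroup A'" "frag_subgroup B'" "B' \<subseteq> A'"
    and total: "\<And>a. a \<in> A \<Longrightarrow> \<exists>a'\<in>A'. R a a'"
    and R_diff: "\<And>a b a' b'. R a a' \<Longrightarrow> R b b' \<Longrightarrow> R (a - b) (a' - b')"
    and R_iff: "\<And>a a'. a \<in> A \<Longrightarrow> a' \<in> A' \<Longrightarrow> R a a' \<Longrightarrow> a \<in> B \<longleftrightarrow> a' \<in> B'"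
  shows "\<exists>h. h \<in> mon (frag_group A Mod B) (frag_group A' Mod B')"
proof -
  let ?c = "\<lambda>a. B #>\<^bsub>frag_group A\<^esub> a" and ?c' = "\<lambda>a. B' #>\<^bsub>frag_group A'\<^esub> a"
  obtain g where g: "\<And>a. a \<in> A \<Longrightarrow> g a \<in> A' \<and> R a (g a)" using total by metis
  define rep where "rep x = (SOME a. a \<in> A \<and> ?c a = x)" for x
  define h where "h x = ?c' (g (rep x))" for x
  have rep: "rep (?c a) \<in> A \<and> ?c (rep (?c a)) = ?c a" if "a \<in> A" for a
    unfolding rep_def by (rule someI_ex) (use that in blast)
  have key: "?c a = ?c b \<longleftrightarrow> ?c' a' = ?c' b'"
    if "a \<in> A" "b \<in> A" "a' \<in> A'" "b' \<in> A'" "R a a'" "R b b'" for a b a' b'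
    using that R_iff[OF frag_subgroup_diff[OF A(1)] frag_subgroup_diff[OF A'(1)] R_diff[OF that(5,6)]]
    by (simp add: frag_coset_eq_iff[OF A] frag_coset_eq_iff[OF A'])
  have h: "h (?c a) = ?c' a'" if "a \<in> A" "a' \<in> A'" "R a a'" for a a'
    unfolding h_def using that rep[of a] g[of "rep (?c a)"] key[of "rep (?c a)" a "g (rep (?c a))" a'] by blast
  \<comment> \<open>Only differences are related by assumption, so \<open>a + b\<close> is read as
    \<open>a - ((b - b) - b)\<close>.\<close>
  have R_add: "R (a + b) (a' + b')" if "R a a'" "R b b'" for a b a' b'
    using R_diff[OF that(1) R_diff[OF R_diff[OF that(2,2)] that(2)]] by simp
  have "h \<in> hom (frag_group A Mod B) (frag_group A' Mod B')"
  proof (rule homI)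
    fix x y assume "x \<in> carrier (frag_group A Mod B)" "y \<in> carrier (frag_group A Mod B)"
    then obtain a b where ab: "a \<in> A" "b \<in> A" "x = ?c a" "y = ?c b"
      by (auto simp: carrier_frag_quotient)
    have "h (?c (a + b)) = ?c' (g a + g b)"
      using ab g R_add A A' by (intro h) (auto intro: frag_subgroup_add)
    also have "\<dots> = ?c' (g a) \<otimes>\<^bsub>frag_group A' Mod B'\<^esub> ?c' (g b)"
      by (rule frag_coset_mult[OF A', symmetric]) (use g ab in auto)
    also have "\<dots> = h (?c a) \<otimes>\<^bsub>frag_group A' Mod B'\<^esub> h (?c b)"
      using g[OF ab(1)] g[OF ab(2)] h[OF ab(1), of "g a"] h[OF ab(2), of "g b"] by simp
    finally show "h (x \<otimes>\<^bsub>frag_group A Mod B\<^esub> y) = h x \<otimes>\<^bsub>frag_group A' Mod B'\<^esub> h y"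
      unfolding ab(3,4) frag_coset_mult[OF A ab(1,2)] .
  next
    fix x assume "x \<in> carrier (frag_group A Mod B)"
    then obtain a where a: "a \<in> A" "x = ?c a" by (auto simp: carrier_frag_quotient)
    then have "h x = ?c' (g a)" "g a \<in> A'" using g[of a] h[of a "g a"] by auto
    then show "h x \<in> carrier (frag_group A' Mod B')" by (auto simp: carrier_frag_quotient)
  qed
  moreover have "inj_on h (carrier (frag_group A Mod B))"
  proof (rule inj_onI)
    fix x y assume "x \<in> carrier (frag_group A Mod B)" "y \<in> carrier (frag_group A Mod B)" and hxy: "h x = h y"
    then obtain a b where ab: "a \<in> A" "b \<in> A" "x = ?c a" "y = ?c b"
      by (auto simp: carrier_frag_quotient)
    then have "?c' (g a) = ?c' (g b)"
      using hxy g[of a] g[of b] h[of a "g a"] h[of b "g b"] by simp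
    then show "x = y" using g[of a] g[of b] key[of a b "g a" "g b"] ab by blast
  qed
  ultimately show ?thesis by (auto simp: mon_def)
qed

lemma mon_imp_subgroup_iso:
  assumes "group G" "group H" "h \<in> mon G H"
  shows "\<exists>K. subgroup K H \<and> H\<lparr>carrier := K\<rparr> \<cong> G"
proof -
  have h: "h \<in> hom G H" "inj_on h (carrier G)" using assms(3) by (auto simp: mon_def)
  then interpret group_hom G H h using assms by (simp add: group_hom_def group_hom_axioms_def)
  let ?K = "h ` carrier G"
  have sub: "subgroup ?K H" by (rule img_is_subgroup)
  have "h \<in> iso G (H\<lparr>carrier := ?K\<rparr>)"
    using h by (auto simp: iso_def hom_def bij_betw_def)
  then have "G \<cong> H\<lparr>carrier := ?K\<rparr>" by (auto simp: is_iso_def)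
  then show ?thesis using sub group.iso_sym[OF assms(1)] by blast
qed

lemma frag_quotient_has_torsion:
  assumes A: "frag_subgroup A" "frag_subgroup B" "B \<subseteq> A"
    and a: "a \<in> A" "a \<notin> B" "frag_cmul (int k) a \<in> B" "k > 0"
  shows "has_torsion (frag_group A Mod B)"
proof -
  let ?c = "\<lambda>a. B #>\<^bsub>frag_group A\<^esub> a" and ?G = "frag_group A Mod B"
  interpret G: group ?G by (rule group_frag_quotient[OF A])
  have one: "\<one>\<^bsub>?G\<^esub> = ?c 0"
    by (auto simp: FactGroup_def r_coset_def frag_group_def)
  have pow: "?c a [^]\<^bsub>?G\<^esub> n = ?c (frag_cmul (int n) a)" for n :: nat
  proof (induction n)
    case 0
    then show ?case using one by simp
  next
    case (Suc n)
    have "?c (frag_cmul (int n) a) \<otimes>\<^bsub>?G\<^esub> ?c a = ?c (frag_cmul (int (Suc n)) a)"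
      using A a by (subst frag_coset_mult[OF A])
        (auto simp: frag_cmul_distrib add.commute intro: frag_subgroup_cmul)
    then show ?case using Suc by simp
  qed
  have "?c a \<in> carrier ?G" using a by (auto simp: carrier_frag_quotient)
  moreover have "?c a \<noteq> \<one>\<^bsub>?G\<^esub>"
    using frag_coset_eq_iff[OF A, of a 0] frag_subgroup_zero[OF A(1)] a one by simp
  moreover have "?c a [^]\<^bsub>?G\<^esub> k = \<one>\<^bsub>?G\<^esub>"
    using frag_coset_eq_iff[OF A, of "frag_cmul (int k) a" 0] frag_subgroup_zero[OF A(1)] a A(3) one pow
    by auto
  ultimately show ?thesis using a(4) unfolding has_torsion_def by blast
qed

section \<open>Homology as cycles modulo boundaries, in one format for all complexes\<close>

lemma frag_subgroup_kernel:
  "frag_subgroup {c. Poly_Mapping.keys c \<subseteq> S \<and> frag_extend f c = 0}"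
  unfolding frag_subgroup_def using keys_diff by (fastforce simp: frag_extend_diff)

lemma frag_subgroup_image:
  "frag_subgroup (frag_extend f ` {c. Poly_Mapping.keys c \<subseteq> T})"
  unfolding frag_subgroup_def
proof (intro conjI ballI)
  fix x y assume "x \<in> frag_extend f ` {c. Poly_Mapping.keys c \<subseteq> T}"
    "y \<in> frag_extend f ` {c. Poly_Mapping.keys c \<subseteq> T}"
  then obtain a b where "Poly_Mapping.keys a \<subseteq> T" "Poly_Mapping.keys b \<subseteq> T"
    "x = frag_extend f a" "y = frag_extend f b" by auto
  moreover from this have "Poly_Mapping.keys (a - b) \<subseteq> T" using keys_diff[of a b] by blast
  ultimately show "x - y \<in> frag_extend f ` {c. Poly_Mapping.keys c \<subseteq> T}"
    by (auto simp flip: frag_extend_diff)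
qed (auto intro!: image_eqI[of _ _ 0])

definition chain_cycles :: "'c set \<Rightarrow> ('c \<Rightarrow> 'c \<Rightarrow>\<^sub>0 int) \<Rightarrow> ('c \<Rightarrow>\<^sub>0 int) set" where
  "chain_cycles S bd = {c. Poly_Mapping.keys c \<subseteq> S \<and> frag_extend bd c = 0}"

definition chain_boundaries :: "'c set \<Rightarrow> ('c \<Rightarrow> 'c \<Rightarrow>\<^sub>0 int) \<Rightarrow> ('c \<Rightarrow>\<^sub>0 int) set" where
  "chain_boundaries T bd = frag_extend bd ` {c. Poly_Mapping.keys c \<subseteq> T}"

lemma chain_homology_eq:
  "chain_homology S T bd = frag_group (chain_cycles S bd) Mod chain_boundaries T bd"
proof -
  have 1: "{c \<in> carrier (free_Abelian_group S). frag_extend bd c = 0} = chain_cycles S bd"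
    by (auto simp: chain_cycles_def)
  have 2: "frag_extend bd ` carrier (free_Abelian_group T) = chain_boundaries T bd"
    by (auto simp: chain_boundaries_def free_Abelian_group_def)
  show ?thesis
    unfolding chain_homology_def 1 2
    by (subst subgroup_generated_eq_frag_group)
      (auto simp: chain_cycles_def intro: frag_subgroup_kernel)
qed

lemma frag_subgroup_cycles: "frag_subgroup (chain_cycles S bd)"
  unfolding chain_cycles_def by (rule frag_subgroup_kernel)

lemma frag_subgroup_boundaries: "frag_subgroup (chain_boundaries T bd)"
  unfolding chain_boundaries_def by (rule frag_subgroup_image)

definition singular_cycles where
  "singular_cycles p X = singular_relcycle_set p X {}"
definition singular_boundaries where
  "singular_boundaries p X = singular_relboundary_set p X {}"

lemma frag_subgroup_singular_cycles: "frag_subgroup (singular_cycles p X)"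
  by (simp add: frag_subgroup_def singular_cycles_def singular_relcycle_diff)

lemma frag_subgroup_singular_boundaries: "frag_subgroup (singular_boundaries p X)"
  by (simp add: frag_subgroup_def singular_boundaries_def singular_relboundary_diff)

lemma singular_boundaries_subset: "singular_boundaries p X \<subseteq> singular_cycles p X"
  by (auto simp: singular_cycles_def singular_boundaries_def singular_relboundary_imp_relcycle)

lemma homology_group_eq:
  "homology_group (int p) X = frag_group (singular_cycles p X) Mod singular_boundaries p X"
proof -
  have "relcycle_group p X {} = frag_group (singular_cycles p X)"
    unfolding relcycle_group_def chain_group_def singular_cycles_def[symmetric]
    by (rule subgroup_generated_eq_frag_group)
      (use frag_subgroup_singular_cycles[of p X] in
        \<open>auto simp: singular_cycles_def singular_cycle singular_chain_def\<close>)
  then show ?thesis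
    by (simp add: nontrivial_relative_homology_group singular_boundaries_def)
qed

section \<open>Finitely generated quotients\<close>

definition frag_span :: "('c \<Rightarrow>\<^sub>0 int) set \<Rightarrow> ('c \<Rightarrow>\<^sub>0 int) set" where
  "frag_span F = \<Inter>{C. frag_subgroup C \<and> F \<subseteq> C}"

lemma frag_subgroup_span: "frag_subgroup (frag_span F)"
  by (auto simp: frag_span_def frag_subgroup_def)

lemma frag_span_superset: "F \<subseteq> frag_span F"
  by (auto simp: frag_span_def)

lemma frag_span_minimal: "frag_subgroup C \<Longrightarrow> F \<subseteq> C \<Longrightarrow> frag_span F \<subseteq> C"
  by (auto simp: frag_span_def)

lemma frag_span_mono: "F \<subseteq> G \<Longrightarrow> frag_span F \<subseteq> frag_span G"
  by (auto simp: frag_span_def)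

lemma frag_span_empty [simp]: "frag_span {} = {0}"
  using frag_span_minimal[of "{0}" "{}"] frag_subgroup_zero[OF frag_subgroup_span[of "{}"]]
  by (auto simp: frag_subgroup_def)

lemma frag_span_insertD:
  assumes "x \<in> frag_span (insert f F)"
  obtains n y where "y \<in> frag_span F" "x = frag_cmul n f + y"
proof -
  let ?C = "{frag_cmul n f + y |n y. y \<in> frag_span F}"
  have "frag_subgroup ?C"
    unfolding frag_subgroup_def
  proof (intro conjI ballI)
    show "0 \<in> ?C"
      by (intro CollectI exI[of _ 0]) (simp add: frag_subgroup_zero frag_subgroup_span)
  next
    fix x y assume "x \<in> ?C" "y \<in> ?C"
    then obtain n u m v where "x = frag_cmul n f + u" "y = frag_cmul m f + v"
      and uv: "u \<in> frag_span F" "v \<in> frag_span F" by blast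
    then have "x - y = frag_cmul (n - m) f + (u - v)" by (simp add: frag_cmul_diff_distrib)
    moreover have "u - v \<in> frag_span F" using uv frag_subgroup_diff frag_subgroup_span by blast
    ultimately show "x - y \<in> ?C" by blast
  qed
  moreover have "insert f F \<subseteq> ?C"
  proof (intro insert_subsetI subsetI)
    show "f \<in> ?C"
      by (intro CollectI exI[of _ 1] exI[of _ 0]) (simp add: frag_subgroup_zero frag_subgroup_span)
    show "x \<in> ?C" if "x \<in> F" for x
      using that frag_span_superset
      by (intro CollectI exI[of _ 0] exI[of _ x]) auto
  qed
  ultimately show ?thesis using that assms frag_span_minimal by blast
qed

lemma frag_span_image:
  fixes k :: nat
  shows "frag_span (g ` {..<k}) = {\<Sum>i<k. frag_cmul (n i) (g i) |n. True}" (is "_ = ?C")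
proof (rule subset_antisym)
  have "frag_subgroup ?C"
    unfolding frag_subgroup_def
  proof (intro conjI ballI)
    show "0 \<in> ?C" by (intro CollectI exI[of _ "\<lambda>_. 0"]) simp
  next
    fix x y assume "x \<in> ?C" "y \<in> ?C"
    then obtain n m where "x = (\<Sum>i<k. frag_cmul (n i) (g i))" "y = (\<Sum>i<k. frag_cmul (m i) (g i))"
      by blast
    then have "x - y = (\<Sum>i<k. frag_cmul (n i - m i) (g i))"
      by (simp add: frag_cmul_diff_distrib sum_subtractf)
    then show "x - y \<in> ?C" by (intro CollectI exI[of _ "\<lambda>i. n i - m i"] conjI TrueI)
  qed
  moreover have "g j \<in> ?C" if "j < k" for j
  proof -
    have "(\<Sum>i<k. frag_cmul (if i = j then 1 else 0) (g i)) = (\<Sum>i<k. if i = j then g i else 0)"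
      by (rule sum.cong) auto
    also have "\<dots> = g j" using that by simp
    finally show ?thesis
      by (intro CollectI exI[of _ "\<lambda>i. if i = j then 1 else 0"] conjI TrueI) simp
  qed
  ultimately show "frag_span (g ` {..<k}) \<subseteq> ?C"
    by (intro frag_span_minimal) auto
  show "?C \<subseteq> frag_span (g ` {..<k})"
    using frag_span_superset[of "g ` {..<k}"]
    by (auto intro!: frag_subgroup_sum[OF frag_subgroup_span] frag_subgroup_cmul[OF frag_subgroup_span])
qed

text \<open>Finite generation of the image of \<open>A\<close> modulo \<open>B\<close>. The
  generators may lie anywhere in the ambient group, which makes the notion monotone in both
  arguments and suits maps induced by inclusions.\<close>

definition fg_mod :: "('c \<Rightarrow>\<^sub>0 int) set \<Rightarrow> ('c \<Rightarrow>\<^sub>0 int) set \<Rightarrow> bool" where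
  "fg_mod A B \<longleftrightarrow> (\<exists>F. finite F \<and> (\<forall>a\<in>A. \<exists>s\<in>frag_span F. a - s \<in> B))"

lemma fg_mod_mono:
  assumes "fg_mod A B" "A' \<subseteq> A" "B \<subseteq> B'"
  shows "fg_mod A' B'"
proof -
  obtain F where "finite F" "\<And>a. a \<in> A \<Longrightarrow> \<exists>s\<in>frag_span F. a - s \<in> B"
    using assms(1) unfolding fg_mod_def by blast
  then show ?thesis unfolding fg_mod_def using assms(2,3) by (intro exI[of _ F]) (meson subset_iff)
qed

lemma fg_mod_subset: "A \<subseteq> B \<Longrightarrow> fg_mod A B"
  unfolding fg_mod_def
proof (intro exI[of _ "{}"] conjI ballI)
  fix a assume "A \<subseteq> B" "a \<in> A"
  then have "a - 0 \<in> B" by auto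
  then show "\<exists>s\<in>frag_span {}. a - s \<in> B" by (rule bexI) simp
qed simp

lemma int_subgroup_principal:
  fixes I :: "int set"
  assumes "0 \<in> I" and diff: "\<And>x y. x \<in> I \<Longrightarrow> y \<in> I \<Longrightarrow> x - y \<in> I"
  obtains m where "m \<in> I" "\<And>x. x \<in> I \<Longrightarrow> m dvd x"
proof (cases "I \<subseteq> {0}")
  case True
  then show ?thesis using that[of 0] assms(1) by auto
next
  case False
  have neg: "- x \<in> I" if "x \<in> I" for x using diff[OF assms(1) that] by simp
  have mult: "int n * x \<in> I" if "x \<in> I" for x n
  proof (induction n)
    case (Suc n)
    then show ?case using diff[OF Suc neg[OF that]] by (simp add: algebra_simps)
  qed (simp add: assms(1))
  have imult: "k * x \<in> I" if "x \<in> I" for x k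
    using mult[OF that, of "nat k"] mult[OF neg[OF that], of "nat (- k)"] by (cases "k \<ge> 0") auto
  define m where "m = (LEAST n::nat. n > 0 \<and> int n \<in> I)"
  obtain x where "x \<in> I" "x \<noteq> 0" using False by auto
  then have "nat \<bar>x\<bar> > 0 \<and> int (nat \<bar>x\<bar>) \<in> I" using neg[of x] by (auto simp: abs_if)
  then have "m > 0 \<and> int m \<in> I" unfolding m_def by (rule LeastI)
  then have m: "m > 0" "int m \<in> I" by auto
  have "int m dvd x" if "x \<in> I" for x
  proof (rule ccontr)
    assume "\<not> int m dvd x"
    then have "x mod int m \<noteq> 0" by presburger
    then have "x mod int m > 0" using m pos_mod_sign[of "int m" x] by linarith
    moreover have "x mod int m \<in> I"
      using diff[OF that imult[OF m(2), of "x div int m"]]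
      by (simp add: minus_div_mult_eq_mod)
    ultimately have "nat (x mod int m) > 0 \<and> int (nat (x mod int m)) \<in> I" by simp
    then have "m \<le> nat (x mod int m)" unfolding m_def by (rule Least_le)
    then show False using m(1) pos_mod_bound[of "int m" x] by linarith
  qed
  then show ?thesis by (rule that[OF m(2)])
qed

lemma frag_cmul_diff_distrib2: "frag_cmul k (a - b) = frag_cmul k a - frag_cmul k b"
  using frag_cmul_distrib2[of k "a - b" b] by (simp add: algebra_simps)

text \<open>Subgroups of finitely generated abelian groups are finitely generated, by induction on
  the generators of the larger group. The possible coefficients at one generator \<open>f\<close>
  form an ideal of the integers; an element \<open>c0\<close> of \<open>A\<close> realising its
  generator \<open>m\<close> is added, and subtracting multiples of \<open>c0\<close> leaves
  elements that are expressed without \<open>f\<close>.\<close>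

lemma fg_mod_generators:
  assumes "fg_mod A B" and A: "frag_subgroup A" and B: "frag_subgroup B"
  shows "\<exists>F. finite F \<and> F \<subseteq> A \<and> (\<forall>a\<in>A. \<exists>s\<in>frag_span F. a - s \<in> B)"
proof -
  have "\<exists>F'. finite F' \<and> F' \<subseteq> A \<and> (\<forall>a\<in>A. \<exists>s\<in>frag_span F'. a - s \<in> B)"
    if "finite F" "frag_subgroup A" "\<forall>a\<in>A. \<exists>s\<in>frag_span F. a - s \<in> B" for A F
    using that
  proof (induction F arbitrary: A rule: finite_induct)
    case empty
    then show ?case by (intro exI[of _ "{}"] conjI finite.emptyI empty_subsetI)
  next
    case (insert f F)
    define P where "P c \<longleftrightarrow> (\<exists>s\<in>frag_span F. c - s \<in> B)" for c
    have P_diff: "P (c - d)" if cd: "P c" "P d" for c d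
    proof -
      obtain s t where st: "s \<in> frag_span F" "c - s \<in> B" "t \<in> frag_span F" "d - t \<in> B"
        using cd unfolding P_def by blast
      then have "(c - d) - (s - t) \<in> B"
        using frag_subgroup_diff[OF B st(2,4)] by (simp add: algebra_simps)
      then show ?thesis using st frag_subgroup_diff[OF frag_subgroup_span] P_def by blast
    qed
    have P0: "P 0" unfolding P_def using frag_subgroup_zero[OF B] frag_subgroup_zero[OF frag_subgroup_span]
      by (intro bexI[of _ 0]) auto
    define I where "I = {n. \<exists>c\<in>A. P (c - frag_cmul n f)}"
    have split: "\<exists>n. P (c - frag_cmul n f)" if c: "c \<in> A" for c
    proof -
      obtain s where s: "s \<in> frag_span (insert f F)" "c - s \<in> B" using insert.prems(2) c by blast
      obtain n y where "y \<in> frag_span F" "s = frag_cmul n f + y" using frag_span_insertD[OF s(1)] .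
      then have "P (c - frag_cmul n f)" unfolding P_def using s(2) by (auto simp: diff_diff_eq)
      then show ?thesis ..
    qed
    have I0: "0 \<in> I"
      unfolding I_def using frag_subgroup_zero[OF insert.prems(1)] P0
        by (intro CollectI bexI[of _ 0]) auto
    have I_diff: "x - y \<in> I" if xy: "x \<in> I" "y \<in> I" for x y
    proof -
      from xy obtain c d where cd: "c \<in> A" "d \<in> A" "P (c - frag_cmul x f)" "P (d - frag_cmul y f)"
        by (auto simp: I_def)
      then have "P ((c - d) - frag_cmul (x - y) f)"
        using P_diff[OF cd(3,4)] by (simp add: frag_cmul_diff_distrib algebra_simps)
      then show "x - y \<in> I"
        using frag_subgroup_diff[OF insert.prems(1) cd(1,2)] by (auto simp: I_def)
    qed
    obtain m where m: "m \<in> I" "\<And>x. x \<in> I \<Longrightarrow> m dvd x"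
      using int_subgroup_principal[OF I0 I_diff] by blast
    obtain c0 where c0: "c0 \<in> A" "P (c0 - frag_cmul m f)" using m(1) by (auto simp: I_def)
    have P_cmul: "P (frag_cmul k c)" if "P c" for k c
    proof -
      have "frag_subgroup {c. P c}" using P0 P_diff by (simp add: frag_subgroup_def)
      then show ?thesis using that frag_subgroup_cmul by blast
    qed
    have "frag_subgroup {a\<in>A. P a}"
      using insert.prems(1) P0 P_diff by (auto simp: frag_subgroup_def)
    moreover have "\<forall>a\<in>{a\<in>A. P a}. \<exists>s\<in>frag_span F. a - s \<in> B" by (auto simp: P_def)
    ultimately obtain F' where F': "finite F'" "F' \<subseteq> {a\<in>A. P a}"
      "\<forall>a\<in>{a\<in>A. P a}. \<exists>s\<in>frag_span F'. a - s \<in> B"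
      using insert.IH[of "{a\<in>A. P a}"] by blast
    have "\<exists>s\<in>frag_span (insert c0 F'). a - s \<in> B" if a: "a \<in> A" for a
    proof -
      obtain n where n: "P (a - frag_cmul n f)" using split[OF a] by blast
      then have "n \<in> I" using a by (auto simp: I_def)
      then obtain k where k: "n = m * k" using m(2) by (auto elim: dvdE)
      have "P ((a - frag_cmul n f) - frag_cmul k (c0 - frag_cmul m f))"
        by (rule P_diff[OF n P_cmul[OF c0(2)]])
      then have "P (a - frag_cmul k c0)"
        by (simp add: k frag_cmul_diff_distrib2 algebra_simps)
      moreover have "a - frag_cmul k c0 \<in> A"
        using a c0 insert.prems(1) frag_subgroup_cmul frag_subgroup_diff by blast
      ultimately obtain s where s: "s \<in> frag_span F'" "a - frag_cmul k c0 - s \<in> B" using F'(3) by blast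
      have "frag_cmul k c0 + s \<in> frag_span (insert c0 F')"
        using s(1) frag_span_mono[of F' "insert c0 F'"] frag_span_superset[of "insert c0 F'"]
        by (intro frag_subgroup_add frag_subgroup_cmul frag_subgroup_span) auto
      then show ?thesis using s(2) by (auto simp: diff_diff_eq)
    qed
    then show ?case using F' c0 by (intro exI[of _ "insert c0 F'"]) auto
  qed
  then show ?thesis using assms unfolding fg_mod_def by blast
qed

lemma fg_mod_sum:
  assumes "fg_mod A C" "fg_mod B C" "frag_subgroup C"
  shows "fg_mod {z. \<exists>x\<in>A. \<exists>y\<in>B. z - x - y \<in> C} C"
proof -
  obtain F G where F: "finite F" "\<forall>a\<in>A. \<exists>s\<in>frag_span F. a - s \<in> C"
    and G: "finite G" "\<forall>a\<in>B. \<exists>s\<in>frag_span G. a - s \<in> C"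
    using assms unfolding fg_mod_def by metis
  have "\<exists>s\<in>frag_span (F \<union> G). z - s \<in> C" if xy: "x \<in> A" "y \<in> B" "z - x - y \<in> C" for x y z
  proof -
    obtain s t where st: "s \<in> frag_span F" "x - s \<in> C" "t \<in> frag_span G" "y - t \<in> C"
      using xy F(2) G(2) by blast
    have "s + t \<in> frag_span (F \<union> G)"
      using st frag_span_mono[of F "F \<union> G"] frag_span_mono[of G "F \<union> G"]
      by (intro frag_subgroup_add frag_subgroup_span) auto
    moreover have "z - (s + t) = (z - x - y) + (x - s) + (y - t)" by simp
    moreover have "z - x - y + (x - s) + (y - t) \<in> C"
      using xy(3) st assms(3) by (intro frag_subgroup_add)
    ultimately have "z - (s + t) \<in> C" "s + t \<in> frag_span (F \<union> G)" by (simp_all only:)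
    then show ?thesis ..
  qed
  then show ?thesis unfolding fg_mod_def using F G by (intro exI[of _ "F \<union> G"]) auto
qed

text \<open>The extension step for an exact sequence \<open>A0 -> A -> Q / W\<close>, with
  \<open>R\<close> for the second map: generators of its image are lifted to \<open>A\<close>, and
  what the lifts miss lies in \<open>A0\<close>.\<close>

lemma fg_mod_extension:
  assumes A: "frag_subgroup A" and B: "frag_subgroup B" and W: "frag_subgroup W"
    and R_diff: "\<And>a b x y. R a x \<Longrightarrow> R b y \<Longrightarrow> R (a - b) (x - y)"
    and total: "\<And>a. a \<in> A \<Longrightarrow> \<exists>x\<in>Q. R a x"
    and Q: "frag_subgroup Q" "fg_mod Q W"
    and ker: "\<And>a x. R a x \<Longrightarrow> x \<in> W \<Longrightarrow> a \<in> A0"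
    and A0: "fg_mod A0 B"
  shows "fg_mod A B"
proof (cases "A = {}")
  case False
  \<comment> \<open>Generators can be lifted only if they are values at elements of
    \<open>A\<close>. They exist because the image is a subgroup of a finitely generated group,
    which is where \<open>fg_mod_generators\<close> enters.\<close>
  let ?E = "{x\<in>Q. \<exists>a\<in>A. R a x}"
  have R0: "R 0 0" using total False R_diff by (metis diff_self ex_in_conv)
  have E: "frag_subgroup ?E"
    unfolding frag_subgroup_def
  proof (intro conjI ballI)
    show "0 \<in> ?E" using R0 frag_subgroup_zero[OF A] frag_subgroup_zero[OF Q(1)] by blast
    fix x y assume "x \<in> ?E" "y \<in> ?E"
    then obtain a b where ab: "a \<in> A" "b \<in> A" "R a x" "R b y" "x \<in> Q" "y \<in> Q" by blast
    show "x - y \<in> ?E"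
      using R_diff[OF ab(3,4)] frag_subgroup_diff[OF A ab(1,2)] frag_subgroup_diff[OF Q(1) ab(5,6)] by blast
  qed
  obtain F where F: "finite F" "F \<subseteq> ?E" "\<And>x. x \<in> ?E \<Longrightarrow> \<exists>s\<in>frag_span F. x - s \<in> W"
  proof -
    have "?E \<subseteq> Q" by blast
    from fg_mod_generators[OF fg_mod_mono[OF Q(2) this subset_refl] E W]
    show ?thesis by (elim exE conjE, intro that) (assumption | erule bspec)+
  qed
  have "\<forall>x\<in>F. \<exists>a. a \<in> A \<and> R a x" using F(2) by blast
  then obtain g where "\<forall>x\<in>F. g x \<in> A \<and> R (g x) x" by (rule bchoice[THEN exE])
  then have g: "\<And>x. x \<in> F \<Longrightarrow> g x \<in> A \<and> R (g x) x" by blast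
  obtain F0 where F0: "finite F0" "\<forall>a\<in>A0. \<exists>s\<in>frag_span F0. a - s \<in> B" using A0 fg_mod_def by metis
  have lift: "\<exists>a\<in>frag_span (g ` F). R a s" if "s \<in> frag_span F" for s
  proof -
    have "frag_subgroup {s. \<exists>a\<in>frag_span (g ` F). R a s}"
      unfolding frag_subgroup_def using R0 R_diff frag_subgroup_zero[OF frag_subgroup_span[of "g ` F"]]
        frag_subgroup_diff[OF frag_subgroup_span[of "g ` F"]] by blast
    moreover have "F \<subseteq> {s. \<exists>a\<in>frag_span (g ` F). R a s}"
      using g frag_span_superset[of "g ` F"] by blast
    ultimately show ?thesis using that frag_span_minimal by blast
  qed
  have "\<exists>s\<in>frag_span (g ` F \<union> F0). a - s \<in> B" if a: "a \<in> A" for a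
  proof -
    obtain x where x: "x \<in> Q" "R a x" using total[OF a] by blast
    then obtain s where s: "s \<in> frag_span F" "x - s \<in> W" using F(3)[of x] a by blast
    obtain b where b: "b \<in> frag_span (g ` F)" "R b s" using lift[OF s(1)] by blast
    have "a - b \<in> A0" using ker[OF R_diff[OF x(2) b(2)] s(2)] .
    then obtain t where t: "t \<in> frag_span F0" "a - b - t \<in> B" using F0 by blast
    have "b + t \<in> frag_span (g ` F \<union> F0)"
      using b t frag_span_mono[of "g ` F" "g ` F \<union> F0"] frag_span_mono[of F0 "g ` F \<union> F0"]
      by (intro frag_subgroup_add frag_subgroup_span) auto
    then show ?thesis using t(2) by (auto simp: diff_diff_eq)
  qed
  then show ?thesis unfolding fg_mod_def using F(1) F0(1) by (intro exI[of _ "g ` F \<union> F0"]) auto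
qed (simp add: fg_mod_def; blast)

section \<open>Decomposition of a finitely generated quotient into cyclic summands\<close>

lemma frag_span_transpose:
  fixes k :: nat
  assumes "i < k" "j < k"
  shows "frag_span ((g(i := g j, j := g i)) ` {..<k}) = frag_span (g ` {..<k})"
proof -
  have "(g(i := g j, j := g i)) ` {..<k} = g ` {..<k}"
    using assms by (auto simp: image_iff)
  then show ?thesis by simp
qed

lemma frag_span_shear:
  fixes k :: nat
  assumes "j < k" "s \<in> frag_span (g ` ({..<k} - {j}))"
  shows "frag_span ((g(j := g j + s)) ` {..<k}) = frag_span (g ` {..<k})"
proof -
  have *: "frag_span (g' ` {..<k}) \<subseteq> frag_span (g ` {..<k})"
    if "g' = g(j := g j + s)" "s \<in> frag_span (g ` ({..<k} - {j}))" for g g' s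
  proof (rule frag_span_minimal[OF frag_subgroup_span])
    have "s \<in> frag_span (g ` {..<k})" using that(2) frag_span_mono[of "g ` ({..<k} - {j})" "g ` {..<k}"] by blast
    then have "g' i \<in> frag_span (g ` {..<k})" if "i < k" for i
      using that \<open>g' = _\<close> frag_span_superset[of "g ` {..<k}"]
      by (auto intro!: frag_subgroup_add frag_subgroup_span)
    then show "g' ` {..<k} \<subseteq> frag_span (g ` {..<k})" by auto
  qed
  have img: "(g(j := g j + s)) ` ({..<k} - {j}) = g ` ({..<k} - {j})" by auto
  have "- s \<in> frag_span (g ` ({..<k} - {j}))" using assms(2) frag_subgroup_uminus frag_subgroup_span by blast
  then show ?thesis
    using *[of "g(j := g j + s)" g s] *[of g "g(j := g j + s)" "- s"] assms(2) img by auto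
qed

text \<open>
  Among all generating tuples and all relations between their members, a smallest positive
  coefficient divides the other coefficients of its relation and splits off a cyclic factor.
\<close>
lemma cyclic_decomposition_span:
  fixes k :: nat
  assumes B: "frag_subgroup B"
  shows "\<exists>g' q. frag_span (g' ` {..<k}) = frag_span (g ` {..<k}) \<and>
    (\<forall>n. (\<Sum>i<k. frag_cmul (n i) (g' i)) \<in> B \<longleftrightarrow> (\<forall>i<k. int (q i) dvd n i))"
proof (induction k arbitrary: g)
  case 0
  then show ?case using frag_subgroup_zero[OF B] by auto
next
  case (Suc k)
  define T where "T m \<longleftrightarrow> m > 0 \<and> (\<exists>g' n. frag_span (g' ` {..<Suc k}) = frag_span (g ` {..<Suc k}) \<and>
      (\<Sum>i<Suc k. frag_cmul (n i) (g' i)) \<in> B \<and> n k = int m)" for m :: nat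
  \<comment> \<open>Swapping \<open>j\<close> with the last index and adjusting the sign turns any
    nonzero coefficient of any relation into a positive last coefficient.\<close>
  have T: "T (nat \<bar>n j\<bar>)"
    if span: "frag_span (g' ` {..<Suc k}) = frag_span (g ` {..<Suc k})"
      and rel: "(\<Sum>i<Suc k. frag_cmul (n i) (g' i)) \<in> B" and j: "j < Suc k" "n j \<noteq> 0" for g' n j
  proof -
    define g'' where "g'' = g'(j := g' k, k := g' j)"
    define n' where "n' i = sgn (n j) * (n(j := n k, k := n j)) i" for i
    have bij: "bij_betw (Transposition.transpose j k) {..<Suc k} {..<Suc k}"
      using j by (intro bij_betw_byWitness[of _ "Transposition.transpose j k"]) (auto simp: Transposition.transpose_def)
    have "(\<Sum>i<Suc k. frag_cmul (n' i) (g'' i))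
        = (\<Sum>i<Suc k. frag_cmul (sgn (n j)) (frag_cmul (n (Transposition.transpose j k i)) (g' (Transposition.transpose j k i))))"
      by (intro sum.cong) (auto simp: n'_def g''_def Transposition.transpose_def frag_cmul_cmul)
    also have "\<dots> = frag_cmul (sgn (n j)) (\<Sum>i<Suc k. frag_cmul (n (Transposition.transpose j k i)) (g' (Transposition.transpose j k i)))"
      by (simp only: frag_cmul_sum)
    also have "(\<Sum>i<Suc k. frag_cmul (n (Transposition.transpose j k i)) (g' (Transposition.transpose j k i))) = (\<Sum>i<Suc k. frag_cmul (n i) (g' i))"
      by (rule sum.reindex_bij_betw[OF bij])
    finally have "(\<Sum>i<Suc k. frag_cmul (n' i) (g'' i)) \<in> B"
      using frag_subgroup_cmul[OF B rel] by simp
    moreover have "n' k = int (nat \<bar>n j\<bar>)" by (auto simp: n'_def sgn_if)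
    moreover have "frag_span (g'' ` {..<Suc k}) = frag_span (g ` {..<Suc k})"
      using frag_span_transpose[of j "Suc k" k g'] j span unfolding g''_def by simp
    moreover have "nat \<bar>n j\<bar> > 0" using j by simp
    ultimately show ?thesis unfolding T_def by blast
  qed
  show ?case
  proof (cases "\<exists>m. T m")
    \<comment> \<open>No nontrivial relation: all summands are infinite cyclic, which the order
      \<open>0\<close> encodes.\<close>
    case False
    have "\<forall>i<Suc k. int 0 dvd n i" if "(\<Sum>i<Suc k. frag_cmul (n i) (g i)) \<in> B" for n
      using T[of g n] that False by auto
    moreover have "(\<Sum>i<Suc k. frag_cmul (n i) (g i)) \<in> B" if "\<forall>i<Suc k. int 0 dvd n i" for n
      using that frag_subgroup_zero[OF B] by simp
    ultimately show ?thesis by (intro exI[of _ g] exI[of _ "\<lambda>_. 0"]) blast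
  next
    case True
    define m where "m = (LEAST m. T m)"
    have Tm: "T m" unfolding m_def using True by (rule LeastI_ex)
    have least: "m \<le> m'" if "T m'" for m' unfolding m_def using that by (rule Least_le)
    from Tm have "m > 0" by (simp add: T_def)
    from Tm obtain g' n where g': "frag_span (g' ` {..<Suc k}) = frag_span (g ` {..<Suc k})"
      "(\<Sum>i<Suc k. frag_cmul (n i) (g' i)) \<in> B" "n k = int m" by (auto simp: T_def)
    \<comment> \<open>Replacing \<open>g' k\<close> by \<open>g' k + t * g' i\<close> turns the
      coefficient \<open>n i\<close> into its remainder modulo \<open>m\<close>. A nonzero remainder
      would satisfy \<open>T\<close> and be smaller than \<open>m\<close>.\<close>
    have dvd: "int m dvd n i" if i: "i < k" for i
    proof (rule ccontr)
      assume nd: "\<not> int m dvd n i"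
      define t where "t = n i div int m"
      define h where "h = g'(k := g' k + frag_cmul t (g' i))"
      define n' where "n' = n(i := n i mod int m)"
      have span: "frag_span (h ` {..<Suc k}) = frag_span (g ` {..<Suc k})"
        unfolding h_def g'(1)[symmetric]
        by (rule frag_span_shear)
          (use i frag_span_superset[of "g' ` ({..<Suc k} - {k})"] in
            \<open>auto intro!: frag_subgroup_cmul frag_subgroup_span\<close>)
      have "(\<Sum>j<k. frag_cmul (n' j) (h j)) =
          (\<Sum>j<k. frag_cmul (n j) (g' j) - (if j = i then frag_cmul (int m * t) (g' i) else 0))"
      proof (rule sum.cong)
        fix j assume "j \<in> {..<k}"
        moreover have "n i mod int m = n i - int m * t" by (simp add: t_def minus_mult_div_eq_mod)
        ultimately show "frag_cmul (n' j) (h j) = frag_cmul (n j) (g' j) - (if j = i then frag_cmul (int m * t) (g' i) else 0)"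
          by (auto simp: n'_def h_def frag_cmul_diff_distrib)
      qed simp
      then have "(\<Sum>j<Suc k. frag_cmul (n' j) (h j)) = (\<Sum>j<Suc k. frag_cmul (n j) (g' j))"
        using i by (simp add: sum_subtractf h_def n'_def g'(3) frag_cmul_distrib2 frag_cmul_cmul)
      then have "T (nat \<bar>n' i\<bar>)"
        using T[OF span, of n' i] i g'(2) nd by (auto simp: n'_def dvd_eq_mod_eq_0)
      then have "m \<le> nat \<bar>n i mod int m\<bar>" using least by (simp add: n'_def)
      moreover have "0 \<le> n i mod int m" "n i mod int m < int m" using \<open>m > 0\<close> by auto
      ultimately show False by linarith
    qed
    define t where "t i = n i div int m" for i
    have nt: "n i = int m * t i" if "i < k" for i using dvd[OF that] by (simp add: t_def)
    \<comment> \<open>All coefficients are multiples of \<open>m\<close>, so the relation reads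
      \<open>m * (g' k + s)\<close>: the sheared last generator is annihilated by \<open>m\<close>
      modulo \<open>B\<close>.\<close>
    define s where "s = (\<Sum>i<k. frag_cmul (t i) (g' i))"
    define h where "h = g'(k := g' k + s)"
    have "s \<in> frag_span (g' ` {..<k})" unfolding s_def frag_span_image by blast
    moreover have "{..<Suc k} - {k} = {..<k}" by auto
    ultimately have span: "frag_span (h ` {..<Suc k}) = frag_span (g ` {..<Suc k})"
      unfolding h_def g'(1)[symmetric] by (intro frag_span_shear) auto
    have "frag_cmul (int m) (h k) = (\<Sum>i<Suc k. frag_cmul (n i) (g' i))"
      by (simp add: h_def s_def frag_cmul_distrib2 frag_cmul_sum frag_cmul_cmul nt g'(3))
    then have mh: "frag_cmul (int m) (h k) \<in> B" using g'(2) by simp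
    obtain g0 q where g0: "frag_span (g0 ` {..<k}) = frag_span (h ` {..<k})"
      "\<And>n. (\<Sum>i<k. frag_cmul (n i) (g0 i)) \<in> B \<longleftrightarrow> (\<forall>i<k. int (q i) dvd n i)"
      using Suc.IH[of h] by blast
    define g1 where "g1 = g0(k := h k)"
    have g1k: "g1 ` {..<k} = g0 ` {..<k}" by (auto simp: g1_def)
    have 1: "frag_span (insert (h k) (g0 ` {..<k})) = frag_span (insert (h k) (h ` {..<k}))"
    proof -
      have *: "frag_span (insert x F) \<subseteq> frag_span (insert x G)" if "frag_span F = frag_span G" for x F G
        using frag_span_superset[of F] frag_span_superset[of "insert x G"] frag_span_mono[of G "insert x G"] that
        by (intro frag_span_minimal[OF frag_subgroup_span]) auto
      show ?thesis using *[OF g0(1)] *[OF g0(1)[symmetric]] by blast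
    qed
    have img: "g1 ` {..<Suc k} = insert (h k) (g0 ` {..<k})" "h ` {..<Suc k} = insert (h k) (h ` {..<k})"
      by (auto simp: g1_def lessThan_Suc)
    have span1: "frag_span (g1 ` {..<Suc k}) = frag_span (g ` {..<Suc k})"
      using 1 span by (simp only: img)
    have g1_sum: "(\<Sum>i<Suc k. frag_cmul (c i) (g1 i)) = (\<Sum>i<k. frag_cmul (c i) (g0 i)) + frag_cmul (c k) (h k)" for c
      by (simp add: g1_def)
    \<comment> \<open>Subtracting a multiple of the relation \<open>m * h k\<close> reduces the last
      coefficient modulo \<open>m\<close>, and minimality forbids a nonzero remainder. Hence
      \<open>h k\<close> generates a direct summand of order exactly \<open>m\<close>.\<close>
    have dvd_k: "int m dvd c k" if c: "(\<Sum>i<Suc k. frag_cmul (c i) (g1 i)) \<in> B" for c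
    proof (rule ccontr)
      assume nd: "\<not> int m dvd c k"
      define c' where "c' = c(k := c k mod int m)"
      have "c k mod int m = c k - (c k div int m) * int m" by (simp add: minus_div_mult_eq_mod)
      then have "(\<Sum>i<Suc k. frag_cmul (c' i) (g1 i))
          = (\<Sum>i<Suc k. frag_cmul (c i) (g1 i)) - frag_cmul (c k div int m) (frag_cmul (int m) (h k))"
        unfolding g1_sum by (simp add: c'_def frag_cmul_diff_distrib frag_cmul_cmul)
      also have "\<dots> \<in> B" by (intro frag_subgroup_diff[OF B] c frag_subgroup_cmul[OF B] mh)
      finally have "T (nat \<bar>c' k\<bar>)"
        using T[OF span1, of c' k] nd by (auto simp: c'_def dvd_eq_mod_eq_0)
      then have "m \<le> nat \<bar>c k mod int m\<bar>" using least by (simp add: c'_def)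
      moreover have "0 \<le> c k mod int m" "c k mod int m < int m" using \<open>m > 0\<close> by auto
      ultimately show False by linarith
    qed
    have mem: "frag_cmul x (h k) \<in> B" if dvd_x: "int m dvd x" for x
    proof -
      obtain u where "x = u * int m" using dvd_x by (metis dvd_def mult.commute)
      then show ?thesis using frag_subgroup_cmul[OF B mh, of u] by (simp add: frag_cmul_cmul)
    qed
    define q1 where "q1 = q(k := m)"
    have "(\<Sum>i<Suc k. frag_cmul (c i) (g1 i)) \<in> B \<longleftrightarrow> (\<forall>i<Suc k. int (q1 i) dvd c i)" for c
    proof -
      have "(\<Sum>i<Suc k. frag_cmul (c i) (g1 i)) \<in> B \<longleftrightarrow>
          int m dvd c k \<and> (\<Sum>i<k. frag_cmul (c i) (g0 i)) \<in> B"
        (is "?l \<longleftrightarrow> ?d \<and> ?r")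
      proof -
        have "?d" if ?l using dvd_k[OF that] .
        moreover have "?l \<longleftrightarrow> ?r" if ?d
          unfolding g1_sum using frag_subgroup_diff_iff[OF B, of "_ + frag_cmul (c k) (h k)" "_"] mem[OF that] by simp
        ultimately show ?thesis by blast
      qed
      also have "\<dots> \<longleftrightarrow> (\<forall>i<Suc k. int (q1 i) dvd c i)"
        unfolding g0(2) by (auto simp: q1_def less_Suc_eq)
      finally show ?thesis .
    qed
    then show ?thesis using span1 by blast
  qed
qed

text \<open>\<open>q i\<close> is the order of the \<open>i\<close>-th summand, where
  \<open>0\<close> means infinite order and \<open>1\<close> a trivial summand.\<close>

lemma cyclic_decomposition:
  assumes A: "frag_subgroup A" and B: "frag_subgroup B" and fg: "fg_mod A B"
  obtains k :: nat and g q where "\<And>i. i < k \<Longrightarrow> g i \<in> A"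
    "\<And>a. a \<in> A \<Longrightarrow> \<exists>n. a - (\<Sum>i<k. frag_cmul (n i) (g i)) \<in> B"
    "\<And>n. (\<Sum>i<k. frag_cmul (n i) (g i)) \<in> B \<longleftrightarrow> (\<forall>i<k. int (q i) dvd n i)"
proof -
  obtain F where F: "finite F" "F \<subseteq> A" "\<And>a. a \<in> A \<Longrightarrow> \<exists>s\<in>frag_span F. a - s \<in> B"
    using fg_mod_generators[OF fg A B] by blast
  obtain g0 :: "nat \<Rightarrow> _" and k where "F = g0 ` {..<k}"
    using finite_imp_nat_seg_image_inj_on[OF F(1)] by (metis lessThan_def)
  moreover obtain g q where g: "frag_span (g ` {..<k}) = frag_span (g0 ` {..<k})"
    "\<And>n. (\<Sum>i<k. frag_cmul (n i) (g i)) \<in> B \<longleftrightarrow> (\<forall>i<k. int (q i) dvd n i)"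
    using cyclic_decomposition_span[OF B, where g = g0 and k = k] by blast
  ultimately have span: "frag_span (g ` {..<k}) = frag_span F" by simp
  show ?thesis
  proof (rule that[of k g q])
    show "g i \<in> A" if "i < k" for i
      using that frag_span_superset[of "g ` {..<k}"] span frag_span_minimal[OF A F(2)] by auto
    show "\<exists>n. a - (\<Sum>i<k. frag_cmul (n i) (g i)) \<in> B" if "a \<in> A" for a
      using F(3)[OF that] unfolding span[symmetric] frag_span_image by blast
  qed (rule g(2))
qed

section \<open>Singular homology of compact manifolds is finitely generated\<close>

abbreviation cycles_in :: "'a topology \<Rightarrow> 'a set \<Rightarrow> nat \<Rightarrow> 'a chain set" where
  "cycles_in M V p \<equiv> singular_cycles p (subtopology M V)"

abbreviation boundaries_in :: "'a topology \<Rightarrow> 'a set \<Rightarrow> nat \<Rightarrow> 'a chain set" where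
  "boundaries_in M V p \<equiv> singular_boundaries p (subtopology M V)"

lemma singular_cycles_sub_iff:
  "c \<in> cycles_in M V p \<longleftrightarrow>
     singular_chain p (subtopology M V) c \<and> chain_boundary p c = 0"
  by (simp add: singular_cycles_def singular_cycle)

lemma singular_boundaries_sub_iff:
  "c \<in> boundaries_in M V p \<longleftrightarrow>
     (\<exists>d. singular_chain (Suc p) (subtopology M V) d \<and> chain_boundary (Suc p) d = c)"
  by (simp add: singular_boundaries_def singular_boundary)

lemma singular_boundaries_mono:
  "V \<subseteq> U \<Longrightarrow> boundaries_in M V p \<subseteq> boundaries_in M U p"
  by (auto simp: singular_boundaries_def intro: singular_boundary_mono)

text \<open>Cycles of \<open>V\<close> modulo boundaries of \<open>U\<close> describe the image of
  \<open>H(V)\<close> in \<open>H(U)\<close>. Vanishing in high degrees is included because one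
  finite metric space must serve all degrees at once.\<close>

definition tame_pair :: "'a topology \<Rightarrow> 'a set \<Rightarrow> 'a set \<Rightarrow> bool" where
  "tame_pair M V U \<longleftrightarrow>
     (\<forall>p. fg_mod (cycles_in M V p) (boundaries_in M U p)) \<and>
     (\<exists>N. \<forall>p\<ge>N. cycles_in M V p \<subseteq> boundaries_in M U p)"

definition tame_nhds :: "'a topology \<Rightarrow> 'a set \<Rightarrow> bool" where
  "tame_nhds M K \<longleftrightarrow> (\<forall>U. openin M U \<and> K \<subseteq> U \<longrightarrow>
     (\<exists>V. openin M V \<and> K \<subseteq> V \<and> V \<subseteq> U \<and> tame_pair M V U))"

lemma tame_nhdsD:
  assumes "tame_nhds M K" "openin M U" "K \<subseteq> U"
  obtains V where "openin M V" "K \<subseteq> V" "V \<subseteq> U" "tame_pair M V U"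
  using assms(1)[unfolded tame_nhds_def, rule_format, OF conjI[OF assms(2,3)]] by (elim exE conjE)

lemma tame_pair_subset:
  assumes "\<And>p. fg_mod (cycles_in M V p) (boundaries_in M U p)"
    and "\<And>p. p \<ge> N \<Longrightarrow> cycles_in M V p \<subseteq> boundaries_in M U p"
  shows "tame_pair M V U"
  using assms unfolding tame_pair_def by blast

text \<open>A cycle is homologous to one whose simplices each lie in \<open>V1\<close> or in
  \<open>V2\<close>, and these simplices are then sorted into two chains.\<close>

lemma singular_cycles_split:
  assumes "openin M V1" "openin M V2" and z: "z \<in> cycles_in M (V1 \<union> V2) p"
  obtains a b where "singular_chain p (subtopology M V1) a" "singular_chain p (subtopology M V2) b"
    "z - (a + b) \<in> boundaries_in M (V1 \<union> V2) p" "chain_boundary p (a + b) = 0"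
proof -
  let ?X = "subtopology M (V1 \<union> V2)"
  obtain z' where z': "singular_relcycle p ?X {} z'" "homologous_rel p ?X {} z z'"
    "\<And>f. f \<in> Poly_Mapping.keys z' \<Longrightarrow> \<exists>V\<in>{V1, V2}. f \<in> standard_simplex p \<rightarrow> V"
  proof (rule small_homologous_rel_relcycle_exists[of "{V1, V2}" ?X p "{}" z])
    show "openin ?X U" if "U \<in> {V1, V2}" for U
      using that assms(1,2) by (auto simp: openin_open_subtopology openin_Un)
    show "topspace ?X \<subseteq> \<Union>{V1, V2}" by auto
  qed (use z in \<open>auto simp: singular_cycles_def\<close>)
  have chain: "singular_chain p ?X z'" using z'(1) by (simp add: singular_cycle)
  have "f \<in> singular_simplex_set p (subtopology M V1) \<union> singular_simplex_set p (subtopology M V2)"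
    if f: "f \<in> Poly_Mapping.keys z'" for f
  proof -
    have "singular_simplex p M f" using chain f
      by (auto simp: singular_chain_def singular_simplex_subtopology)
    then show ?thesis using z'(3)[OF f] by (auto simp: singular_simplex_subtopology Pi_iff)
  qed
  then obtain a b where ab: "Poly_Mapping.keys a \<subseteq> singular_simplex_set p (subtopology M V1)"
    "Poly_Mapping.keys b \<subseteq> singular_simplex_set p (subtopology M V2)" "a + b = z'"
    by (meson frag_split subsetI)
  show ?thesis
  proof (rule that[of a b])
    show "z - (a + b) \<in> singular_boundaries p ?X"
      using z'(2) ab(3) by (simp add: homologous_rel_def singular_boundaries_def)
    show "chain_boundary p (a + b) = 0" using z'(1) ab(3) by (simp add: singular_cycle)
  qed (use ab in \<open>simp_all add: singular_chain_def\<close>)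
qed

text \<open>Exactness of the Mayer-Vietoris sequence across two levels of neighbourhoods. The
  connecting class of a cycle \<open>a + b\<close> on \<open>V1 \<union> V2\<close> is that of the
  boundary of \<open>a\<close>, a cycle in \<open>W\<close>. If it is filled by \<open>c\<close> in
  \<open>U1 \<inter> U2\<close>, then \<open>a + b\<close> is the sum of the cycles
  \<open>a - c\<close> in \<open>U1\<close> and \<open>b + c\<close> in \<open>U2\<close>.\<close>

lemma singular_cycles_Un_fg_mod:
  assumes open12: "openin M V1" "openin M V2"
    and sub: "V1 \<subseteq> U1" "V2 \<subseteq> U2" "U1 \<subseteq> U" "U2 \<subseteq> U" "V1 \<inter> V2 \<subseteq> W"
    and fg1: "fg_mod (cycles_in M U1 p) (boundaries_in M U p)"
    and fg2: "fg_mod (cycles_in M U2 p) (boundaries_in M U p)"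
    and fgW: "p > 0 \<Longrightarrow> fg_mod (cycles_in M W (p - 1))
               (boundaries_in M (U1 \<inter> U2) (p - 1))"
  shows "fg_mod (cycles_in M (V1 \<union> V2) p) (boundaries_in M U p)"
    (is "fg_mod ?A ?B")
    and "\<lbrakk>cycles_in M U1 p \<subseteq> boundaries_in M U p;
      cycles_in M U2 p \<subseteq> boundaries_in M U p; p > 0;
      cycles_in M W (p - 1) \<subseteq> boundaries_in M (U1 \<inter> U2) (p - 1)\<rbrakk>
      \<Longrightarrow> cycles_in M (V1 \<union> V2) p \<subseteq> boundaries_in M U p"
proof -
  let ?Z1 = "cycles_in M U1 p" and ?Z2 = "cycles_in M U2 p"
  let ?Q = "cycles_in M W (p - 1)"
  let ?W = "boundaries_in M (U1 \<inter> U2) (p - 1)"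
  define A0 where "A0 = {z. \<exists>x\<in>?Z1. \<exists>y\<in>?Z2. z - x - y \<in> ?B}"
  \<comment> \<open>The graph of the connecting map. Its value depends on how \<open>z\<close> is
    split, so it is a relation.\<close>
  define R where "R z e \<longleftrightarrow> (\<exists>a b. singular_chain p (subtopology M V1) a \<and> singular_chain p (subtopology M V2) b \<and>
     z - (a + b) \<in> boundaries_in M (V1 \<union> V2) p \<and> chain_boundary p (a + b) = 0 \<and>
     e = chain_boundary p a)" for z e
  have fgA0: "fg_mod A0 ?B"
    unfolding A0_def by (rule fg_mod_sum[OF fg1 fg2 frag_subgroup_singular_boundaries])
  have R_diff: "R (z - z') (e - e')" if R: "R z e" "R z' e'" for z z' e e'
  proof -
    obtain a b where ab: "singular_chain p (subtopology M V1) a" "singular_chain p (subtopology M V2) b"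
      "z - (a + b) \<in> boundaries_in M (V1 \<union> V2) p" "chain_boundary p (a + b) = 0"
      "e = chain_boundary p a" using R(1) unfolding R_def by blast
    obtain a' b' where ab': "singular_chain p (subtopology M V1) a'" "singular_chain p (subtopology M V2) b'"
      "z' - (a' + b') \<in> boundaries_in M (V1 \<union> V2) p" "chain_boundary p (a' + b') = 0"
      "e' = chain_boundary p a'" using R(2) unfolding R_def by blast
    show ?thesis
      unfolding R_def
    proof (rule exI[of _ "a - a'"], rule exI[of _ "b - b'"], intro conjI)
      have "(z - (a + b)) - (z' - (a' + b')) \<in> boundaries_in M (V1 \<union> V2) p"
        using frag_subgroup_diff[OF frag_subgroup_singular_boundaries ab(3) ab'(3)] .
      moreover have "(z - (a + b)) - (z' - (a' + b')) = (z - z') - ((a - a') + (b - b'))" by simp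
      ultimately show "(z - z') - ((a - a') + (b - b')) \<in> boundaries_in M (V1 \<union> V2) p"
        by (simp only:)
      have "(a - a') + (b - b') = (a + b) - (a' + b')" by simp
      then show "chain_boundary p ((a - a') + (b - b')) = 0"
        using ab(4) ab'(4) by (simp only: chain_boundary_diff) simp
      show "e - e' = chain_boundary p (a - a')" using ab(5) ab'(5) by (simp add: chain_boundary_diff)
    qed (use ab ab' singular_chain_diff in blast)+
  qed
  have ker: "z \<in> A0"
    if V: "singular_chain p (subtopology M V1) a" "singular_chain p (subtopology M V2) b"
      "z - (a + b) \<in> boundaries_in M (V1 \<union> V2) p" "chain_boundary p (a + b) = 0"
      and c: "singular_chain p (subtopology M (U1 \<inter> U2)) c" "chain_boundary p a = chain_boundary p c"
    for z a b c
  proof -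
    have c1: "singular_chain p (subtopology M U1) c" "singular_chain p (subtopology M U2) c"
      using c(1) by (auto intro: singular_chain_mono)
    have a1: "singular_chain p (subtopology M U1) a" using V(1) sub by (auto intro: singular_chain_mono)
    have b1: "singular_chain p (subtopology M U2) b" using V(2) sub by (auto intro: singular_chain_mono)
    have "chain_boundary p (b + c) = 0"
      using V(4) c(2) by (simp add: chain_boundary_add add.commute)
    then have "b + c \<in> ?Z2" using b1 c1 by (simp add: singular_cycles_sub_iff singular_chain_add)
    moreover have "a - c \<in> ?Z1"
      using a1 c1 c(2) by (simp add: singular_cycles_sub_iff singular_chain_diff chain_boundary_diff)
    moreover have "z - (a - c) - (b + c) \<in> ?B"
    proof -
      have "V1 \<union> V2 \<subseteq> U" using sub by blast
      then have "z - (a + b) \<in> ?B" using V(3) singular_boundaries_mono by blast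
      moreover have "z - (a - c) - (b + c) = z - (a + b)" by (simp add: algebra_simps)
      ultimately show ?thesis by (simp only:)
    qed
    ultimately show ?thesis unfolding A0_def by blast
  qed
  have total: "\<exists>e\<in>?Q. R z e" if z: "z \<in> ?A" and p: "p > 0" for z
  proof -
    obtain a b where ab: "singular_chain p (subtopology M V1) a" "singular_chain p (subtopology M V2) b"
      "z - (a + b) \<in> boundaries_in M (V1 \<union> V2) p" "chain_boundary p (a + b) = 0"
      using singular_cycles_split[OF open12 z] by blast
    have a_eq: "chain_boundary p a = - chain_boundary p b"
      using ab(4) by (simp add: chain_boundary_add eq_neg_iff_add_eq_0)
    have "singular_chain (p - 1) (subtopology M V1) (chain_boundary p a)"
      using singular_chain_boundary[OF ab(1)] by simp
    moreover have "singular_chain (p - 1) (subtopology M V2) (chain_boundary p a)"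
      using singular_chain_boundary[OF ab(2)] by (simp add: a_eq singular_chain_minus)
    ultimately have "singular_chain (p - 1) (subtopology M (V1 \<inter> V2)) (chain_boundary p a)"
      by (auto simp: singular_chain_subtopology)
    then have "singular_chain (p - 1) (subtopology M W) (chain_boundary p a)"
      using sub(5) singular_chain_mono by blast
    moreover have "chain_boundary (p - 1) (chain_boundary p a) = 0"
      using chain_boundary_boundary[OF ab(1)] by simp
    ultimately have "chain_boundary p a \<in> ?Q" by (simp add: singular_cycles_sub_iff)
    then show ?thesis using ab unfolding R_def by blast
  qed
  have R_ker: "z \<in> A0" if R: "R z e" "e \<in> ?W" and p: "p > 0" for z e
  proof -
    have "Suc (p - 1) = p" using p by simp
    then obtain c where c: "singular_chain p (subtopology M (U1 \<inter> U2)) c" "chain_boundary p c = e"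
      using R(2) unfolding singular_boundaries_sub_iff by auto
    obtain a b where ab: "singular_chain p (subtopology M V1) a" "singular_chain p (subtopology M V2) b"
      "z - (a + b) \<in> boundaries_in M (V1 \<union> V2) p" "chain_boundary p (a + b) = 0"
      "e = chain_boundary p a" using R(1) unfolding R_def by blast
    show ?thesis by (rule ker[OF ab(1-4) c(1)]) (use ab c in simp)
  qed
  show "fg_mod ?A ?B"
  proof (cases "p = 0")
    \<comment> \<open>In degree 0 every chain is a cycle, so a splitting is already a sum of cycles
      and \<open>c = 0\<close> will do.\<close>
    case True
    have "?A \<subseteq> A0"
    proof
      fix z assume z: "z \<in> ?A"
      obtain a b where ab: "singular_chain p (subtopology M V1) a" "singular_chain p (subtopology M V2) b"
        "z - (a + b) \<in> boundaries_in M (V1 \<union> V2) p" "chain_boundary p (a + b) = 0"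
        using singular_cycles_split[OF open12 z] by blast
      show "z \<in> A0" by (rule ker[OF ab singular_chain_0]) (simp add: True chain_boundary_def)
    qed
    then show ?thesis using fg_mod_mono[OF fgA0] by blast
  next
    case False
    then have p: "p > 0" by simp
    show ?thesis
      by (rule fg_mod_extension[where R = R, OF frag_subgroup_singular_cycles frag_subgroup_singular_boundaries
            frag_subgroup_singular_boundaries R_diff total[OF _ p] frag_subgroup_singular_cycles fgW[OF p]
            R_ker[OF _ _ p] fgA0])
  qed
  show "?A \<subseteq> ?B" if Z: "?Z1 \<subseteq> ?B" "?Z2 \<subseteq> ?B" and p: "p > 0" and QW: "?Q \<subseteq> ?W"
  proof
    fix z assume "z \<in> ?A"
    then obtain e where "e \<in> ?Q" "R z e" using total p by blast
    then have "z \<in> A0" using R_ker QW p by blast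
    then obtain x y where xy: "x \<in> ?B" "y \<in> ?B" "z - x - y \<in> ?B" unfolding A0_def using Z by blast
    then have "(z - x - y) + x + y \<in> ?B" by (intro frag_subgroup_add frag_subgroup_singular_boundaries)
    then show "z \<in> ?B" by simp
  qed
qed

lemma tame_nhds_Un:
  assumes haus: "Hausdorff_space M" and K: "compactin M K" "compactin M L"
    and tame: "tame_nhds M K" "tame_nhds M L" "tame_nhds M (K \<inter> L)"
  shows "tame_nhds M (K \<union> L)"
  unfolding tame_nhds_def
proof (intro allI impI, elim conjE)
  fix U assume U: "openin M U" "K \<union> L \<subseteq> U"
  obtain U1 where U1: "openin M U1" "K \<subseteq> U1" "U1 \<subseteq> U" "tame_pair M U1 U"
    using tame_nhdsD[OF tame(1) U(1)] U(2) by blast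
  obtain U2 where U2: "openin M U2" "L \<subseteq> U2" "U2 \<subseteq> U" "tame_pair M U2 U"
    using tame_nhdsD[OF tame(2) U(1)] U(2) by blast
  have "openin M (U1 \<inter> U2)" "K \<inter> L \<subseteq> U1 \<inter> U2" using U1 U2 by auto
  then obtain W where W: "openin M W" "K \<inter> L \<subseteq> W" "W \<subseteq> U1 \<inter> U2" "tame_pair M W (U1 \<inter> U2)"
    by (rule tame_nhdsD[OF tame(3)])
  obtain N1 N2 N3 where
    N1: "\<And>p. p \<ge> N1 \<Longrightarrow> cycles_in M U1 p \<subseteq> boundaries_in M U p" and
    N2: "\<And>p. p \<ge> N2 \<Longrightarrow> cycles_in M U2 p \<subseteq> boundaries_in M U p" and
    N3: "\<And>p. p \<ge> N3 \<Longrightarrow> cycles_in M W p \<subseteq> boundaries_in M (U1 \<inter> U2) p"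
    using U1(4) U2(4) W(4) unfolding tame_pair_def by metis
  note fg = U1(4)[unfolded tame_pair_def, THEN conjunct1, rule_format]
    U2(4)[unfolded tame_pair_def, THEN conjunct1, rule_format]
    W(4)[unfolded tame_pair_def, THEN conjunct1, rule_format]
  \<comment> \<open>The smaller neighbourhoods must meet only inside \<open>W\<close>. Outside
    \<open>W\<close> the two compact sets are disjoint and are separated by \<open>S\<close> and
    \<open>T\<close>; then \<open>(W \<union> S) \<inter> (W \<union> T) = W\<close>.\<close>
  have KW: "compactin M (K - W)" "compactin M (L - W)"
    using K W(1) haus by (metis Diff_subset closed_compactin closedin_diff compactin_imp_closedin)+
  have "disjnt (K - W) (L - W)" using W(2) by (auto simp: disjnt_def)
  then obtain S T where ST: "openin M S" "openin M T" "K - W \<subseteq> S" "L - W \<subseteq> T" "disjnt S T"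
    using Hausdorff_space_compact_separation[OF haus KW] by blast
  define V1 where "V1 = U1 \<inter> (W \<union> S)"
  define V2 where "V2 = U2 \<inter> (W \<union> T)"
  have V: "openin M V1" "openin M V2" "V1 \<subseteq> U1" "V2 \<subseteq> U2" "V1 \<inter> V2 \<subseteq> W" "K \<subseteq> V1" "L \<subseteq> V2"
    using ST U1 U2 W unfolding V1_def V2_def by (auto simp: disjnt_def)
  note mv = singular_cycles_Un_fg_mod[OF V(1-4) U1(3) U2(3) V(5) fg]
  have "tame_pair M (V1 \<union> V2) U"
  proof (rule tame_pair_subset)
    \<comment> \<open>The summand 1 pays for the use of \<open>W\<close> in degree
      \<open>p - 1\<close>.\<close>
    show "cycles_in M (V1 \<union> V2) p \<subseteq> boundaries_in M U p"
      if p: "p \<ge> N1 + N2 + N3 + 1" for p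
      by (rule mv(2)[OF N1 N2 _ N3]) (use p in auto)
  qed (rule mv(1))
  moreover have "openin M (V1 \<union> V2)" "K \<union> L \<subseteq> V1 \<union> V2" "V1 \<union> V2 \<subseteq> U" using V U1 U2 by auto
  ultimately show "\<exists>V. openin M V \<and> K \<union> L \<subseteq> V \<and> V \<subseteq> U \<and> tame_pair M V U"
    by blast
qed

lemma tame_nhds_empty: "tame_nhds M {}"
proof -
  have *: "singular_cycles p (subtopology M {}) \<subseteq> boundaries_in M U p" for p U
    using frag_subgroup_zero[OF frag_subgroup_singular_boundaries]
    by (auto simp: singular_cycles_def singular_cycle singular_chain_empty)
  have "tame_pair M {} U" for U
    by (rule tame_pair_subset[OF fg_mod_subset[OF *] *])
  then show ?thesis unfolding tame_nhds_def by (intro allI impI exI[of _ "{}"]) simp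
qed

text \<open>Induction on the number of sets. The union of all sets but \<open>K\<close> meets
  \<open>K\<close> in the union of the sets \<open>K \<inter> L\<close>, which again belong to
  \<open>\<B>\<close>. As some of these may coincide, the induction bounds the cardinality instead
  of fixing it.\<close>

lemma tame_nhds_Union:
  assumes haus: "Hausdorff_space M"
    and F: "\<And>K. K \<in> \<B> \<Longrightarrow> compactin M K" "\<And>K. K \<in> \<B> \<Longrightarrow> tame_nhds M K"
      "\<And>K L. K \<in> \<B> \<Longrightarrow> L \<in> \<B> \<Longrightarrow> K \<inter> L \<in> \<B>"
    and "finite \<F>" "\<F> \<subseteq> \<B>"
  shows "tame_nhds M (\<Union>\<F>)"
proof -
  have "\<forall>\<F>. finite \<F> \<and> \<F> \<subseteq> \<B> \<and> card \<F> \<le> n \<longrightarrow> tame_nhds M (\<Union>\<F>)" for n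
  proof (induction n)
    case 0
    then show ?case by (auto simp: tame_nhds_empty)
  next
    case (Suc n)
    show ?case
    proof (intro allI impI, elim conjE)
      fix \<F> assume fin: "finite \<F>" "\<F> \<subseteq> \<B>" "card \<F> \<le> Suc n"
      show "tame_nhds M (\<Union>\<F>)"
      proof (cases "\<F> = {}")
        case True
        then show ?thesis by (simp add: tame_nhds_empty)
      next
        case False
        then obtain K where K: "K \<in> \<F>" by auto
        let ?G = "\<F> - {K}"
        have G: "finite ?G" "?G \<subseteq> \<B>" "card ?G \<le> n" using fin K by auto
        have "card ((\<inter>) K ` ?G) \<le> n" using card_image_le[OF G(1), of "(\<inter>) K"] G(3) by linarith
        moreover have "(\<inter>) K ` ?G \<subseteq> \<B>"
        proof
          fix L assume "L \<in> (\<inter>) K ` ?G"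
          then obtain L' where "L' \<in> \<F>" "L = K \<inter> L'" by auto
          then show "L \<in> \<B>" using F(3)[of K L'] K fin(2) by auto
        qed
        ultimately have "tame_nhds M (\<Union>((\<inter>) K ` ?G))"
          using Suc[rule_format, of "(\<inter>) K ` ?G"] G(1) by simp
        moreover have "\<Union>((\<inter>) K ` ?G) = K \<inter> \<Union>?G" by auto
        moreover have "tame_nhds M (\<Union>?G)" using Suc[rule_format, of ?G] G by simp
        moreover have "compactin M (\<Union>?G)" using G F(1) by (intro compactin_Union) auto
        ultimately have "tame_nhds M (K \<union> \<Union>?G)"
          using tame_nhds_Un[OF haus F(1)] F(2) K fin(2) by (simp add: subset_iff)
        moreover have "K \<union> \<Union>?G = \<Union>\<F>" using K by auto
        ultimately show ?thesis by simp
      qed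
    qed
  qed
  then show ?thesis using assms by blast
qed

text \<open>The identity is homotopic to a constant map, so every cycle is homologous to one at a
  single point. Such a cycle is a multiple of the constant simplex, and in positive degrees it is a
  boundary.\<close>

lemma contractible_fg_mod:
  assumes "contractible_space X"
  shows "fg_mod (singular_cycles p X) (singular_boundaries p X)"
    and "p \<ge> 1 \<Longrightarrow> singular_cycles p X \<subseteq> singular_boundaries p X"
proof -
  obtain a where a: "homotopic_with (\<lambda>x. True) X X id (\<lambda>x. a)"
    using assms by (auto simp: contractible_space_def)
  have "fg_mod (singular_cycles p X) (singular_boundaries p X) \<and>
     (p \<ge> 1 \<longrightarrow> singular_cycles p X \<subseteq> singular_boundaries p X)"
  proof (cases "topspace X = {}")
    case True
    then have "singular_cycles p X \<subseteq> singular_boundaries p X"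
      using frag_subgroup_zero[OF frag_subgroup_singular_boundaries]
      by (auto simp: singular_cycles_def singular_cycle singular_chain_empty)
    then show ?thesis by (auto intro: fg_mod_subset)
  next
    case False
    have "continuous_map X X (\<lambda>x. a)" using homotopic_with_imp_continuous_maps[OF a] by blast
    then have aX: "a \<in> topspace X" using False by (auto simp: continuous_map_def)
    let ?Y = "subtopology X {a}"
    have Y: "topspace ?Y = {a}" using aX by auto
    have cont: "continuous_map X ?Y (\<lambda>x. a)" using aX by simp
    have hom: "c - chain_map p (\<lambda>x. a) c \<in> singular_boundaries p X" if "c \<in> singular_cycles p X" for c
    proof -
      have c: "singular_relcycle p X {} c" using that by (simp add: singular_cycles_def)
      have "homotopic_with (\<lambda>h. h \<in> {} \<rightarrow> {}) X X id (\<lambda>x. a)" using a by simp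
      then have "homologous_rel p X {} (chain_map p id c) (chain_map p (\<lambda>x. a) c)"
        by (rule homotopic_imp_homologous_rel_chain_maps) (rule c)
      moreover have "chain_map p id c = c" using c by (intro chain_map_ident[of p X]) (simp add: singular_cycle)
      ultimately show ?thesis by (simp add: homologous_rel_def singular_boundaries_def)
    qed
    have img: "singular_relcycle p ?Y {} (chain_map p (\<lambda>x. a) c)" if "c \<in> singular_cycles p X" for c
      using singular_relcycle_chain_map[of p X "{}" c ?Y "\<lambda>x. a" "{}"] that cont
      by (simp add: singular_cycles_def)
    have 1: "singular_cycles p X \<subseteq> singular_boundaries p X" if "p \<ge> 1"
    proof
      fix c assume c: "c \<in> singular_cycles p X"
      have "singular_relboundary p ?Y {} (chain_map p (\<lambda>x. a) c)"
        using img[OF c] singular_boundary_eq_cycle_singleton[OF Y that] by blast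
      then have "singular_relboundary p (subtopology X (topspace X)) {} (chain_map p (\<lambda>x. a) c)"
        by (rule singular_boundary_mono[rotated]) (simp add: aX)
      then have "chain_map p (\<lambda>x. a) c \<in> singular_boundaries p X"
        by (simp add: singular_boundaries_def)
      then show "c \<in> singular_boundaries p X"
        using frag_subgroup_add[OF frag_subgroup_singular_boundaries hom[OF c]] by fastforce
    qed
    let ?f = "frag_of (restrict (\<lambda>x. a) (standard_simplex p))"
    have "fg_mod (singular_cycles p X) (singular_boundaries p X)"
      unfolding fg_mod_def
    proof (intro exI[of _ "{?f}"] conjI ballI)
      fix c assume c: "c \<in> singular_cycles p X"
      then have "singular_chain p ?Y (chain_map p (\<lambda>x. a) c)" using img[OF c] by (simp add: singular_cycle)
      then obtain k where k: "chain_map p (\<lambda>x. a) c = frag_cmul k ?f"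
        using singular_chain_singleton[OF Y] by blast
      have "frag_cmul k ?f \<in> frag_span {?f}"
        using frag_span_superset[of "{?f}"] by (intro frag_subgroup_cmul frag_subgroup_span) auto
      then show "\<exists>s\<in>frag_span {?f}. c - s \<in> singular_boundaries p X" using hom[OF c] k by auto
    qed simp
    then show ?thesis using 1 by blast
  qed
  then show "fg_mod (singular_cycles p X) (singular_boundaries p X)"
    "p \<ge> 1 \<Longrightarrow> singular_cycles p X \<subseteq> singular_boundaries p X" by auto
qed

subsection \<open>Boxes in charts\<close>

text \<open>Boxes serve as cells because they are closed under intersection, as
  \<open>tame_nhds_Union\<close> requires; a box is empty when some lower bound exceeds the upper
  one. Coordinates from \<open>m\<close> on vanish because points of
  \<open>Euclidean_space m\<close> are functions on all of \<open>nat\<close>.\<close>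

definition closed_box :: "nat \<Rightarrow> (nat \<Rightarrow> real) \<Rightarrow> (nat \<Rightarrow> real) \<Rightarrow> (nat \<Rightarrow> real) set" where
  "closed_box m l u = {x. (\<forall>i<m. l i \<le> x i \<and> x i \<le> u i) \<and> (\<forall>i\<ge>m. x i = 0)}"

definition open_box :: "nat \<Rightarrow> (nat \<Rightarrow> real) \<Rightarrow> (nat \<Rightarrow> real) \<Rightarrow> (nat \<Rightarrow> real) set" where
  "open_box m l u = {x. (\<forall>i<m. l i < x i \<and> x i < u i) \<and> (\<forall>i\<ge>m. x i = 0)}"

lemma closed_box_eq_PiE: "closed_box m l u = (\<Pi>\<^sub>E i\<in>UNIV. if i < m then {l i..u i} else {0})"
proof -
  have "x \<in> closed_box m l u \<longleftrightarrow> (\<forall>i. x i \<in> (if i < m then {l i..u i} else {0}))" for x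
    by (simp add: closed_box_def) (metis not_less)
  then show ?thesis by (auto simp: PiE_iff)
qed

lemma open_box_eq_PiE: "open_box m l u = (\<Pi>\<^sub>E i\<in>UNIV. if i < m then {l i<..<u i} else {0})"
proof -
  have "x \<in> open_box m l u \<longleftrightarrow> (\<forall>i. x i \<in> (if i < m then {l i<..<u i} else {0}))" for x
    by (simp add: open_box_def) (metis not_less)
  then show ?thesis by (auto simp: PiE_iff)
qed

lemma open_box_subset: "open_box m l u \<subseteq> closed_box m l u"
  unfolding open_box_def closed_box_def by (auto intro: less_imp_le)

lemma closed_box_Int:
  "closed_box m l u \<inter> closed_box m l' u' = closed_box m (\<lambda>i. max (l i) (l' i)) (\<lambda>i. min (u i) (u' i))"
  by (auto simp: closed_box_def)

lemma compactin_closed_box: "compactin (Euclidean_space m) (closed_box m l u)"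
proof -
  have "compactin (powertop_real UNIV) (closed_box m l u)"
    unfolding closed_box_eq_PiE compactin_PiE by (auto simp: compactin_euclidean_iff)
  then show ?thesis
    by (auto simp: Euclidean_space_def compactin_subtopology closed_box_def)
qed

lemma openin_open_box: "openin (Euclidean_space m) (open_box m l u)"
proof -
  have "finite {i. (if i < m then {l i<..<u i} else UNIV) \<noteq> UNIV}"
    by (rule finite_subset[of _ "{..<m}"]) auto
  then have "openin (powertop_real UNIV) (\<Pi>\<^sub>E i\<in>UNIV. if i < m then {l i<..<u i} else UNIV)"
    by (subst openin_PiE_gen) auto
  moreover have "open_box m l u = (\<Pi>\<^sub>E i\<in>UNIV. if i < m then {l i<..<u i} else UNIV) \<inter> {x. \<forall>i\<ge>m. x i = 0}"
    by (auto simp: open_box_def PiE_iff split: if_splits)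
  ultimately show ?thesis
    unfolding Euclidean_space_def openin_subtopology by blast
qed

lemma contractible_open_box: "contractible_space (subtopology (Euclidean_space m) (open_box m l u))"
proof -
  have "{x. \<forall>i\<ge>m. x i = 0} \<inter> open_box m l u = open_box m l u" by (auto simp: open_box_def)
  then have "subtopology (Euclidean_space m) (open_box m l u) = subtopology (powertop_real UNIV) (open_box m l u)"
    by (simp add: Euclidean_space_def subtopology_subtopology)
  also have "\<dots> = product_topology (\<lambda>i. top_of_set (if i < m then {l i<..<u i} else {0})) UNIV"
    unfolding open_box_eq_PiE by (rule subtopology_product_topology)
  finally have "subtopology (Euclidean_space m) (open_box m l u) = \<dots>" .
  moreover have "contractible_space (top_of_set (if i < m then {l i<..<u i} else {0}))" for i
    by (cases "i < m") (simp_all add: convex_imp_contractible)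
  ultimately show ?thesis by (auto simp: contractible_space_product_topology)
qed

text \<open>The boxes enlarged by \<open>1 / (n + 1)\<close> shrink to the given one. If none of
  them lay in \<open>S\<close>, compactness would give a common point of the closed sets
  \<open>D n - S\<close>, and this point would lie in the original box.\<close>

lemma closed_box_nhd:
  assumes O: "openin (Euclidean_space m) S" "closed_box m l u \<subseteq> S"
  obtains e where "e > 0" "closed_box m (\<lambda>i. l i - e) (\<lambda>i. u i + e) \<subseteq> S"
proof -
  define D where "D n = closed_box m (\<lambda>i. l i - inverse (real (Suc n))) (\<lambda>i. u i + inverse (real (Suc n)))" for n
  have "\<exists>n. D n \<subseteq> S"
  proof (rule ccontr)
    assume no: "\<nexists>n. D n \<subseteq> S"
    let ?X = "subtopology (Euclidean_space m) (D 0)"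
    have D_mono: "D n \<subseteq> D k" if "k \<le> n" for k n
    proof -
      have "inverse (real (Suc n)) \<le> inverse (real (Suc k))" using that by (simp add: le_imp_inverse_le)
      then have "l i - inverse (real (Suc k)) \<le> y \<and> y \<le> u i + inverse (real (Suc k))"
        if "l i - inverse (real (Suc n)) \<le> y \<and> y \<le> u i + inverse (real (Suc n))" for i y
        using that by linarith
      then show ?thesis unfolding D_def closed_box_def by blast
    qed
    have "compact_space ?X" unfolding D_def by (intro compact_space_subtopology compactin_closed_box)
    moreover have "closedin ?X (D n - S)" for n
    proof -
      have "closedin (Euclidean_space m) (D n)"
        unfolding D_def by (intro compactin_imp_closedin compactin_closed_box)
          (simp add: Euclidean_space_def Hausdorff_space_subtopology Hausdorff_space_product_topology)
      then have "closedin (Euclidean_space m) (D n - S)" using O(1) by (rule closedin_diff)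
      then show ?thesis using D_mono[of 0 n] by (intro closedin_subset_topspace) auto
    qed
    moreover have "D n - S \<noteq> {}" for n using no by blast
    moreover have "decseq (\<lambda>n. D n - S)" unfolding decseq_def using D_mono by blast
    ultimately have "(\<Inter>n. D n - S) \<noteq> {}" by (rule compact_space_imp_nest)
    then obtain x where x: "\<And>n. x \<in> D n" "x \<notin> S" by auto
    have "x \<in> closed_box m l u"
      unfolding closed_box_def
    proof (intro CollectI conjI allI impI)
      fix i assume i: "i < m"
      have lim: "(\<lambda>n. inverse (real (Suc n))) \<longlonglongrightarrow> 0" by (rule LIMSEQ_inverse_real_of_nat)
      have "l i - inverse (real (Suc n)) \<le> x i" "x i \<le> u i + inverse (real (Suc n))" for n
        using x(1)[of n] i by (auto simp: D_def closed_box_def)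
      then show "l i \<le> x i" "x i \<le> u i"
        using LIMSEQ_le_const2[OF tendsto_diff[OF tendsto_const lim], of "l i" "x i"]
          LIMSEQ_le_const[OF tendsto_add[OF tendsto_const lim], of "x i" "u i"] by auto
    qed (use x(1)[of 0] in \<open>auto simp: D_def closed_box_def\<close>)
    then show False using x(2) O(2) by blast
  qed
  then obtain n where "D n \<subseteq> S" ..
  then show ?thesis using that[of "inverse (real (Suc n))"] by (auto simp: D_def)
qed

text \<open>The chart pulls a slightly larger open box back to a contractible neighbourhood of
  \<open>K\<close> inside \<open>U\<close>.\<close>

lemma tame_nhds_chart_box:
  assumes chart: "chart_of m M D \<phi>" and K: "K \<subseteq> D" "\<phi> ` K = closed_box m l u"
  shows "tame_nhds M K"
  unfolding tame_nhds_def
proof (intro allI impI, elim conjE)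
  fix U assume U: "openin M U" "K \<subseteq> U"
  let ?E = "Euclidean_space m"
  have D: "openin M D" "openin ?E (\<phi> ` D)"
    and hom: "homeomorphic_map (subtopology M D) (subtopology ?E (\<phi> ` D)) \<phi>"
    using chart by (auto simp: chart_of_def)
  have tD: "topspace (subtopology M D) = D" using openin_subset[OF D(1)] by auto
  have inj: "inj_on \<phi> D" using hom tD by (auto simp: homeomorphic_map_def homeomorphic_eq_everything_map)
  have "openin (subtopology M D) (D \<inter> U)" using U(1) by (simp add: openin_subtopology_Int2)
  then have "openin (subtopology ?E (\<phi> ` D)) (\<phi> ` (D \<inter> U))"
    using hom tD by (metis homeomorphic_map_openness_eq)
  then have "openin ?E (\<phi> ` (D \<inter> U))" using D(2) openin_trans_full by blast
  moreover have "closed_box m l u \<subseteq> \<phi> ` (D \<inter> U)" using K U(2) by blast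
  ultimately obtain e where e: "e > 0" "closed_box m (\<lambda>i. l i - e) (\<lambda>i. u i + e) \<subseteq> \<phi> ` (D \<inter> U)"
    by (rule closed_box_nhd)
  let ?O = "open_box m (\<lambda>i. l i - e) (\<lambda>i. u i + e)"
  have O: "?O \<subseteq> \<phi> ` (D \<inter> U)" using open_box_subset e(2) by (rule subset_trans)
  define V where "V = {x \<in> D. \<phi> x \<in> ?O}"
  have imV: "\<phi> ` V = ?O" using O by (auto simp: V_def)
  have "openin (subtopology ?E (\<phi> ` D)) ?O"
    using openin_open_box O by (metis image_mono inf_le1 openin_subset_topspace_eq subset_trans openin_open_subtopology D(2))
  then have "openin (subtopology M D) V"
    using homeomorphic_map_openness_eq[OF hom, of V] imV tD by (auto simp: V_def)
  then have openV: "openin M V" using D(1) openin_trans_full by blast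
  have VU: "V \<subseteq> U"
  proof
    fix x assume "x \<in> V"
    then have "x \<in> D" "\<phi> x \<in> \<phi> ` (D \<inter> U)" using O by (auto simp: V_def)
    then show "x \<in> U" using inj by (auto dest: inj_onD)
  qed
  have KV: "K \<subseteq> V"
  proof
    fix x assume "x \<in> K"
    then have "x \<in> D" "\<phi> x \<in> closed_box m l u" using K by auto
    then show "x \<in> V" using e(1) by (auto simp: V_def closed_box_def open_box_def add_strict_increasing2)
  qed
  have "homeomorphic_map (subtopology (subtopology M D) V) (subtopology (subtopology ?E (\<phi> ` D)) ?O) \<phi>"
  proof (rule homeomorphic_map_subtopologies[OF hom])
    have "topspace (subtopology ?E (\<phi> ` D)) = \<phi> ` D" using openin_subset[OF D(2)] by auto
    moreover have "V \<subseteq> D" by (auto simp: V_def)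
    ultimately show "\<phi> ` (topspace (subtopology M D) \<inter> V) = topspace (subtopology ?E (\<phi> ` D)) \<inter> ?O"
      using tD imV O by (simp add: Int_absorb1 Int_absorb2) blast
  qed
  moreover have "subtopology (subtopology M D) V = subtopology M V"
    by (simp add: subtopology_subtopology V_def Int_absorb1)
  moreover have "subtopology (subtopology ?E (\<phi> ` D)) ?O = subtopology ?E ?O"
  proof -
    have "\<phi> ` D \<inter> ?O = ?O" using O by blast
    then show ?thesis by (simp add: subtopology_subtopology)
  qed
  ultimately have "subtopology M V homeomorphic_space subtopology ?E ?O"
    using homeomorphic_map_imp_homeomorphic_space by metis
  then have contr: "contractible_space (subtopology M V)"
    using contractible_open_box homeomorphic_space_contractibility by blast
  have "tame_pair M V U"
  proof (rule tame_pair_subset)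
    show "fg_mod (cycles_in M V p) (boundaries_in M U p)" for p
      by (rule fg_mod_mono[OF contractible_fg_mod(1)[OF contr] subset_refl singular_boundaries_mono[OF VU]])
    show "cycles_in M V p \<subseteq> boundaries_in M U p" if "p \<ge> 1" for p
      using contractible_fg_mod(2)[OF contr that] singular_boundaries_mono[OF VU] by (rule subset_trans)
  qed
  then show "\<exists>V. openin M V \<and> K \<subseteq> V \<and> V \<subseteq> U \<and> tame_pair M V U"
    using openV KV VU by blast
qed

text \<open>A compact set in a chart need not be a union of boxes, but inside a given
  \<open>U\<close> it is covered by finitely many of them. Since the cover may depend on
  \<open>U\<close>, a neighbourhood that suits the union of the boxes also suits
  \<open>K\<close>.\<close>

lemma tame_nhds_chart:
  assumes haus: "Hausdorff_space M" and chart: "chart_of m M D \<phi>" and K: "compactin M K" "K \<subseteq> D"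
  shows "tame_nhds M K"
  unfolding tame_nhds_def
proof (intro allI impI, elim conjE)
  fix U assume U: "openin M U" "K \<subseteq> U"
  let ?E = "Euclidean_space m"
  have D: "openin M D" "openin ?E (\<phi> ` D)"
    and hom: "homeomorphic_map (subtopology M D) (subtopology ?E (\<phi> ` D)) \<phi>"
    using chart by (auto simp: chart_of_def)
  have tD: "topspace (subtopology M D) = D" using openin_subset[OF D(1)] by auto
  have tE: "topspace (subtopology ?E (\<phi> ` D)) = \<phi> ` D" using openin_subset[OF D(2)] by auto
  have inj: "inj_on \<phi> D" using hom tD by (auto simp: homeomorphic_map_def homeomorphic_eq_everything_map)
  obtain \<psi> where \<psi>: "homeomorphic_maps (subtopology M D) (subtopology ?E (\<phi> ` D)) \<phi> \<psi>"
    using hom homeomorphic_map_maps by blast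
  define \<B> where "\<B> = {L. L \<subseteq> D \<and> (\<exists>l u. \<phi> ` L = closed_box m l u)}"
  have \<B>_compact: "compactin M L" if LB: "L \<in> \<B>" for L
  proof -
    obtain l u where L: "L \<subseteq> D" "\<phi> ` L = closed_box m l u" using LB by (auto simp: \<B>_def)
    have "compactin (subtopology ?E (\<phi> ` D)) (\<phi> ` L)"
      using compactin_closed_box[of m l u] L(2) image_mono[OF L(1), of \<phi>] by (simp add: compactin_subtopology)
    then have "compactin (subtopology M D) L"
      using homeomorphic_map_compactness_eq[OF hom, of L] L(1) openin_subset[OF D(1)] by auto
    then show ?thesis by (simp add: compactin_subtopology)
  qed
  have \<B>_tame: "tame_nhds M L" if "L \<in> \<B>" for L
    using tame_nhds_chart_box[OF chart] that by (auto simp: \<B>_def)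
  have \<B>_Int: "L \<inter> L' \<in> \<B>" if "L \<in> \<B>" "L' \<in> \<B>" for L L'
  proof -
    have "\<phi> ` (L \<inter> L') = \<phi> ` L \<inter> \<phi> ` L'"
      using that inj by (intro inj_on_image_Int[of \<phi> D]) (auto simp: \<B>_def)
    then show ?thesis using that closed_box_Int by (auto simp: \<B>_def) metis
  qed
  define \<O> where "\<O> = {V. openin M V \<and> (\<exists>L\<in>\<B>. V \<subseteq> L \<and> L \<subseteq> U)}"
  have "\<exists>V\<in>\<O>. x \<in> V" if x: "x \<in> K" for x
  proof -
    have "openin (subtopology M D) (D \<inter> U)" using U(1) by (simp add: openin_subtopology_Int2)
    then have "openin (subtopology ?E (\<phi> ` D)) (\<phi> ` (D \<inter> U))"
      using hom tD by (metis homeomorphic_map_openness_eq)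
    then have S: "openin ?E (\<phi> ` (D \<inter> U))" using D(2) openin_trans_full by blast
    have xD: "x \<in> D" using x K by blast
    have "\<phi> x \<in> topspace ?E" using openin_subset[OF D(2)] xD by blast
    then have x0: "\<phi> x i = 0" if "i \<ge> m" for i using that by (simp add: topspace_Euclidean_space)
    have "closed_box m (\<phi> x) (\<phi> x) = {\<phi> x}"
    proof -
      have "y = \<phi> x" if "y \<in> closed_box m (\<phi> x) (\<phi> x)" for y
      proof
        show "y i = \<phi> x i" for i
          using that x0[of i] by (cases "i < m") (auto simp: closed_box_def intro: antisym)
      qed
      then show ?thesis using x0 by (auto simp: closed_box_def)
    qed
    then have "closed_box m (\<phi> x) (\<phi> x) \<subseteq> \<phi> ` (D \<inter> U)" using x xD U(2) by auto
    with S obtain e where e: "e > 0" "closed_box m (\<lambda>i. \<phi> x i - e) (\<lambda>i. \<phi> x i + e) \<subseteq> \<phi> ` (D \<inter> U)"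
      by (rule closed_box_nhd)
    define L where "L = {y \<in> D. \<phi> y \<in> closed_box m (\<lambda>i. \<phi> x i - e) (\<lambda>i. \<phi> x i + e)}"
    define V where "V = {y \<in> D. \<phi> y \<in> open_box m (\<lambda>i. \<phi> x i - e) (\<lambda>i. \<phi> x i + e)}"
    have VL: "V \<subseteq> L" unfolding V_def L_def using open_box_subset by blast
    have "\<phi> ` L = closed_box m (\<lambda>i. \<phi> x i - e) (\<lambda>i. \<phi> x i + e)" using e(2) by (auto simp: L_def)
    then have LB: "L \<in> \<B>" by (auto simp: \<B>_def L_def)
    have LU: "L \<subseteq> U"
    proof
      fix y assume "y \<in> L"
      then have "y \<in> D" "\<phi> y \<in> \<phi> ` (D \<inter> U)" using e(2) by (auto simp: L_def)
      then show "y \<in> U" using inj by (auto dest: inj_onD)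
    qed
    have O: "open_box m (\<lambda>i. \<phi> x i - e) (\<lambda>i. \<phi> x i + e) \<subseteq> \<phi> ` D"
      using open_box_subset e(2) by blast
    have "openin (subtopology ?E (\<phi> ` D)) (open_box m (\<lambda>i. \<phi> x i - e) (\<lambda>i. \<phi> x i + e))"
      using openin_open_box O D(2) by (simp add: openin_open_subtopology)
    moreover have "\<phi> ` V = open_box m (\<lambda>i. \<phi> x i - e) (\<lambda>i. \<phi> x i + e)" using O by (auto simp: V_def)
    ultimately have "openin (subtopology M D) V"
      using homeomorphic_map_openness_eq[OF hom, of V] tD by (auto simp: V_def)
    then have "openin M V" using D(1) openin_trans_full by blast
    moreover have "x \<in> V" using e(1) xD x0 by (auto simp: V_def open_box_def)
    ultimately show ?thesis using VL LB LU by (auto simp: \<O>_def)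
  qed
  then have "K \<subseteq> \<Union>\<O>" by blast
  moreover have "\<forall>V\<in>\<O>. openin M V" by (auto simp: \<O>_def)
  ultimately obtain \<G> where \<G>: "finite \<G>" "\<G> \<subseteq> \<O>" "K \<subseteq> \<Union>\<G>"
    using K(1) unfolding compactin_def by blast
  have "\<forall>V\<in>\<G>. \<exists>L. L \<in> \<B> \<and> V \<subseteq> L \<and> L \<subseteq> U" using \<G>(2) by (auto simp: \<O>_def)
  then obtain f where f: "\<forall>V\<in>\<G>. f V \<in> \<B> \<and> V \<subseteq> f V \<and> f V \<subseteq> U" by (rule bchoice[THEN exE])
  have "tame_nhds M (\<Union>(f ` \<G>))"
    by (rule tame_nhds_Union[OF haus \<B>_compact \<B>_tame \<B>_Int]) (use f \<G>(1) in auto)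
  moreover have "\<Union>(f ` \<G>) \<subseteq> U" using f by (intro UN_least) simp
  ultimately obtain V where V: "openin M V" "\<Union>(f ` \<G>) \<subseteq> V" "V \<subseteq> U" "tame_pair M V U"
    using tame_nhdsD[OF _ U(1)] by blast
  have "\<Union>\<G> \<subseteq> \<Union>(f ` \<G>)" using f by (auto simp: subset_iff)
  then have "K \<subseteq> V" using \<G>(3) V(2) by (meson subset_trans)
  then show "\<exists>V. openin M V \<and> K \<subseteq> V \<and> V \<subseteq> U \<and> tame_pair M V U"
    using V by (intro exI[of _ V] conjI)
qed

text \<open>Compact sets that lie in a single chart domain form a family closed under intersection,
  and finitely many of them cover \<open>M\<close>. The only neighbourhood of the whole space is
  itself, so the image of \<open>H(V)\<close> in \<open>H(U)\<close> becomes the homology of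
  \<open>M\<close>.\<close>

lemma compact_manifold_homology_fg:
  assumes compact: "compact_space M" and haus: "Hausdorff_space M" and A: "smooth_atlas m M A"
  shows "fg_mod (singular_cycles p M) (singular_boundaries p M)"
    and "\<exists>N. \<forall>p\<ge>N. singular_cycles p M \<subseteq> singular_boundaries p M"
proof -
  define \<B> where "\<B> = {K. compactin M K \<and> (\<exists>(U, \<phi>)\<in>A. K \<subseteq> U)}"
  have chart: "chart_of m M U \<phi>" if "(U, \<phi>) \<in> A" for U \<phi> using A that by (auto simp: smooth_atlas_def)
  have tame: "tame_nhds M K" if "K \<in> \<B>" for K
    using that tame_nhds_chart[OF haus chart] by (auto simp: \<B>_def)
  have Int: "K \<inter> L \<in> \<B>" if "K \<in> \<B>" "L \<in> \<B>" for K L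
    using that compactin_imp_closedin[OF haus] closed_Int_compactin[of M K L] by (auto simp: \<B>_def)
  define \<O> where "\<O> = {V. openin M V \<and> (\<exists>L\<in>\<B>. V \<subseteq> L)}"
  have "\<exists>V\<in>\<O>. x \<in> V" if x: "x \<in> topspace M" for x
  proof -
    have "(\<Union>(U, \<phi>)\<in>A. U) = topspace M" using A by (simp add: smooth_atlas_def)
    then obtain U \<phi> where U: "(U, \<phi>) \<in> A" "x \<in> U" using x by blast
    have "openin M U" using chart[OF U(1)] by (simp add: chart_of_def)
    moreover have "neighbourhood_base_of (closedin M) M"
      using compact_Hausdorff_imp_regular_space[OF compact haus]
      by (simp only: neighbourhood_base_of_closedin)
    ultimately obtain V C where "openin M V" "closedin M C" "x \<in> V" "V \<subseteq> C" "C \<subseteq> U"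
      using U(2) unfolding neighbourhood_base_of by (elim allE[of _ U] allE[of _ x] impE) blast+
    moreover have "compactin M C" using \<open>closedin M C\<close> compact by (rule closedin_compact_space[rotated])
    ultimately show ?thesis using U(1) by (auto simp: \<O>_def \<B>_def)
  qed
  then have "topspace M \<subseteq> \<Union>\<O>" by blast
  moreover have "\<forall>V\<in>\<O>. openin M V" by (auto simp: \<O>_def)
  ultimately obtain \<G> where \<G>: "finite \<G>" "\<G> \<subseteq> \<O>" "topspace M \<subseteq> \<Union>\<G>"
    using compact unfolding compact_space_def compactin_def by blast
  have "\<forall>V\<in>\<G>. \<exists>L. L \<in> \<B> \<and> V \<subseteq> L" using \<G>(2) by (auto simp: \<O>_def)
  then obtain f where f: "\<forall>V\<in>\<G>. f V \<in> \<B> \<and> V \<subseteq> f V" by (rule bchoice[THEN exE])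
  have \<B>_compact: "compactin M K" if "K \<in> \<B>" for K using that by (auto simp: \<B>_def)
  have "tame_nhds M (\<Union>(f ` \<G>))"
    by (rule tame_nhds_Union[OF haus \<B>_compact tame Int]) (use f \<G>(1) in auto)
  moreover have eq: "\<Union>(f ` \<G>) = topspace M"
  proof
    show "\<Union>(f ` \<G>) \<subseteq> topspace M"
      using f by (intro UN_least compactin_subset_topspace \<B>_compact) simp
    have "\<Union>\<G> \<subseteq> \<Union>(f ` \<G>)" using f by (auto simp: subset_iff)
    then show "topspace M \<subseteq> \<Union>(f ` \<G>)" using \<G>(3) by (rule subset_trans[rotated])
  qed
  ultimately obtain V where V: "topspace M \<subseteq> V" "V \<subseteq> topspace M" "tame_pair M V (topspace M)"
    using tame_nhdsD[of M "topspace M" "topspace M"] by (metis openin_topspace subset_refl)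
  then have "V = topspace M" by blast
  then show "fg_mod (singular_cycles p M) (singular_boundaries p M)"
    "\<exists>N. \<forall>p\<ge>N. singular_cycles p M \<subseteq> singular_boundaries p M"
    using V(3) unfolding tame_pair_def by simp_all
qed

section \<open>Boundary operators given by deleting entries of lists\<close>

text \<open>Common form of the simplicial and the magnitude boundary; \<open>v i xs\<close> tells
  whether entry \<open>i\<close> of \<open>xs\<close> may be deleted.\<close>

definition deletion_boundary :: "(nat \<Rightarrow> 'a list \<Rightarrow> bool) \<Rightarrow> 'a list \<Rightarrow> 'a list \<Rightarrow>\<^sub>0 int" where
  "deletion_boundary v xs =
     (\<Sum>i<length xs. frag_cmul ((- 1) ^ i) (if v i xs then frag_of (delete_nth i xs) else 0))"

lemma length_delete_nth: "i < length xs \<Longrightarrow> length (delete_nth i xs) = length xs - 1"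
  by (simp add: delete_nth_def)

lemma nth_delete_nth:
  "i < length xs \<Longrightarrow> k < length xs - 1 \<Longrightarrow> delete_nth i xs ! k = (if k < i then xs ! k else xs ! Suc k)"
  by (auto simp: delete_nth_def nth_append min_def)

lemma delete_nth_commute:
  "i \<le> j \<Longrightarrow> Suc j < length xs \<Longrightarrow> delete_nth j (delete_nth i xs) = delete_nth i (delete_nth (Suc j) xs)"
  by (rule nth_equalityI) (auto simp: length_delete_nth nth_delete_nth)

text \<open>Deleting entry \<open>i\<close> and then entry \<open>j \<ge> i\<close> gives the same
  list as deleting entry \<open>j + 1\<close> and then entry \<open>i\<close>, with the opposite
  sign. The assumption makes both orders admissible at the same time, so the terms cancel in
  pairs.\<close>

lemma deletion_boundary_boundary:
  assumes v: "\<And>i j. i \<le> j \<Longrightarrow> Suc j < length xs \<Longrightarrow>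
      v i xs \<and> v j (delete_nth i xs) \<longleftrightarrow> v (Suc j) xs \<and> v i (delete_nth (Suc j) xs)"
  shows "frag_extend (deletion_boundary v) (deletion_boundary v xs) = 0"
proof -
  define m where "m = length xs"
  define T where "T i j = (if v i xs \<and> v j (delete_nth i xs) then frag_of (delete_nth j (delete_nth i xs)) else 0)" for i j
  define g where "g = (\<lambda>(i, j). frag_cmul ((- 1) ^ (i + j)) (T i j))"
  have 1: "frag_extend (deletion_boundary v) (frag_cmul ((- 1) ^ i) (if v i xs then frag_of (delete_nth i xs) else 0))
      = (\<Sum>j<m - 1. g (i, j))" if "i < m" for i
    using that by (simp add: frag_extend_cmul deletion_boundary_def length_delete_nth m_def frag_cmul_sum
        g_def T_def frag_cmul_cmul power_add)
  have "frag_extend (deletion_boundary v) (deletion_boundary v xs)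
      = (\<Sum>i<m. \<Sum>j<m - 1. g (i, j))"
    unfolding deletion_boundary_def[of v xs] m_def[symmetric] by (simp add: frag_extend_sum 1)
  also have "\<dots> = (\<Sum>p\<in>{..<m} \<times> {..<m - 1}. g p)"
    by (simp add: sum.cartesian_product)
  also have "\<dots> = (\<Sum>p\<in>{p\<in>{..<m} \<times> {..<m - 1}. fst p \<le> snd p}. g p)
      + (\<Sum>p\<in>{p\<in>{..<m} \<times> {..<m - 1}. snd p < fst p}. g p)"
    by (subst sum.union_disjoint[symmetric]) (auto intro!: sum.cong)
  also have "(\<Sum>p\<in>{p\<in>{..<m} \<times> {..<m - 1}. snd p < fst p}. g p)
      = (\<Sum>p\<in>{p\<in>{..<m} \<times> {..<m - 1}. fst p \<le> snd p}. - g p)"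
  proof (rule sum.reindex_bij_witness[of _ "\<lambda>(i, j). (Suc j, i)" "\<lambda>(i, j). (j, i - 1)"])
    fix p assume "p \<in> {p \<in> {..<m} \<times> {..<m - 1}. snd p < fst p}"
    then obtain i j where p: "p = (Suc i, j)" "Suc i < m" "j \<le> i"
      by (cases p; cases "fst p") auto
    have "T (Suc i) j = T j i"
      using v[of j i] delete_nth_commute[of j i xs] p by (simp add: T_def m_def)
    then show "- g (case p of (i, j) \<Rightarrow> (j, i - 1)) = g p"
      using p by (simp add: g_def add.commute)
  qed auto
  finally show ?thesis by (simp add: sum_negf)
qed

lemma simplicial_boundary_eq: "simplicial_boundary = deletion_boundary (\<lambda>_ _. True)"
  by (simp add: fun_eq_iff simplicial_boundary_def deletion_boundary_def)

lemma simplicial_boundary_boundary: "frag_extend simplicial_boundary (simplicial_boundary xs) = 0"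
  unfolding simplicial_boundary_eq by (rule deletion_boundary_boundary) auto

text \<open>Indexed by the number of vertices, one more than the dimension: \<open>m = 0\<close>
  contributes the empty list and thereby the augmentation.\<close>

definition simplicial_chains :: "'a set \<Rightarrow> ('a \<Rightarrow> 'a \<Rightarrow> bool) \<Rightarrow> nat \<Rightarrow> 'a list set" where
  "simplicial_chains P lt m = {xs. length xs = m \<and> set xs \<subseteq> P \<and> sorted_wrt lt xs}"

lemma set_delete_nth: "set (delete_nth i xs) \<subseteq> set xs"
  by (auto simp: delete_nth_def dest: in_set_takeD in_set_dropD)

lemma sorted_wrt_delete_nth: "sorted_wrt R xs \<Longrightarrow> sorted_wrt R (delete_nth i xs)"
proof (cases "i < length xs")
  case True
  then show "sorted_wrt R xs \<Longrightarrow> sorted_wrt R (delete_nth i xs)"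
    unfolding sorted_wrt_iff_nth_less by (simp add: length_delete_nth nth_delete_nth)
qed (simp add: delete_nth_def)

lemma simplicial_chains_delete:
  "xs \<in> simplicial_chains P lt (Suc m) \<Longrightarrow> i < Suc m \<Longrightarrow> delete_nth i xs \<in> simplicial_chains P lt m"
  using set_delete_nth[of i xs] sorted_wrt_delete_nth[of lt xs i]
  by (auto simp: simplicial_chains_def length_delete_nth)

lemma keys_deletion_boundary:
  "Poly_Mapping.keys (deletion_boundary v xs) \<subseteq> {delete_nth i xs |i. i < length xs \<and> v i xs}"
proof -
  have "Poly_Mapping.keys (frag_cmul k (if v i xs then frag_of (delete_nth i xs) else 0))
      \<subseteq> {delete_nth i xs |i. i < length xs \<and> v i xs}" if "i < length xs" for i k
    using keys_cmul[of k "frag_of (delete_nth i xs)"] that by (cases "v i xs") auto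
  then show ?thesis
    unfolding deletion_boundary_def by (intro subset_trans[OF keys_sum] UN_least) simp
qed

lemma keys_simplicial_boundary:
  assumes xs: "xs \<in> simplicial_chains P lt (Suc m)"
  shows "Poly_Mapping.keys (simplicial_boundary xs) \<subseteq> simplicial_chains P lt m"
proof -
  have "{delete_nth i xs |i. i < length xs \<and> True} \<subseteq> simplicial_chains P lt m"
    using simplicial_chains_delete[OF xs] xs by (auto simp: simplicial_chains_def)
  then show ?thesis
    unfolding simplicial_boundary_eq using keys_deletion_boundary[of "\<lambda>_ _. True" xs] by (rule subset_trans[rotated])
qed

lemma frag_extend_extend: "frag_extend f (frag_extend g c) = frag_extend (\<lambda>x. frag_extend f (g x)) c"
  by (rule frag_induction[OF subset_UNIV, of _ c]) (simp_all add: frag_extend_diff)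

lemma frag_extend_uminus: "frag_extend (\<lambda>x. - f x) c = - frag_extend f c"
  by (rule frag_induction[OF subset_UNIV, of _ c]) (simp_all add: frag_extend_diff)

lemma chain_boundaries_subset:
  assumes "\<And>x. x \<in> T \<Longrightarrow> Poly_Mapping.keys (bd x) \<subseteq> S" "\<And>x. x \<in> T \<Longrightarrow> frag_extend bd (bd x) = 0"
  shows "chain_boundaries T bd \<subseteq> chain_cycles S bd"
proof
  fix c assume "c \<in> chain_boundaries T bd"
  then obtain b where b: "Poly_Mapping.keys b \<subseteq> T" "c = frag_extend bd b" by (auto simp: chain_boundaries_def)
  have "Poly_Mapping.keys c \<subseteq> S" using keys_frag_extend[of bd b] b assms(1) by blast
  moreover have "frag_extend bd c = frag_extend (\<lambda>x. frag_extend bd (bd x)) b"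
    by (simp add: b(2) frag_extend_extend)
  moreover have "\<dots> = 0" by (rule frag_extend_eq_0) (use b(1) assms(2) in auto)
  ultimately show "c \<in> chain_cycles S bd" by (simp add: chain_cycles_def)
qed

lemma simplicial_boundaries_subset:
  "chain_boundaries (simplicial_chains P lt (Suc m)) simplicial_boundary
     \<subseteq> chain_cycles (simplicial_chains P lt m) simplicial_boundary"
  by (rule chain_boundaries_subset[OF keys_simplicial_boundary simplicial_boundary_boundary])

section \<open>The magnitude chain complex\<close>

fun path_length :: "('a \<Rightarrow> 'a \<Rightarrow> real) \<Rightarrow> 'a list \<Rightarrow> real" where
  "path_length d (x # y # zs) = d x y + path_length d (y # zs)"
| "path_length d _ = 0"

lemma path_length_eq_sum: "path_length d xs = (\<Sum>i=1..length xs - 1. d (xs ! (i - 1)) (xs ! i))"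
proof (induction d xs rule: path_length.induct)
  case (1 d x y zs)
  have "(\<Sum>i=1..Suc (length zs). d ((x # y # zs) ! (i - 1)) ((x # y # zs) ! i))
      = d x y + (\<Sum>i=Suc 1..Suc (length zs). d ((x # y # zs) ! (i - 1)) ((x # y # zs) ! i))"
    by (subst sum.atLeast_Suc_atMost) auto
  also have "(\<Sum>i=Suc 1..Suc (length zs). d ((x # y # zs) ! (i - 1)) ((x # y # zs) ! i))
      = (\<Sum>i=1..length zs. d ((y # zs) ! (i - 1)) ((y # zs) ! i))"
    unfolding sum.shift_bounds_cl_Suc_ivl by (intro sum.cong) (auto simp: nth_Cons')
  finally show ?case using 1 by simp
qed auto

lemma path_length_append: "path_length d (us @ a # vs) = path_length d (us @ [a]) + path_length d (a # vs)"
  by (induction us rule: induct_list012) auto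

lemma proper_chains_eq:
  "proper_chains M d n l = {xs. length xs = n + 1 \<and> set xs \<subseteq> M \<and> distinct_adj xs \<and> path_length d xs = l}"
proof -
  have "distinct_adj xs \<longleftrightarrow> (\<forall>i\<in>{1..n}. xs ! (i - 1) \<noteq> xs ! i)" if "length xs = n + 1" for xs :: "'a list"
  proof -
    have "distinct_adj xs \<longleftrightarrow> (\<forall>i<n. xs ! i \<noteq> xs ! Suc i)"
      using that by (simp add: distinct_adj_conv_nth)
    also have "\<dots> \<longleftrightarrow> (\<forall>i\<in>{1..n}. xs ! (i - 1) \<noteq> xs ! i)"
    proof (intro iffI allI impI ballI)
      fix i assume "\<forall>i<n. xs ! i \<noteq> xs ! Suc i" "i \<in> {1..n}"
      then show "xs ! (i - 1) \<noteq> xs ! i" by (cases i) auto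
    next
      fix i assume *: "\<forall>i\<in>{1..n}. xs ! (i - 1) \<noteq> xs ! i" "i < n"
      then have "Suc i \<in> {1..n}" by simp
      with *(1) show "xs ! i \<noteq> xs ! Suc i" by fastforce
    qed
    finally show ?thesis .
  qed
  then show ?thesis by (auto simp: proper_chains_def path_length_eq_sum)
qed

definition face_valid :: "('a \<Rightarrow> 'a \<Rightarrow> real) \<Rightarrow> nat \<Rightarrow> 'a list \<Rightarrow> bool" where
  "face_valid d i xs \<longleftrightarrow> 1 \<le> i \<and> i + 1 < length xs \<and> strictly_between d (xs ! (i - 1)) (xs ! i) (xs ! (i + 1))"

lemma magnitude_boundary_eq: "magnitude_boundary d = deletion_boundary (face_valid d)"
proof
  fix xs :: "'a list"
  show "magnitude_boundary d xs = deletion_boundary (face_valid d) xs"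
  proof (cases xs)
    case Nil
    then show ?thesis by (simp add: magnitude_boundary_def deletion_boundary_def magnitude_face_def)
  next
    case (Cons x zs)
    then have "{0..length xs - 1} = {..<length xs}" by auto
    moreover have "i + 1 \<le> length xs - 1 \<longleftrightarrow> i + 1 < length xs" for i using Cons by auto
    ultimately show ?thesis
      unfolding magnitude_boundary_def deletion_boundary_def Let_def magnitude_face_def face_valid_def
      by (simp only:)
  qed
qed

lemma split_at3:
  assumes "1 \<le> i" "i + 1 < length xs"
  obtains us a b c vs where "xs = us @ a # b # c # vs" "i = Suc (length us)"
proof -
  have "xs = take (i - 1) xs @ xs ! (i - 1) # xs ! i # xs ! (i + 1) # drop (i + 2) xs"
  proof -
    have "drop (i - 1) xs = xs ! (i - 1) # drop i xs" "drop i xs = xs ! i # drop (i + 1) xs"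
      "drop (i + 1) xs = xs ! (i + 1) # drop (i + 2) xs"
      using assms Cons_nth_drop_Suc[of "i - 1" xs] Cons_nth_drop_Suc[of i xs] Cons_nth_drop_Suc[of "i + 1" xs]
      by simp_all
    then show ?thesis using append_take_drop_id[of "i - 1" xs] by simp
  qed
  moreover have "i = Suc (length (take (i - 1) xs))" using assms by simp
  ultimately show ?thesis by (rule that)
qed

context Metric_space
begin

text \<open>Faces keep both endpoints, so the complex splits into a direct sum over pairs of
  endpoints. The two new neighbours differ because their distance is a sum of positive
  distances.\<close>

lemma proper_chains_delete:
  assumes xs: "xs \<in> proper_chains M d (Suc n) l" and v: "face_valid d i xs"
  shows "delete_nth i xs \<in> proper_chains M d n l" "hd (delete_nth i xs) = hd xs" "last (delete_nth i xs) = last xs"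
proof -
  have "1 \<le> i" "i + 1 < length xs" using v by (auto simp: face_valid_def)
  then obtain us a b c vs where eq: "xs = us @ a # b # c # vs" "i = Suc (length us)"
    by (rule split_at3)
  have del: "delete_nth i xs = us @ a # c # vs" by (simp add: eq delete_nth_def)
  have btw: "d a b + d b c = d a c" "a \<noteq> b" "b \<noteq> c"
    using v by (simp_all add: face_valid_def strictly_between_def eq nth_append)
  have abc: "a \<in> M" "b \<in> M" "c \<in> M" using xs by (auto simp: proper_chains_eq eq)
  have "d a b \<noteq> 0" using btw(2) abc zero by simp
  then have "d a b + d b c \<noteq> 0" using nonneg[of a b] nonneg[of b c] by linarith
  then have "a \<noteq> c" using btw(1) zero[of a c] abc by auto
  moreover have "distinct_adj (us @ [a])" "distinct_adj (c # vs)"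
    using xs by (auto simp: proper_chains_eq eq distinct_adj_append_iff)
  ultimately have "distinct_adj (us @ a # c # vs)"
    using xs by (auto simp: proper_chains_eq eq distinct_adj_append_iff)
  moreover have "path_length d (us @ a # c # vs) = l"
    using xs btw path_length_append[of d us a "b # c # vs"] path_length_append[of d us a "c # vs"]
    by (simp add: proper_chains_eq eq)
  ultimately show "delete_nth i xs \<in> proper_chains M d n l"
    using xs unfolding del by (auto simp: proper_chains_eq eq)
  show "hd (delete_nth i xs) = hd xs" "last (delete_nth i xs) = last xs"
    unfolding del by (auto simp: eq hd_append)
qed

lemma keys_magnitude_boundary:
  "xs \<in> proper_chains M d (Suc n) l \<Longrightarrow> Poly_Mapping.keys (magnitude_boundary d xs) \<subseteq> proper_chains M d n l"
  unfolding magnitude_boundary_eq using keys_deletion_boundary[of "face_valid d" xs] proper_chains_delete(1) by blast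

text \<open>By the triangle inequality both sides say that
  \<open>d a b + d b c + d c e = d a e\<close> with consecutive points distinct.\<close>

lemma strictly_between_swap:
  assumes "a \<in> M" "b \<in> M" "c \<in> M" "e \<in> M"
  shows "strictly_between d a b c \<and> strictly_between d a c e \<longleftrightarrow> strictly_between d b c e \<and> strictly_between d a b e"
  using assms triangle[of a b c] triangle[of b c e] triangle[of a c e] triangle[of a b e]
    zero[of a c] zero[of b e] zero[of a b] zero[of c e] nonneg
  unfolding strictly_between_def by (smt (verit))

lemma magnitude_boundary_boundary:
  assumes "set xs \<subseteq> M"
  shows "frag_extend (magnitude_boundary d) (magnitude_boundary d xs) = 0"
  unfolding magnitude_boundary_eq
proof (rule deletion_boundary_boundary)
  fix i j assume ij: "i \<le> j" "Suc j < length xs"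
  show "face_valid d i xs \<and> face_valid d j (delete_nth i xs) \<longleftrightarrow>
        face_valid d (Suc j) xs \<and> face_valid d i (delete_nth (Suc j) xs)"
  proof (cases "1 \<le> i \<and> Suc (Suc j) < length xs")
    case False
    then show ?thesis using ij by (auto simp: face_valid_def length_delete_nth)
  next
    case bounds: True
    show ?thesis
    \<comment> \<open>For \<open>i = j\<close> two adjacent entries are deleted, which is the swap
      above. Otherwise neither deletion changes the neighbours of the other entry.\<close>
    proof (cases "i = j")
      case True
      have "xs ! (i - 1) \<in> M" "xs ! i \<in> M" "xs ! (i + 1) \<in> M" "xs ! (i + 2) \<in> M"
        using assms bounds True by (auto intro!: subsetD[OF assms nth_mem])
      moreover have "1 \<le> j" "Suc j < length xs - 1" using bounds True by auto
      ultimately show ?thesis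
        using True strictly_between_swap[of "xs ! (i - 1)" "xs ! i" "xs ! (i + 1)" "xs ! (i + 2)"]
        by (auto simp: face_valid_def length_delete_nth nth_delete_nth)
    next
      case False
      then have "\<not> j - 1 < i" "Suc (j - 1) = j" "i - 1 < Suc j" "Suc j < length xs - 1" "Suc i < length xs - 1"
        using ij bounds by auto
      then show ?thesis
        using ij bounds by (auto simp: face_valid_def length_delete_nth nth_delete_nth)
    qed
  qed
qed

lemma magnitude_boundaries_subset:
  "chain_boundaries (proper_chains M d (Suc n) l) (magnitude_boundary d)
     \<subseteq> chain_cycles (proper_chains M d n l) (magnitude_boundary d)"
  by (rule chain_boundaries_subset[OF keys_magnitude_boundary magnitude_boundary_boundary])
    (auto simp: proper_chains_eq)

end

section \<open>Order complexes inside magnitude complexes\<close>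

text \<open>
  The poset \<open>(P, lt)\<close> together with a minimum and a maximum is embedded in the metric space, such
  that a path from \<open>e0\<close> to \<open>e1\<close> has the minimal length \<open>\<rho> e1 - \<rho> e0\<close> exactly if it is a chain.
\<close>
locale hat_embedding = Metric_space X d for X :: "'x set" and d +
  fixes P :: "'p set" and lt :: "'p \<Rightarrow> 'p \<Rightarrow> bool" and e :: "'p \<Rightarrow> 'x" and e0 e1 :: 'x and \<rho> :: "'x \<Rightarrow> real"
  assumes X_eq: "X = {e0, e1} \<union> e ` P"
    and dist_ge: "\<And>a b. a \<in> X \<Longrightarrow> b \<in> X \<Longrightarrow> \<rho> b - \<rho> a \<le> d a b"
    and inj: "inj_on e P"
    and e0_e1: "e0 \<noteq> e1" "d e0 e1 = \<rho> e1 - \<rho> e0"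
    and e0_e: "\<And>x. x \<in> P \<Longrightarrow> e0 \<noteq> e x \<and> d e0 (e x) = \<rho> (e x) - \<rho> e0"
    and e_e1: "\<And>x. x \<in> P \<Longrightarrow> e x \<noteq> e1 \<and> d (e x) e1 = \<rho> e1 - \<rho> (e x)"
    and lt_iff: "\<And>x y. x \<in> P \<Longrightarrow> y \<in> P \<Longrightarrow> lt x y \<longleftrightarrow> x \<noteq> y \<and> d (e x) (e y) = \<rho> (e y) - \<rho> (e x)"
begin

definition R :: "'x \<Rightarrow> 'x \<Rightarrow> bool" where
  "R a b \<longleftrightarrow> a \<in> X \<and> b \<in> X \<and> a \<noteq> b \<and> d a b = \<rho> b - \<rho> a"

definition wrap :: "'p list \<Rightarrow> 'x list" where
  "wrap xs = e0 # map e xs @ [e1]"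

definition chains :: "'p list set" where
  "chains = {xs. set xs \<subseteq> P \<and> sorted_wrt lt xs}"

lemma in_X [simp]: "e0 \<in> X" "e1 \<in> X" "x \<in> P \<Longrightarrow> e x \<in> X"
  by (auto simp: X_eq)

text \<open>From \<open>d a c \<le> d a b + d b c = \<rho> c - \<rho> a \<le> d a c\<close> equality
  holds throughout, and \<open>a \<noteq> c\<close> because \<open>\<rho>\<close> grows strictly
  along \<open>R\<close>.\<close>

lemma transp_R: "transp R"
proof (rule transpI)
  fix a b c assume ab: "R a b" and bc: "R b c"
  then have X: "a \<in> X" "b \<in> X" "c \<in> X" by (auto simp: R_def)
  have "d a b > 0" "d b c > 0" using ab bc X zero nonneg[of a b] nonneg[of b c] by (auto simp: R_def order_less_le)
  moreover have "d a c \<le> d a b + d b c" using triangle X by blast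
  ultimately show "R a c"
    using ab bc dist_ge[of a c] by (auto simp: R_def)
qed

lemma sorted_wrt_R_wrap: "xs \<in> chains \<Longrightarrow> sorted_wrt R (wrap xs)"
proof -
  assume xs: "xs \<in> chains"
  have "sorted_wrt (\<lambda>x y. R (e x) (e y)) xs"
  proof (rule sorted_wrt_mono_rel)
    show "R (e x) (e y)" if "x \<in> set xs" "y \<in> set xs" "lt x y" for x y
      using that xs lt_iff[of x y] inj by (auto simp: chains_def R_def inj_on_def subset_iff)
  qed (use xs in \<open>simp add: chains_def\<close>)
  then show ?thesis
    using xs e0_e e_e1 e0_e1 by (auto simp: wrap_def sorted_wrt_append sorted_wrt_map R_def chains_def subset_iff)
qed

lemma path_length_ge:
  "xs \<noteq> [] \<Longrightarrow> set xs \<subseteq> X \<Longrightarrow> \<rho> (last xs) - \<rho> (hd xs) \<le> path_length d xs"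
proof (induction xs rule: induct_list012)
  case (3 x y zs)
  then show ?case using dist_ge[of x y] by fastforce
qed auto

text \<open>Each step is at least as long as its rise of \<open>\<rho>\<close>, and the rises
  telescope, so in a path of minimal length every step is an \<open>R\<close> step; transitivity
  then compares all pairs.\<close>

lemma path_length_eq_iff:
  "xs \<noteq> [] \<Longrightarrow> set xs \<subseteq> X \<Longrightarrow>
     path_length d xs = \<rho> (last xs) - \<rho> (hd xs) \<and> distinct_adj xs \<longleftrightarrow> sorted_wrt R xs"
proof (induction xs rule: induct_list012)
  case (3 x y zs)
  have xy: "x \<in> X" "y \<in> X" using 3 by auto
  have le: "\<rho> (last (y # zs)) - \<rho> y \<le> path_length d (y # zs)" using path_length_ge[of "y # zs"] 3 by auto
  have "path_length d (x # y # zs) = \<rho> (last (x # y # zs)) - \<rho> (hd (x # y # zs)) \<and> distinct_adj (x # y # zs)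
      \<longleftrightarrow> R x y \<and> path_length d (y # zs) = \<rho> (last (y # zs)) - \<rho> (hd (y # zs)) \<and> distinct_adj (y # zs)"
    using dist_ge[OF xy] le xy by (auto simp: R_def)
  also have "\<dots> \<longleftrightarrow> R x y \<and> sorted_wrt R (y # zs)" using 3 by auto
  also have "\<dots> \<longleftrightarrow> sorted_wrt R (x # y # zs)"
    using transpD[OF transp_R] by auto
  finally show ?case .
qed auto

lemma wrap_proper: "xs \<in> chains \<Longrightarrow> wrap xs \<in> proper_chains X d (Suc (length xs)) (\<rho> e1 - \<rho> e0)"
proof -
  assume xs: "xs \<in> chains"
  have "set (wrap xs) \<subseteq> X" using xs by (auto simp: wrap_def X_eq chains_def)
  then show ?thesis
    using path_length_eq_iff[of "wrap xs"] sorted_wrt_R_wrap[OF xs]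
    by (auto simp: proper_chains_eq wrap_def)
qed

lemma proper_is_wrap:
  assumes ys: "ys \<in> proper_chains X d n (\<rho> e1 - \<rho> e0)" and ends: "hd ys = e0" "last ys = e1"
  shows "ys \<in> wrap ` chains"
proof -
  have ne: "ys \<noteq> []" and sub: "set ys \<subseteq> X" using ys by (auto simp: proper_chains_eq)
  have sorted: "sorted_wrt R ys" using path_length_eq_iff[OF ne sub] ys ends by (simp add: proper_chains_eq)
  obtain zs where zs: "ys = e0 # zs @ [e1]"
  proof -
    obtain us where us: "ys = e0 # us" using ne ends by (cases ys) auto
    then have "us \<noteq> []" using ends e0_e1 by auto
    then have "us = butlast us @ [e1]" using ends us by (metis append_butlast_last_id last_ConsR)
    then show ?thesis using that us by blast
  qed
  have "z \<in> e ` P" if "z \<in> set zs" for z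
  proof -
    have "R e0 z" "R z e1" using that sorted unfolding zs by (auto simp: sorted_wrt_append)
    then have "z \<in> X" "z \<noteq> e0" "z \<noteq> e1" by (auto simp: R_def)
    then show ?thesis using X_eq by blast
  qed
  then have "set zs \<subseteq> e ` P" by blast
  then have "e (inv_into P e z) = z" "inv_into P e z \<in> P" if "z \<in> set zs" for z
    using that f_inv_into_f[of z e P] inv_into_into[of z e P] by blast+
  then have "map e (map (inv_into P e) zs) = zs" "set (map (inv_into P e) zs) \<subseteq> P"
    by (simp_all add: map_idI image_subset_iff)
  then obtain xs where xs: "set xs \<subseteq> P" "zs = map e xs" by metis
  have "sorted_wrt (\<lambda>x y. R (e x) (e y)) xs" using sorted unfolding zs xs by (auto simp: sorted_wrt_append sorted_wrt_map)
  then have "sorted_wrt lt xs"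
    by (rule sorted_wrt_mono_rel[rotated]) (use xs lt_iff in \<open>auto simp: R_def subset_iff\<close>)
  then show ?thesis using xs zs by (auto simp: chains_def wrap_def)
qed

lemma inj_wrap: "inj_on wrap chains"
proof (rule inj_onI)
  fix xs ys assume xy: "xs \<in> chains" "ys \<in> chains" "wrap xs = wrap ys"
  then have "map e xs = map e ys" by (simp add: wrap_def)
  moreover have "inj_on e (set xs \<union> set ys)" using inj xy by (auto simp: chains_def intro: inj_on_subset)
  ultimately show "xs = ys" using map_inj_on by blast
qed

text \<open>The ends are never deleted, and every inner entry may be. Indices in
  \<open>wrap xs\<close> are larger by one, whence the sign.\<close>

lemma magnitude_boundary_wrap:
  assumes xs: "xs \<in> chains"
  shows "magnitude_boundary d (wrap xs) = - frag_extend (frag_of \<circ> wrap) (simplicial_boundary xs)"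
proof -
  let ?m = "length xs"
  have len: "length (wrap xs) = Suc (Suc ?m)" by (simp add: wrap_def)
  have valid: "face_valid d i (wrap xs) \<longleftrightarrow> 1 \<le> i \<and> i < Suc ?m" for i
  proof -
    have "strictly_between d (wrap xs ! (i - 1)) (wrap xs ! i) (wrap xs ! (i + 1))" if "1 \<le> i" "i < Suc ?m"
    proof -
      have "R (wrap xs ! (i - 1)) (wrap xs ! i)" "R (wrap xs ! i) (wrap xs ! (i + 1))"
        "R (wrap xs ! (i - 1)) (wrap xs ! (i + 1))"
        using sorted_wrt_R_wrap[OF xs] that len by (auto simp: sorted_wrt_iff_nth_less)
      then show ?thesis by (simp add: R_def strictly_between_def)
    qed
    then show ?thesis by (auto simp: face_valid_def len)
  qed
  have del: "delete_nth (Suc i) (wrap xs) = wrap (delete_nth i xs)" if "i < ?m" for i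
    using that by (simp add: delete_nth_def wrap_def take_map drop_map)
  have "magnitude_boundary d (wrap xs) =
      (\<Sum>i<Suc (Suc ?m). frag_cmul ((- 1) ^ i) (if 1 \<le> i \<and> i < Suc ?m then frag_of (delete_nth i (wrap xs)) else 0))"
    by (simp only: magnitude_boundary_eq deletion_boundary_def len valid)
  also have "\<dots> = (\<Sum>i<?m. frag_cmul ((- 1) ^ Suc i) (frag_of (delete_nth (Suc i) (wrap xs))))"
    by (subst sum.lessThan_Suc, subst sum.lessThan_Suc_shift) simp
  also have "\<dots> = (\<Sum>i<?m. - frag_extend (frag_of \<circ> wrap) (frag_cmul ((- 1) ^ i) (frag_of (delete_nth i xs))))"
    by (intro sum.cong) (auto simp: del frag_extend_cmul)
  also have "\<dots> = - frag_extend (frag_of \<circ> wrap) (simplicial_boundary xs)"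
    by (simp add: simplicial_boundary_def frag_extend_sum sum_negf)
  finally show ?thesis .
qed

text \<open>Projection to the summand spanned by the wrapped chains; all other generators go to
  \<open>0\<close>.\<close>

definition unwrap :: "'x list \<Rightarrow> 'p list \<Rightarrow>\<^sub>0 int" where
  "unwrap ys = (if ys \<in> wrap ` chains then frag_of (inv_into chains wrap ys) else 0)"

lemma unwrap_wrap: "xs \<in> chains \<Longrightarrow> unwrap (wrap xs) = frag_of xs"
  by (simp add: unwrap_def inj_wrap inv_into_f_f)

lemma delete_chains: "xs \<in> chains \<Longrightarrow> delete_nth i xs \<in> chains"
  using set_delete_nth[of i xs] sorted_wrt_delete_nth[of lt xs i] by (auto simp: chains_def)

lemma keys_simplicial_boundary_chains:
  "xs \<in> chains \<Longrightarrow> Poly_Mapping.keys (simplicial_boundary xs) \<subseteq> chains"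
  unfolding simplicial_boundary_eq using keys_deletion_boundary[of "\<lambda>_ _. True" xs] delete_chains by blast

lemma unwrap_extend:
  assumes "Poly_Mapping.keys c \<subseteq> chains"
  shows "frag_extend unwrap (frag_extend (frag_of \<circ> wrap) c) = c"
proof -
  have "frag_extend unwrap (frag_extend (frag_of \<circ> wrap) c) = frag_extend (\<lambda>x. unwrap (wrap x)) c"
    by (simp add: frag_extend_extend)
  also have "\<dots> = frag_extend frag_of c"
    using assms by (intro frag_extend_eq) (auto simp: unwrap_wrap)
  finally show ?thesis by (simp flip: frag_expansion)
qed

text \<open>A path of this length that does not come from a chain has other endpoints, and so do its
  faces; both sides are then zero.\<close>

lemma unwrap_magnitude_boundary:
  assumes ys: "ys \<in> proper_chains X d (Suc n) (\<rho> e1 - \<rho> e0)"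
  shows "frag_extend unwrap (magnitude_boundary d ys) = - frag_extend simplicial_boundary (unwrap ys)"
proof (cases "ys \<in> wrap ` chains")
  case True
  then obtain xs where xs: "xs \<in> chains" "ys = wrap xs" by auto
  then show ?thesis
    by (simp add: magnitude_boundary_wrap frag_extend_minus unwrap_extend keys_simplicial_boundary_chains unwrap_wrap)
next
  case False
  then have ends: "\<not> (hd ys = e0 \<and> last ys = e1)" using proper_is_wrap[OF ys] by blast
  have "unwrap zs = 0" if zs: "zs \<in> Poly_Mapping.keys (magnitude_boundary d ys)" for zs
  proof -
    obtain i where "zs = delete_nth i ys" "face_valid d i ys"
      using zs keys_deletion_boundary[of "face_valid d" ys] unfolding magnitude_boundary_eq by blast
    then have "\<not> (hd zs = e0 \<and> last zs = e1)" using proper_chains_delete(2,3)[OF ys] ends by simp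
    then have "zs \<notin> wrap ` chains" by (auto simp: wrap_def)
    then show ?thesis by (simp add: unwrap_def)
  qed
  then have "frag_extend unwrap (magnitude_boundary d ys) = 0" by (intro frag_extend_eq_0) auto
  then show ?thesis using False by (simp add: unwrap_def)
qed

text \<open>The projection \<open>unwrap\<close> is a left inverse of the embedding and commutes
  with the boundaries up to sign, so a filling of the image of \<open>c\<close> projects to a
  filling of \<open>c\<close>.\<close>

lemma wrap_cycles:
  assumes c: "c \<in> chain_cycles (simplicial_chains P lt m) simplicial_boundary"
  shows "frag_extend (frag_of \<circ> wrap) c
     \<in> chain_cycles (proper_chains X d (Suc m) (\<rho> e1 - \<rho> e0)) (magnitude_boundary d)"
    and "frag_extend (frag_of \<circ> wrap) c
     \<in> chain_boundaries (proper_chains X d (Suc (Suc m)) (\<rho> e1 - \<rho> e0)) (magnitude_boundary d) \<longleftrightarrow>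
     c \<in> chain_boundaries (simplicial_chains P lt (Suc m)) simplicial_boundary"
proof -
  let ?W = "frag_extend (frag_of \<circ> wrap)" and ?l = "\<rho> e1 - \<rho> e0"
  have simp_chains: "simplicial_chains P lt k \<subseteq> chains" for k by (auto simp: simplicial_chains_def chains_def)
  have W_keys: "Poly_Mapping.keys (?W b) \<subseteq> proper_chains X d (Suc k) ?l"
    if "Poly_Mapping.keys b \<subseteq> simplicial_chains P lt k" for b k
  proof -
    have "Poly_Mapping.keys (?W b) \<subseteq> wrap ` Poly_Mapping.keys b"
      using keys_frag_extend[of "frag_of \<circ> wrap" b] by auto
    moreover have "wrap xs \<in> proper_chains X d (Suc k) ?l" if "xs \<in> simplicial_chains P lt k" for xs
      using wrap_proper[of xs] simp_chains that by (auto simp: simplicial_chains_def)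
    ultimately show ?thesis using that by blast
  qed
  have W_bd: "frag_extend (magnitude_boundary d) (?W b) = - ?W (frag_extend simplicial_boundary b)"
    if "Poly_Mapping.keys b \<subseteq> chains" for b
  proof -
    have "frag_extend (magnitude_boundary d) (?W b) = frag_extend (\<lambda>xs. - ?W (simplicial_boundary xs)) b"
      unfolding frag_extend_extend
      using that by (intro frag_extend_eq) (auto simp: magnitude_boundary_wrap)
    then show ?thesis by (simp only: frag_extend_uminus frag_extend_extend)
  qed
  have keys: "Poly_Mapping.keys c \<subseteq> simplicial_chains P lt m" "Poly_Mapping.keys c \<subseteq> chains"
    using c simp_chains[of m] by (auto simp: chain_cycles_def)
  show "?W c \<in> chain_cycles (proper_chains X d (Suc m) ?l) (magnitude_boundary d)"
    using c W_keys[OF keys(1)] W_bd[OF keys(2)] by (simp add: chain_cycles_def)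
  show "?W c \<in> chain_boundaries (proper_chains X d (Suc (Suc m)) ?l) (magnitude_boundary d) \<longleftrightarrow>
     c \<in> chain_boundaries (simplicial_chains P lt (Suc m)) simplicial_boundary"
  proof
    assume "c \<in> chain_boundaries (simplicial_chains P lt (Suc m)) simplicial_boundary"
    then obtain b where b: "Poly_Mapping.keys b \<subseteq> simplicial_chains P lt (Suc m)" "c = frag_extend simplicial_boundary b"
      by (auto simp: chain_boundaries_def)
    then have "?W c = frag_extend (magnitude_boundary d) (- ?W b)"
      using W_bd[of b] simp_chains[of "Suc m"] by (simp add: frag_extend_minus)
    moreover have "Poly_Mapping.keys (- ?W b) \<subseteq> proper_chains X d (Suc (Suc m)) ?l" using W_keys[OF b(1)] by simp
    ultimately show "?W c \<in> chain_boundaries (proper_chains X d (Suc (Suc m)) ?l) (magnitude_boundary d)"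
      by (auto simp: chain_boundaries_def)
  next
    assume "?W c \<in> chain_boundaries (proper_chains X d (Suc (Suc m)) ?l) (magnitude_boundary d)"
    then obtain b where b: "Poly_Mapping.keys b \<subseteq> proper_chains X d (Suc (Suc m)) ?l"
      "?W c = frag_extend (magnitude_boundary d) b" by (auto simp: chain_boundaries_def)
    have "c = frag_extend unwrap (frag_extend (magnitude_boundary d) b)"
      using unwrap_extend[OF keys(2)] b(2) by simp
    also have "\<dots> = frag_extend (\<lambda>ys. - frag_extend simplicial_boundary (unwrap ys)) b"
      unfolding frag_extend_extend
      using b(1) by (intro frag_extend_eq) (auto simp: unwrap_magnitude_boundary)
    also have "\<dots> = frag_extend simplicial_boundary (- frag_extend unwrap b)"
      by (simp only: frag_extend_uminus frag_extend_extend frag_extend_minus)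
    finally have "c = frag_extend simplicial_boundary (- frag_extend unwrap b)" .
    moreover have "Poly_Mapping.keys (- frag_extend unwrap b) \<subseteq> simplicial_chains P lt (Suc m)"
    proof
      fix xs assume "xs \<in> Poly_Mapping.keys (- frag_extend unwrap b)"
      then obtain ys where ys: "ys \<in> Poly_Mapping.keys b" "xs \<in> Poly_Mapping.keys (unwrap ys)"
        using keys_frag_extend[of unwrap b] by auto
      then obtain zs where "zs \<in> chains" "ys = wrap zs" by (auto simp: unwrap_def split: if_splits)
      with ys have "xs \<in> chains" "ys = wrap xs" by (auto simp: unwrap_wrap)
      moreover have "length ys = Suc (Suc (Suc m))" using ys(1) b(1) by (auto simp: proper_chains_eq)
      ultimately show "xs \<in> simplicial_chains P lt (Suc m)" by (auto simp: chains_def simplicial_chains_def wrap_def)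
    qed
    ultimately show "c \<in> chain_boundaries (simplicial_chains P lt (Suc m)) simplicial_boundary"
      by (auto simp: chain_boundaries_def)
  qed
qed

end

section \<open>Shortest path metrics of graded posets\<close>

lemma walk_0: "walk V adj a b 0 \<longleftrightarrow> a = b \<and> a \<in> V"
  by (auto simp: walk_def intro!: exI[of _ "\<lambda>_. b"])

lemma walk_Suc: "walk V adj a b (Suc n) \<longleftrightarrow> (\<exists>c. walk V adj a c n \<and> adj c b \<and> b \<in> V)"
proof
  assume "walk V adj a b (Suc n)"
  then obtain x where x: "x 0 = a" "x (Suc n) = b" "\<forall>i\<le>Suc n. x i \<in> V" "\<forall>i<Suc n. adj (x i) (x (Suc i))"
    by (auto simp: walk_def)
  then have "walk V adj a (x n) n" unfolding walk_def by (intro exI[of _ x]) auto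
  then show "\<exists>c. walk V adj a c n \<and> adj c b \<and> b \<in> V" using x by auto
next
  assume "\<exists>c. walk V adj a c n \<and> adj c b \<and> b \<in> V"
  then obtain x where x: "x 0 = a" "\<forall>i\<le>n. x i \<in> V" "\<forall>i<n. adj (x i) (x (Suc i))" "adj (x n) b" "b \<in> V"
    by (auto simp: walk_def)
  show "walk V adj a b (Suc n)"
    unfolding walk_def using x by (intro exI[of _ "x(Suc n := b)"]) (auto simp: less_Suc_eq le_Suc_eq)
qed

lemma walk_append: "walk V adj a b n \<Longrightarrow> walk V adj b c m \<Longrightarrow> walk V adj a c (n + m)"
  by (induction m arbitrary: c) (auto simp: walk_0 walk_Suc)

lemma walk_ends: "walk V adj a b n \<Longrightarrow> a \<in> V \<and> b \<in> V"
  by (auto simp: walk_def)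

lemma walk_sym:
  assumes sym: "\<And>u v. adj u v \<Longrightarrow> adj v u" and "walk V adj a b n"
  shows "walk V adj b a n"
  using assms(2)
proof (induction n arbitrary: b)
  case 0
  then show ?case by (auto simp: walk_0)
next
  case (Suc n)
  then obtain c where c: "walk V adj a c n" "adj c b" "b \<in> V" by (auto simp: walk_Suc)
  have "walk V adj b c (Suc 0)" using c sym walk_ends[OF c(1)] by (auto simp: walk_Suc walk_0)
  from walk_append[OF this Suc.IH[OF c(1)]] show ?case by simp
qed

lemma path_dist_le: "walk V adj a b n \<Longrightarrow> path_dist V adj a b \<le> real n"
  by (simp add: path_dist_def Least_le)

lemma path_dist_walk:
  assumes "\<exists>n. walk V adj a b n"
  obtains n where "walk V adj a b n" "path_dist V adj a b = real n"
  using LeastI_ex[OF assms] by (simp add: path_dist_def)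

lemma path_dist_Metric_space:
  assumes sym: "\<And>u v. adj u v \<Longrightarrow> adj v u" and conn: "\<And>a b. a \<in> V \<Longrightarrow> b \<in> V \<Longrightarrow> \<exists>n. walk V adj a b n"
  shows "Metric_space V (path_dist V adj)"
proof
  show "0 \<le> path_dist V adj x y" for x y by (simp add: path_dist_def)
  have "walk V adj x y n \<longleftrightarrow> walk V adj y x n" for x y n
    using walk_sym[where adj = adj] sym by metis
  then show "path_dist V adj x y = path_dist V adj y x" for x y by (simp add: path_dist_def)
  show "(path_dist V adj x y = 0) = (x = y)" if xy: "x \<in> V" "y \<in> V" for x y
  proof
    assume 0: "path_dist V adj x y = 0"
    obtain n where "walk V adj x y n" "path_dist V adj x y = real n"
      using path_dist_walk[OF conn[OF xy]] by blast
    then show "x = y" using 0 by (simp add: walk_0)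
  next
    assume "x = y"
    then have "path_dist V adj x y \<le> real 0" using xy by (intro path_dist_le) (simp add: walk_0)
    then show "path_dist V adj x y = 0" using \<open>0 \<le> path_dist V adj x y\<close> by simp
  qed
  show "path_dist V adj x z \<le> path_dist V adj x y + path_dist V adj y z"
    if xyz: "x \<in> V" "y \<in> V" "z \<in> V" for x y z
  proof -
    obtain n where n: "walk V adj x y n" "path_dist V adj x y = real n"
      using path_dist_walk[OF conn[OF xyz(1,2)]] by blast
    obtain m where m: "walk V adj y z m" "path_dist V adj y z = real m"
      using path_dist_walk[OF conn[OF xyz(2,3)]] by blast
    show ?thesis using path_dist_le[OF walk_append[OF n(1) m(1)]] n m by simp
  qed
qed

section \<open>Distance and rank in graded posets\<close>

lemma covers_in: "partial_order_on H ord \<Longrightarrow> covers ord b a \<Longrightarrow> a \<in> H \<and> b \<in> H"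
  by (auto simp: covers_def partial_order_on_def preorder_on_def)

text \<open>Every edge of the Hasse diagram changes the rank by one, so the rise of rank bounds the
  distance from below; the least element makes the diagram connected.\<close>

locale graded_poset =
  fixes H :: "'h set" and ord :: "('h \<times> 'h) set" and \<rho> :: "'h \<Rightarrow> nat" and bot :: 'h
  assumes po: "partial_order_on H ord"
    and bot: "\<And>a. a \<in> H \<Longrightarrow> (bot, a) \<in> ord"
    and strict: "\<And>a b. (a, b) \<in> ord \<Longrightarrow> a \<noteq> b \<Longrightarrow> \<rho> a < \<rho> b"
    and cov: "\<And>a b. covers ord b a \<Longrightarrow> \<rho> b = Suc (\<rho> a)"
begin

definition adj :: "'h \<Rightarrow> 'h \<Rightarrow> bool" where
  "adj = (\<lambda>a b. covers ord b a \<or> covers ord a b)"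

lemma hasse_dist_adj: "hasse_dist H ord = path_dist H adj"
  by (simp add: hasse_dist_def adj_def)

lemma le_in: "(a, b) \<in> ord \<Longrightarrow> a \<in> H \<and> b \<in> H"
  using po by (auto simp: partial_order_on_def preorder_on_def)

lemma le_trans: "(a, b) \<in> ord \<Longrightarrow> (b, c) \<in> ord \<Longrightarrow> (a, c) \<in> ord"
  using po by (meson partial_order_on_def preorder_on_def transE)

text \<open>An ordered pair that is not a cover is split at an element in between. Both rank
  differences are smaller, so the refinement ends.\<close>

lemma upward_walk: "(a, b) \<in> ord \<Longrightarrow> \<rho> b = \<rho> a + n \<Longrightarrow> walk H adj a b n"
proof (induction n arbitrary: a b rule: less_induct)
  case (less n)
  show ?case
  proof (cases "a = b")
    case True
    then show ?thesis using less.prems le_in by (auto simp: walk_0)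
  next
    case ab: False
    show ?thesis
    proof (cases "covers ord b a")
      case True
      then have "n = Suc 0" using cov less.prems by fastforce
      then show ?thesis using True less.prems le_in by (auto simp: walk_Suc walk_0 adj_def)
    next
      case False
      then obtain c where c: "c \<noteq> a" "c \<noteq> b" "(a, c) \<in> ord" "(c, b) \<in> ord"
        using ab less.prems by (auto simp: covers_def)
      have "\<rho> a < \<rho> c" "\<rho> c < \<rho> b" using strict c by auto
      then obtain i j where ij: "\<rho> c = \<rho> a + i" "\<rho> b = \<rho> c + j" by (metis less_imp_add_positive)
      have "i < n" "j < n" "n = i + j" using ij \<open>\<rho> a < \<rho> c\<close> \<open>\<rho> c < \<rho> b\<close> less.prems by auto
      then show ?thesis using walk_append[OF less.IH[OF _ c(3) ij(1)] less.IH[OF _ c(4) ij(2)]] by simp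
    qed
  qed
qed

lemma walk_rank_le: "walk H adj a b n \<Longrightarrow> \<rho> b \<le> \<rho> a + n"
proof (induction n arbitrary: b)
  case (Suc n)
  then obtain c where c: "walk H adj a c n" "adj c b" by (auto simp: walk_Suc)
  then have "\<rho> b \<le> Suc (\<rho> c)" using cov by (fastforce simp: adj_def)
  then show ?case using Suc.IH[OF c(1)] by simp
qed (simp add: walk_0)

text \<open>A walk gains at most one rank in each step. One that gains \<open>n\<close> ranks in
  \<open>n\<close> steps therefore goes up at every step.\<close>

lemma walk_rank_eq: "walk H adj a b n \<Longrightarrow> \<rho> b = \<rho> a + n \<Longrightarrow> (a, b) \<in> ord"
proof (induction n arbitrary: b)
  case 0
  then show ?case using po by (auto simp: walk_0 partial_order_on_def preorder_on_def refl_on_def)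
next
  case (Suc n)
  then obtain c where c: "walk H adj a c n" "adj c b" by (auto simp: walk_Suc)
  have "\<rho> c \<le> \<rho> a + n" using walk_rank_le[OF c(1)] .
  moreover have "\<rho> b \<le> Suc (\<rho> c)" using c(2) cov by (fastforce simp: adj_def)
  ultimately have "\<rho> c = \<rho> a + n" "\<rho> b = Suc (\<rho> c)" using Suc.prems(2) by auto
  moreover from this have "covers ord b c" using c(2) cov[of c b] by (auto simp: adj_def)
  ultimately show ?case using Suc.IH[OF c(1)] le_trans by (auto simp: covers_def)
qed

lemma connected: "a \<in> H \<Longrightarrow> b \<in> H \<Longrightarrow> \<exists>n. walk H adj a b n"
proof -
  have *: "\<exists>n. walk H adj bot c n" if "c \<in> H" for c
  proof -
    have "\<rho> bot \<le> \<rho> c" using strict[OF bot[OF that]] by (cases "bot = c") auto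
    then obtain n where "\<rho> c = \<rho> bot + n" by (metis le_iff_add)
    then show ?thesis using upward_walk[OF bot[OF that]] by blast
  qed
  have adj_sym: "adj v u" if "adj u v" for u v using that by (auto simp: adj_def)
  assume "a \<in> H" "b \<in> H"
  with * obtain n m where "walk H adj bot a n" "walk H adj bot b m" by blast
  then show ?thesis using walk_sym[where adj = adj, OF adj_sym] walk_append by metis
qed

lemma Metric: "Metric_space H (hasse_dist H ord)"
  unfolding hasse_dist_adj using connected by (intro path_dist_Metric_space) (auto simp: adj_def)

lemma dist_ge: "a \<in> H \<Longrightarrow> b \<in> H \<Longrightarrow> real (\<rho> b) - real (\<rho> a) \<le> hasse_dist H ord a b"
  using path_dist_walk[OF connected[of a b]] walk_rank_le[of a b] unfolding hasse_dist_adj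
  by (metis add.commute diff_le_eq of_nat_add of_nat_mono)

lemma dist_eq_iff:
  assumes "a \<in> H" "b \<in> H"
  shows "hasse_dist H ord a b = real (\<rho> b) - real (\<rho> a) \<longleftrightarrow> (a, b) \<in> ord"
proof
  assume eq: "hasse_dist H ord a b = real (\<rho> b) - real (\<rho> a)"
  obtain n where n: "walk H adj a b n" "hasse_dist H ord a b = real n"
    using path_dist_walk[OF connected[OF assms]] unfolding hasse_dist_adj by blast
  then have "\<rho> b = \<rho> a + n" using eq by linarith
  then show "(a, b) \<in> ord" using walk_rank_eq n(1) by blast
next
  assume ab: "(a, b) \<in> ord"
  then have "\<rho> a \<le> \<rho> b" using strict by (cases "a = b") (auto intro: less_imp_le)
  then obtain n where n: "\<rho> b = \<rho> a + n" by (metis le_iff_add)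
  have "hasse_dist H ord a b \<le> real n"
    unfolding hasse_dist_adj by (rule path_dist_le[OF upward_walk[OF ab n]])
  then show "hasse_dist H ord a b = real (\<rho> b) - real (\<rho> a)" using dist_ge[OF assms] n by simp
qed

end

text \<open>\<open>k\<close> is meant to be the common size of the maximal chains. With ranks
  \<open>0\<close> and \<open>k + 1\<close> for the new ends, heights 1 at minimal and
  \<open>k\<close> at maximal elements make covers that involve an end rise by one as well; for
  empty \<open>P\<close>, where \<open>Hat1\<close> covers \<open>Hat0\<close>, this requires
  \<open>k = 0\<close>.\<close>

definition height_function :: "'a set \<Rightarrow> ('a \<times> 'a) set \<Rightarrow> ('a \<Rightarrow> nat) \<Rightarrow> nat \<Rightarrow> bool" where
  "height_function P r ht k \<longleftrightarrow>
     (\<forall>x y. (x, y) \<in> r \<longrightarrow> x \<noteq> y \<longrightarrow> ht x < ht y) \<and>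
     (\<forall>x y. covers r y x \<longrightarrow> ht y = Suc (ht x)) \<and>
     (\<forall>x\<in>P. (\<forall>y. (y, x) \<in> r \<longrightarrow> y = x) \<longrightarrow> ht x = 1) \<and>
     (\<forall>x\<in>P. (\<forall>y. (x, y) \<in> r \<longrightarrow> y = x) \<longrightarrow> ht x = k) \<and>
     (\<forall>x\<in>P. 1 \<le> ht x \<and> ht x \<le> k) \<and> (P = {} \<longrightarrow> k = 0)"

definition hat_rank :: "('a \<Rightarrow> nat) \<Rightarrow> nat \<Rightarrow> 'a hat \<Rightarrow> nat" where
  "hat_rank ht k a = (case a of Hat0 \<Rightarrow> 0 | Elem x \<Rightarrow> ht x | Hat1 \<Rightarrow> Suc k)"

lemma hat_carrier_simps [simp]: "Hat0 \<in> hat_carrier P" "Hat1 \<in> hat_carrier P" "Elem x \<in> hat_carrier P \<longleftrightarrow> x \<in> P"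
  by (auto simp: hat_carrier_def)

lemma hat_order_simps [simp]:
  "(Hat0, b) \<in> hat_order P r \<longleftrightarrow> b \<in> hat_carrier P"
  "(a, Hat1) \<in> hat_order P r \<longleftrightarrow> a \<in> hat_carrier P"
  "(Elem x, Elem y) \<in> hat_order P r \<longleftrightarrow> x \<in> P \<and> y \<in> P \<and> (x, y) \<in> r"
  "(Elem x, Hat0) \<notin> hat_order P r" "(Hat1, Hat0) \<notin> hat_order P r" "(Hat1, Elem x) \<notin> hat_order P r"
  by (auto simp: hat_order_def)

lemma hat_order_partial_order:
  assumes "partial_order_on P r"
  shows "partial_order_on (hat_carrier P) (hat_order P r)"
proof -
  have r: "r \<subseteq> P \<times> P" "\<And>x. x \<in> P \<Longrightarrow> (x, x) \<in> r" "trans r" "antisym r"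
    using assms by (auto simp: partial_order_on_def preorder_on_def refl_on_def)
  have "hat_order P r \<subseteq> hat_carrier P \<times> hat_carrier P" by (auto simp: hat_order_def)
  moreover have "(a, a) \<in> hat_order P r" if "a \<in> hat_carrier P" for a
    using that r(2) by (cases a) auto
  moreover have "(a, c) \<in> hat_order P r" if "(a, b) \<in> hat_order P r" "(b, c) \<in> hat_order P r" for a b c
    using that by (cases a; cases b; cases c) (auto intro: transD[OF r(3)])
  moreover have "a = b" if "(a, b) \<in> hat_order P r" "(b, a) \<in> hat_order P r" for a b
    using that by (cases a; cases b) (auto intro: antisymD[OF r(4)])
  ultimately show ?thesis
    unfolding partial_order_on_def preorder_on_def by (intro conjI refl_onI transI antisymI)
qed

lemma hat_graded:
  assumes po: "partial_order_on P r" and ht: "height_function P r ht k"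
  shows "graded_poset (hat_carrier P) (hat_order P r) (hat_rank ht k) Hat0"
proof
  show "partial_order_on (hat_carrier P) (hat_order P r)" by (rule hat_order_partial_order[OF po])
  show "(Hat0, a) \<in> hat_order P r" if "a \<in> hat_carrier P" for a using that by simp
  have r: "(x, y) \<in> r \<Longrightarrow> x \<in> P \<and> y \<in> P" for x y
    using po by (auto simp: partial_order_on_def preorder_on_def)
  have h1: "ht x < ht y" if "(x, y) \<in> r" "x \<noteq> y" for x y using ht that by (simp add: height_function_def)
  have h2: "ht y = Suc (ht x)" if "covers r y x" for x y using ht that by (simp add: height_function_def)
  have h3: "ht x = 1" if "x \<in> P" "\<And>y. (y, x) \<in> r \<Longrightarrow> y = x" for x using ht that by (auto simp: height_function_def)
  have h4: "ht x = k" if "x \<in> P" "\<And>y. (x, y) \<in> r \<Longrightarrow> y = x" for x using ht that by (auto simp: height_function_def)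
  have h5: "1 \<le> ht x" "ht x \<le> k" if "x \<in> P" for x using ht that by (auto simp: height_function_def)
  have h6: "k = 0" if "P = {}" using ht that by (simp add: height_function_def)
  show "hat_rank ht k a < hat_rank ht k b" if "(a, b) \<in> hat_order P r" "a \<noteq> b" for a b
    using that h1 h5 by (cases a; cases b) (auto simp: hat_rank_def Suc_le_eq le_imp_less_Suc)
  show "hat_rank ht k b = Suc (hat_rank ht k a)" if ab: "covers (hat_order P r) b a" for a b
  proof -
    have ord: "(a, b) \<in> hat_order P r" "a \<noteq> b"
      and no: "\<And>c. (a, c) \<in> hat_order P r \<Longrightarrow> (c, b) \<in> hat_order P r \<Longrightarrow> c = a \<or> c = b"
      using ab unfolding covers_def by blast+
    show ?thesis
    proof (cases a)
      case a: Hat0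
      show ?thesis
      proof (cases b)
        case (Elem x)
        then have "x \<in> P" using ord a by simp
        moreover have "y = x" if "(y, x) \<in> r" for y using no[of "Elem y"] r[OF that] that a Elem by auto
        ultimately show ?thesis using h3[of x] a Elem by (simp add: hat_rank_def)
      next
        case Hat1
        have "P = {}" using no[of "Elem _"] a Hat1 by auto
        then show ?thesis using h6 a Hat1 by (simp add: hat_rank_def)
      qed (use ord a in auto)
    next
      case a: (Elem x)
      then have x: "x \<in> P" using ord(1) by (auto simp: hat_order_def)
      show ?thesis
      proof (cases b)
        case (Elem y)
        have "covers r y x"
          unfolding covers_def using ord no[of "Elem _"] a Elem r by auto
        then show ?thesis using h2 a Elem by (simp add: hat_rank_def)
      next
        case Hat1
        have "y = x" if "(x, y) \<in> r" for y using no[of "Elem y"] r[OF that] that a Hat1 by auto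
        then show ?thesis using h4[of x] x a Hat1 by (simp add: hat_rank_def)
      qed (use ord a in auto)
    next
      case Hat1
      then show ?thesis using ord by (cases b) auto
    qed
  qed
qed

text \<open>The injection \<open>f\<close> renames the points, so that one result serves
  \<open>hat_carrier P\<close> itself and copies of it on natural numbers.\<close>

lemma hat_embedding_transfer:
  fixes \<rho> :: "'a hat \<Rightarrow> real"
  assumes f: "inj_on f (hat_carrier P)" and X: "X = f ` hat_carrier P"
    and metric: "Metric_space X d"
    and ge: "\<And>a b. a \<in> hat_carrier P \<Longrightarrow> b \<in> hat_carrier P \<Longrightarrow> \<rho> b - \<rho> a \<le> d (f a) (f b)"
    and eq: "\<And>a b. a \<in> hat_carrier P \<Longrightarrow> b \<in> hat_carrier P \<Longrightarrow>
      d (f a) (f b) = \<rho> b - \<rho> a \<longleftrightarrow> (a, b) \<in> hat_order P r"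
  shows "hat_embedding X d P (\<lambda>x y. (x, y) \<in> r \<and> x \<noteq> y) (f \<circ> Elem) (f Hat0) (f Hat1)
     (\<lambda>x. \<rho> (inv_into (hat_carrier P) f x))"
proof -
  interpret Metric_space X d by (rule metric)
  have inv: "inv_into (hat_carrier P) f (f a) = a" if "a \<in> hat_carrier P" for a
    using f that by (rule inv_into_f_f)
  have f_eq: "f a = f b \<longleftrightarrow> a = b" if "a \<in> hat_carrier P" "b \<in> hat_carrier P" for a b
    using f that by (auto dest: inj_onD)
  show ?thesis
  proof
    show "X = {f Hat0, f Hat1} \<union> (f \<circ> Elem) ` P" by (auto simp: X hat_carrier_def)
    show "inj_on (f \<circ> Elem) P" by (auto simp: inj_on_def f_eq)
    fix a b assume "a \<in> X" "b \<in> X"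
    then obtain a' b' where "a' \<in> hat_carrier P" "b' \<in> hat_carrier P" "a = f a'" "b = f b'" by (auto simp: X)
    then show "\<rho> (inv_into (hat_carrier P) f b) - \<rho> (inv_into (hat_carrier P) f a) \<le> d a b"
      using ge[of a' b'] by (simp add: inv)
  qed (simp_all add: inv f_eq eq conj_commute)
qed

lemma hat_embedding_inj:
  assumes po: "partial_order_on P r" and ht: "height_function P r ht k"
    and f: "inj_on f (hat_carrier P)" and X: "X = f ` hat_carrier P"
    and metric: "Metric_space X d"
    and d: "\<And>a b. a \<in> hat_carrier P \<Longrightarrow> b \<in> hat_carrier P \<Longrightarrow> d (f a) (f b) = hat_dist P r a b"
  shows "hat_embedding X d P (\<lambda>x y. (x, y) \<in> r \<and> x \<noteq> y) (f \<circ> Elem) (f Hat0) (f Hat1)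
     (\<lambda>x. real (hat_rank ht k (inv_into (hat_carrier P) f x)))"
proof -
  interpret G: graded_poset "hat_carrier P" "hat_order P r" "hat_rank ht k" Hat0
    by (rule hat_graded[OF po ht])
  show ?thesis
    by (rule hat_embedding_transfer[OF f X metric])
      (simp_all add: d[unfolded hat_dist_def] G.dist_ge G.dist_eq_iff)
qed

lemma walk_image:
  assumes f: "inj_on f V" and adj: "\<And>u v. u \<in> V \<Longrightarrow> v \<in> V \<Longrightarrow> adj' (f u) (f v) \<longleftrightarrow> adj u v"
    and ab: "a \<in> V" "b \<in> V"
  shows "walk (f ` V) adj' (f a) (f b) n \<longleftrightarrow> walk V adj a b n"
  using ab(2)
proof (induction n arbitrary: b)
  case 0
  then show ?case using f ab(1) by (auto simp: walk_0 inj_on_def)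
next
  case (Suc n)
  have "walk (f ` V) adj' (f a) (f b) (Suc n) \<longleftrightarrow> (\<exists>c\<in>V. walk (f ` V) adj' (f a) (f c) n \<and> adj' (f c) (f b))"
    using Suc.prems walk_ends[of "f ` V" adj' "f a"] by (auto simp: walk_Suc; blast)
  also have "\<dots> \<longleftrightarrow> walk V adj a b (Suc n)"
    using Suc adj walk_ends[of V adj a] by (auto simp: walk_Suc; blast)
  finally show ?case .
qed

section \<open>Ranked posets have height functions\<close>

lemma chain_extends_to_maximal:
  assumes "C \<in> Chains r"
  obtains M where "M \<in> maximal_chains r" "C \<subseteq> M"
proof -
  let ?A = "{D \<in> Chains r. C \<subseteq> D}"
  have "\<exists>M\<in>?A. \<forall>X\<in>?A. M \<subseteq> X \<longrightarrow> X = M"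
  proof (rule subset_Zorn)
    fix Cs assume Cs: "subset.chain ?A Cs"
    show "\<exists>U\<in>?A. \<forall>X\<in>Cs. X \<subseteq> U"
    proof (cases "Cs = {}")
      case True
      then show ?thesis using assms by (intro bexI[of _ C]) auto
    next
      case False
      have "(a, b) \<in> r \<or> (b, a) \<in> r" if ab: "a \<in> \<Union>Cs" "b \<in> \<Union>Cs" for a b
      proof -
        obtain S T where ST: "S \<in> Cs" "T \<in> Cs" "a \<in> S" "b \<in> T" using ab by auto
        have "S \<subseteq> T \<or> T \<subseteq> S" using Cs ST by (auto simp: subset_chain_def)
        moreover have "S \<in> Chains r" "T \<in> Chains r" using Cs ST by (auto simp: subset_chain_def)
        ultimately show ?thesis using ST(3,4) unfolding Chains_def by blast
      qed
      moreover have "C \<subseteq> \<Union>Cs"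
      proof -
        obtain S where S: "S \<in> Cs" using False by auto
        then have "C \<subseteq> S" using Cs by (auto simp: subset_chain_def)
        then show ?thesis using S by auto
      qed
      ultimately show ?thesis by (intro bexI[of _ "\<Union>Cs"]) (auto simp: Chains_def)
    qed
  qed
  then obtain M where M: "M \<in> ?A" "\<forall>X\<in>?A. M \<subseteq> X \<longrightarrow> X = M" by (rule bexE)
  have "D = M" if "D \<in> Chains r" "M \<subseteq> D" for D
  proof -
    have "D \<in> ?A" using M(1) that by auto
    then show ?thesis using M(2) that(2) by blast
  qed
  then have "M \<in> maximal_chains r" using M(1) by (simp add: maximal_chains_def)
  moreover have "C \<subseteq> M" using M(1) by simp
  ultimately show ?thesis by (rule that)
qed

text \<open>The height of \<open>x\<close> is the largest size of a chain with greatest element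
  \<open>x\<close>; it is bounded since every chain extends to a maximal one.\<close>

lemma ranked_poset_height_function:
  assumes "ranked_poset P r"
  shows "\<exists>ht k. height_function P r ht k"
proof -
  have po: "partial_order_on P r" using assms by (simp add: ranked_poset_def)
  obtain k where k: "\<And>C. C \<in> maximal_chains r \<Longrightarrow> finite C \<and> card C = k"
    using assms by (auto simp: ranked_poset_def)
  have r: "r \<subseteq> P \<times> P" "\<And>x. x \<in> P \<Longrightarrow> (x, x) \<in> r"
    and tr: "\<And>x y z. (x, y) \<in> r \<Longrightarrow> (y, z) \<in> r \<Longrightarrow> (x, z) \<in> r"
    and as: "\<And>x y. (x, y) \<in> r \<Longrightarrow> (y, x) \<in> r \<Longrightarrow> x = y"
    using po by (auto simp: partial_order_on_def preorder_on_def refl_on_def dest: transD antisymD)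
  have fin: "finite C \<and> card C \<le> k" if C: "C \<in> Chains r" for C
    using chain_extends_to_maximal[OF C] k by (metis card_mono finite_subset)
  define D where "D x = {C \<in> Chains r. x \<in> C \<and> (\<forall>y\<in>C. (y, x) \<in> r)}" for x
  define ht where "ht x = Max (card ` D x)" for x
  have sing: "{x} \<in> D x" if "x \<in> P" for x using that r by (auto simp: D_def Chains_def)
  have fin_card: "finite (card ` D x)" for x
    by (rule finite_subset[of _ "{..k}"]) (use fin in \<open>auto simp: D_def\<close>)
  have ht_ge: "card C \<le> ht x" if "C \<in> D x" for C x
    unfolding ht_def using that fin_card by (intro Max_ge) auto
  have ht_attained: "\<exists>C\<in>D x. card C = ht x" if "x \<in> P" for x
  proof -
    have "ht x \<in> card ` D x" unfolding ht_def using sing[OF that] fin_card by (intro Max_in) auto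
    then show ?thesis by auto
  qed
  have h1: "ht x < ht y" if xy: "(x, y) \<in> r" "x \<noteq> y" for x y
  proof -
    have "x \<in> P" using xy r by auto
    then obtain C where C: "C \<in> D x" "card C = ht x" using ht_attained by blast
    have le_x: "(z, x) \<in> r" if "z \<in> C" for z using C(1) that by (simp add: D_def)
    then have "y \<notin> C" using xy as by blast
    have le_y: "(z, y) \<in> r" if "z \<in> C" for z using tr[OF le_x[OF that] xy(1)] .
    have "(y, y) \<in> r" using xy(1) r by blast
    then have "insert y C \<in> D y"
      using C(1) le_y by (simp add: D_def Chains_def)
    then have "card (insert y C) \<le> ht y" by (rule ht_ge)
    moreover have "finite C" using C(1) fin by (auto simp: D_def)
    ultimately show ?thesis using \<open>y \<notin> C\<close> C(2) by simp
  qed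
  \<comment> \<open>A maximal chain through the cover consists of a part \<open>?L\<close> up to
    \<open>x\<close> and a part \<open>?U\<close> from \<open>y\<close> on. Exchanging
    \<open>?L\<close> for a longest chain \<open>E\<close> ending in \<open>y\<close> gives a chain
    of at most \<open>k = |?L| + |?U|\<close> elements that shares only \<open>y\<close> with
    \<open>?U\<close>, so \<open>ht y + |?U| - 1 \<le> ht x + |?U|\<close>.\<close>
  have h2: "ht y = Suc (ht x)" if cov: "covers r y x" for x y
  proof -
    have xy: "(x, y) \<in> r" "x \<noteq> y" and between: "\<And>c. (x, c) \<in> r \<Longrightarrow> (c, y) \<in> r \<Longrightarrow> c = x \<or> c = y"
      using cov unfolding covers_def by blast+
    have xP: "x \<in> P" "y \<in> P" using xy r by auto
    obtain C where C: "C \<in> D x" "card C = ht x" using ht_attained xP by blast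
    obtain E where E: "E \<in> D y" "card E = ht y" using ht_attained xP by blast
    have "(z, y) \<in> r" if "z \<in> C" for z
    proof (rule tr[OF _ xy(1)])
      show "(z, x) \<in> r" using C(1) that by (simp add: D_def)
    qed
    then have "insert y C \<in> Chains r" using C(1) r(2)[OF xP(2)] by (simp add: D_def Chains_def)
    then obtain M where M: "M \<in> maximal_chains r" "insert y C \<subseteq> M" by (rule chain_extends_to_maximal)
    have MC: "M \<in> Chains r" using M(1) by (simp add: maximal_chains_def)
    have xyM: "x \<in> M" "y \<in> M" using M(2) C(1) by (auto simp: D_def)
    let ?L = "{z\<in>M. (z, x) \<in> r}" and ?U = "{z\<in>M. (y, z) \<in> r}"
    have "z \<in> ?L \<union> ?U" if z: "z \<in> M" for z
    proof -
      have "(z, x) \<in> r \<or> (x, z) \<in> r" "(z, y) \<in> r \<or> (y, z) \<in> r"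
        using MC z xyM by (auto simp: Chains_def)
      then show ?thesis using z between[of z] r xP by auto
    qed
    then have M_eq: "M = ?L \<union> ?U" by blast
    have "?L \<inter> ?U = {}" using xy tr as by blast
    moreover have finM: "finite M" "card M = k" using k[OF M(1)] by auto
    ultimately have card: "k = card ?L + card ?U"
      using M_eq card_Un_disjoint[of ?L ?U] by (metis (no_types, lifting) finite_Un)
    have "?L \<in> D x" using MC xyM r xP by (auto simp: D_def Chains_def)
    then have L: "card ?L \<le> ht x" by (rule ht_ge)
    have "E \<union> ?U \<in> Chains r"
    proof -
      have *: "(a, b) \<in> r" if "a \<in> E" "b \<in> ?U" for a b
        using tr[of a y b] E(1) that by (simp add: D_def)
      have "\<forall>a\<in>E. \<forall>b\<in>E. (a, b) \<in> r \<or> (b, a) \<in> r" "\<forall>a\<in>M. \<forall>b\<in>M. (a, b) \<in> r \<or> (b, a) \<in> r"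
        using E(1) MC by (simp_all add: D_def Chains_def)
      then show ?thesis using * unfolding Chains_def by blast
    qed
    then have "card (E \<union> ?U) \<le> k" using fin by blast
    moreover have "E \<inter> ?U = {y}" using E(1) xyM r xP as by (auto simp: D_def)
    moreover have "finite E" using E(1) fin by (auto simp: D_def)
    ultimately have "card E + card ?U \<le> Suc k"
      using card_Un_Int[of E ?U] finM by simp
    then have "ht y \<le> Suc (ht x)" using card L E(2) by linarith
    then show ?thesis using h1[OF xy] by linarith
  qed
  have h5: "1 \<le> ht x \<and> ht x \<le> k" if x: "x \<in> P" for x
  proof -
    obtain C where C: "C \<in> D x" "card C = ht x" using ht_attained x by blast
    then show ?thesis using ht_ge[OF sing[OF x]] fin[of C] by (simp add: D_def)
  qed
  have h3: "ht x = 1" if x: "x \<in> P" "\<forall>y. (y, x) \<in> r \<longrightarrow> y = x" for x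
  proof -
    obtain C where C: "C \<in> D x" "card C = ht x" using ht_attained x by blast
    have "C = {x}" using C(1) x by (auto simp: D_def)
    then show ?thesis using C(2) by simp
  qed
  \<comment> \<open>A maximal chain through a maximal element ends there, so it competes in the
    definition of \<open>ht x\<close>.\<close>
  have h4: "ht x = k" if x: "x \<in> P" "\<forall>y. (x, y) \<in> r \<longrightarrow> y = x" for x
  proof -
    have "{x} \<in> Chains r" using r x by (auto simp: Chains_def)
    then obtain M where M: "M \<in> maximal_chains r" "{x} \<subseteq> M" by (rule chain_extends_to_maximal)
    then have MC: "M \<in> Chains r" by (simp add: maximal_chains_def)
    have "(y, x) \<in> r" if "y \<in> M" for y
    proof -
      have "(y, x) \<in> r \<or> (x, y) \<in> r" using MC that M(2) by (auto simp: Chains_def)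
      then show ?thesis using x by auto
    qed
    then have "M \<in> D x" using MC M(2) by (auto simp: D_def)
    then show ?thesis using ht_ge[of M x] k[OF M(1)] h5[OF x(1)] by simp
  qed
  have h6: "k = 0" if "P = {}"
  proof -
    have "{} \<in> Chains r" by (simp add: Chains_def)
    then obtain M where "M \<in> maximal_chains r" by (rule chain_extends_to_maximal)
    moreover from this have "M \<subseteq> P" using r(1) by (auto simp: maximal_chains_def Chains_def)
    ultimately show ?thesis using k that by force
  qed
  have "height_function P r ht k"
    unfolding height_function_def using h1 h2 h3 h4 h5 h6 by auto
  then show ?thesis by blast
qed

section \<open>Reduced homology of ranked posets inside magnitude homology\<close>

lemma augmented_simplices_eq:
  "augmented_simplices P r p = (if p < -1 then {} else simplicial_chains P (\<lambda>x y. (x, y) \<in> r \<and> x \<noteq> y) (nat (p + 1)))"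
  by (auto simp: augmented_simplices_def order_complex_def simplicial_chains_def)

text \<open>A simplex of dimension \<open>n - 2\<close> has \<open>m = n - 1\<close> vertices, and
  with both ends it becomes a path of degree \<open>n\<close>.\<close>

lemma reduced_homology_embeds:
  assumes P: "ranked_poset P r" and n: "n \<ge> 1"
  shows "\<exists>h. h \<in> mon (reduced_order_homology P r (int n - 2))
      (magnitude_homology (hat_carrier P) (hat_dist P r) n (hat_dist P r Hat0 Hat1))"
proof -
  obtain m where m: "n = Suc m" using n by (cases n) auto
  have po: "partial_order_on P r" using P by (simp add: ranked_poset_def)
  obtain ht k where ht: "height_function P r ht k" using ranked_poset_height_function[OF P] by blast
  interpret G: graded_poset "hat_carrier P" "hat_order P r" "hat_rank ht k" Hat0
    by (rule hat_graded[OF po ht])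
  let ?lt = "\<lambda>x y. (x, y) \<in> r \<and> x \<noteq> y" and ?X = "hat_carrier P" and ?d = "hat_dist P r"
  let ?\<rho> = "\<lambda>x. real (hat_rank ht k (inv_into ?X id x))"
  interpret hat_embedding ?X ?d P ?lt "id \<circ> Elem" "id Hat0" "id Hat1" ?\<rho>
    by (rule hat_embedding_inj[OF po ht]) (use G.Metric in \<open>simp_all add: hat_dist_def\<close>)
  have l: "?d Hat0 Hat1 = ?\<rho> (id Hat1) - ?\<rho> (id Hat0)" using e0_e1 by simp
  have aug: "augmented_simplices P r (int n - 2) = simplicial_chains P ?lt m"
    "augmented_simplices P r (int n - 2 + 1) = simplicial_chains P ?lt (Suc m)"
    by (auto simp: augmented_simplices_eq m nat_add_distrib)
  show ?thesis
    unfolding reduced_order_homology_def magnitude_homology_def chain_homology_eq aug l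
  proof (rule frag_quotient_mon[where R = "\<lambda>c c'. c' = frag_extend (frag_of \<circ> wrap) c"])
    show "\<exists>c'\<in>chain_cycles (proper_chains ?X ?d n (?\<rho> (id Hat1) - ?\<rho> (id Hat0))) (magnitude_boundary ?d).
        c' = frag_extend (frag_of \<circ> wrap) c"
      if "c \<in> chain_cycles (simplicial_chains P ?lt m) simplicial_boundary" for c
      using wrap_cycles(1)[OF that] m by blast
    show "c \<in> chain_boundaries (simplicial_chains P ?lt (Suc m)) simplicial_boundary \<longleftrightarrow>
        c' \<in> chain_boundaries (proper_chains ?X ?d (n + 1) (?\<rho> (id Hat1) - ?\<rho> (id Hat0))) (magnitude_boundary ?d)"
      if "c \<in> chain_cycles (simplicial_chains P ?lt m) simplicial_boundary" "c' = frag_extend (frag_of \<circ> wrap) c" for c c'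
      using wrap_cycles(2)[OF that(1)] that(2) m by simp
  qed (use magnitude_boundaries_subset in \<open>auto simp: frag_subgroup_cycles frag_subgroup_boundaries
      simplicial_boundaries_subset frag_extend_diff\<close>)
qed

section \<open>Posets with prescribed homology classes\<close>

text \<open>\<open>C\<close> is the basis of the cycles in the first conclusion and that of the
  filling chains in the second, so the two are applied in neighbouring degrees.\<close>

lemma frag_extend_chain_map:
  assumes keys: "\<And>xs. xs \<in> C \<Longrightarrow> Poly_Mapping.keys (F xs) \<subseteq> C'"
    and comm: "\<And>xs. xs \<in> C \<Longrightarrow> frag_extend bd' (F xs) = frag_extend F (bd xs)"
  shows "c \<in> chain_cycles C bd \<Longrightarrow> frag_extend F c \<in> chain_cycles C' bd'"
    and "c \<in> chain_boundaries C bd \<Longrightarrow> frag_extend F c \<in> chain_boundaries C' bd'"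
proof -
  have 1: "Poly_Mapping.keys (frag_extend F b) \<subseteq> C'" if "Poly_Mapping.keys b \<subseteq> C" for b
    using keys_frag_extend[of F b] keys that by blast
  have 2: "frag_extend bd' (frag_extend F b) = frag_extend F (frag_extend bd b)" if "Poly_Mapping.keys b \<subseteq> C" for b
    unfolding frag_extend_extend by (rule frag_extend_eq) (use comm that in auto)
  show "c \<in> chain_cycles C bd \<Longrightarrow> frag_extend F c \<in> chain_cycles C' bd'"
    using 1[of c] 2[of c] by (simp add: chain_cycles_def)
  show "c \<in> chain_boundaries C bd \<Longrightarrow> frag_extend F c \<in> chain_boundaries C' bd'"
    using 1 2 unfolding chain_boundaries_def by (smt (verit) image_iff mem_Collect_eq)
qed

section \<open>Classes of prescribed order and suspension\<close>

lemma delete_nth_map: "delete_nth i (map h xs) = map h (delete_nth i xs)"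
  by (simp add: delete_nth_def take_map drop_map)

lemma simplicial_boundary_map:
  "simplicial_boundary (map h xs) = frag_extend (frag_of \<circ> map h) (simplicial_boundary xs)"
  by (simp add: simplicial_boundary_def frag_extend_sum frag_extend_cmul delete_nth_map)

lemma simplicial_boundary_snoc:
  "simplicial_boundary (xs @ [t]) =
     frag_extend (\<lambda>zs. frag_of (zs @ [t])) (simplicial_boundary xs) + frag_cmul ((- 1) ^ length xs) (frag_of xs)"
proof -
  have "simplicial_boundary (xs @ [t]) =
      (\<Sum>i<length xs. frag_cmul ((- 1) ^ i) (frag_of (delete_nth i (xs @ [t]))))
      + frag_cmul ((- 1) ^ length xs) (frag_of (delete_nth (length xs) (xs @ [t])))"
    by (simp add: simplicial_boundary_def)
  also have "(\<Sum>i<length xs. frag_cmul ((- 1) ^ i) (frag_of (delete_nth i (xs @ [t]))))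
      = frag_extend (\<lambda>zs. frag_of (zs @ [t])) (simplicial_boundary xs)"
    unfolding simplicial_boundary_def frag_extend_sum[OF finite_lessThan] o_def frag_extend_cmul frag_extend_of
    by (intro sum.cong) (auto simp: delete_nth_def)
  finally show ?thesis by (simp add: delete_nth_def)
qed

abbreviation simplicial_cycles where
  "simplicial_cycles P lt s \<equiv> chain_cycles (simplicial_chains P lt s) simplicial_boundary"

abbreviation simplicial_boundaries where
  "simplicial_boundaries P lt s \<equiv> chain_boundaries (simplicial_chains P lt (Suc s)) simplicial_boundary"

text \<open>\<open>s\<close> counts vertices, so the class has degree \<open>s - 1\<close>. Its
  order is exactly \<open>q\<close>, with \<open>0\<close> for infinite order and \<open>1\<close>
  for a class that vanishes.\<close>

definition cyclic_class :: "'a set \<Rightarrow> ('a \<Rightarrow> 'a \<Rightarrow> bool) \<Rightarrow> nat \<Rightarrow> nat \<Rightarrow> ('a list \<Rightarrow>\<^sub>0 int) \<Rightarrow> bool" where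
  "cyclic_class P lt s q z \<longleftrightarrow> z \<in> simplicial_cycles P lt s \<and>
     (\<forall>j. frag_cmul j z \<in> simplicial_boundaries P lt s \<longleftrightarrow> int q dvd j)"

lemma simplicial_boundary_keysD:
  assumes "zs \<in> Poly_Mapping.keys (simplicial_boundary xs)"
  obtains i where "i < length xs" "zs = delete_nth i xs"
  using assms keys_deletion_boundary[of "\<lambda>_ _. True" xs] unfolding simplicial_boundary_eq by blast

text \<open>Two incomparable elements above all others suspend the order complex. The suspension map
  \<open>S\<close> has a left inverse \<open>T\<close>, which keeps the chains ending in
  \<open>t0\<close> and strips that vertex; both commute with the boundary, so \<open>S\<close>
  preserves the order of a class.\<close>

lemma cyclic_class_suspension:
  assumes z: "cyclic_class P lt s q z" and t: "t0 \<noteq> t1" "t0 \<notin> P" "t1 \<notin> P"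
    and below: "\<And>x. x \<in> P \<Longrightarrow> lt x t0 \<and> lt x t1 \<and> \<not> lt t0 x \<and> \<not> lt t1 x"
    and irrefl: "\<not> lt t0 t1" "\<not> lt t1 t0" "\<not> lt t0 t0" "\<not> lt t1 t1"
  shows "\<exists>z'. cyclic_class (P \<union> {t0, t1}) lt (Suc s) q z'"
proof -
  let ?P = "P \<union> {t0, t1}"
  \<comment> \<open>The new vertices come last, so neither map picks up a sign, and the two copies
    of \<open>xs\<close> in the boundary of \<open>S xs\<close> cancel.\<close>
  define S where "S xs = frag_of (xs @ [t0]) - frag_of (xs @ [t1])" for xs :: "'a list"
  define T where "T ys = (if ys \<noteq> [] \<and> last ys = t0 then frag_of (butlast ys) else 0)" for ys :: "'a list"
  have S_keys: "Poly_Mapping.keys (S xs) \<subseteq> simplicial_chains ?P lt (Suc k)" if "xs \<in> simplicial_chains P lt k" for xs k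
  proof -
    have "xs @ [t0] \<in> simplicial_chains ?P lt (Suc k)" "xs @ [t1] \<in> simplicial_chains ?P lt (Suc k)"
      using that below by (auto simp: simplicial_chains_def sorted_wrt_append)
    then show ?thesis unfolding S_def using keys_diff[of "frag_of (xs @ [t0])" "frag_of (xs @ [t1])"] by auto
  qed
  have S_comm: "frag_extend simplicial_boundary (S xs) = frag_extend S (simplicial_boundary xs)" for xs
  proof -
    have "frag_extend S c = frag_extend (\<lambda>zs. frag_of (zs @ [t0])) c - frag_extend (\<lambda>zs. frag_of (zs @ [t1])) c" for c
      by (rule frag_induction[OF subset_UNIV, of _ c]) (simp_all add: frag_extend_diff S_def)
    then show ?thesis by (simp add: S_def frag_extend_diff simplicial_boundary_snoc)
  qed
  \<comment> \<open>The new elements are maximal and incomparable, so a chain contains at most one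
    of them, as its last entry.\<close>
  have chain_cases: "ys \<in> simplicial_chains P lt k \<or>
      (\<exists>xs t. ys = xs @ [t] \<and> (t = t0 \<or> t = t1) \<and> k > 0 \<and> xs \<in> simplicial_chains P lt (k - 1))"
    if ys: "ys \<in> simplicial_chains ?P lt k" for ys k
  proof (cases "set ys \<subseteq> P")
    case True
    then show ?thesis using ys by (simp add: simplicial_chains_def)
  next
    case False
    then obtain t where "t \<in> set ys" "t \<notin> P" by auto
    then obtain xs vs where split: "ys = xs @ t # vs" by (meson split_list)
    have tt: "t = t0 \<or> t = t1" using ys \<open>t \<in> set ys\<close> \<open>t \<notin> P\<close> by (auto simp: simplicial_chains_def)
    have sorted: "sorted_wrt lt (xs @ t # vs)" "set (xs @ t # vs) \<subseteq> ?P" using ys split by (auto simp: simplicial_chains_def)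
    have "vs = []"
    proof (cases vs)
      case (Cons v us)
      then have "lt t v" "v \<in> ?P" using sorted by (auto simp: sorted_wrt_append)
      then show ?thesis using tt below irrefl by auto
    qed
    moreover have "set xs \<subseteq> P"
    proof
      fix x assume "x \<in> set xs"
      then have "lt x t" "x \<in> ?P" using sorted by (auto simp: sorted_wrt_append)
      then show "x \<in> P" using tt irrefl by auto
    qed
    ultimately show ?thesis using split tt ys by (auto simp: simplicial_chains_def sorted_wrt_append)
  qed
  have T_P: "T xs = 0" if "set xs \<subseteq> P" for xs
  proof (cases "xs = []")
    case False
    then have "last xs \<in> P" using that last_in_set by blast
    then show ?thesis using t by (auto simp: T_def)
  qed (simp add: T_def)
  have T_keys: "Poly_Mapping.keys (T ys) \<subseteq> simplicial_chains P lt k" if "ys \<in> simplicial_chains ?P lt (Suc k)" for ys k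
    using chain_cases[OF that]
  proof
    assume "ys \<in> simplicial_chains P lt (Suc k)"
    then show ?thesis by (simp add: T_P simplicial_chains_def)
  next
    assume "\<exists>xs t. ys = xs @ [t] \<and> (t = t0 \<or> t = t1) \<and> Suc k > 0 \<and> xs \<in> simplicial_chains P lt (Suc k - 1)"
    then show ?thesis by (auto simp: T_def)
  qed
  have T_snoc: "frag_extend T (frag_extend (\<lambda>zs. frag_of (zs @ [t])) c) = (if t = t0 then c else 0)" for t c
  proof -
    have "frag_extend T (frag_extend (\<lambda>zs. frag_of (zs @ [t])) c) = frag_extend (\<lambda>zs. if t = t0 then frag_of zs else 0) c"
      unfolding frag_extend_extend by (rule frag_extend_eq) (simp add: T_def)
    also have "\<dots> = (if t = t0 then c else 0)" by (simp flip: frag_expansion) (simp add: frag_extend_def)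
    finally show ?thesis .
  qed
  have T_comm: "frag_extend simplicial_boundary (T ys) = frag_extend T (simplicial_boundary ys)"
    if "ys \<in> simplicial_chains ?P lt k" for ys k
    using chain_cases[OF that]
  proof
    assume ys: "ys \<in> simplicial_chains P lt k"
    have "frag_extend T (simplicial_boundary ys) = 0"
    proof (rule frag_extend_eq_0)
      fix zs assume "zs \<in> Poly_Mapping.keys (simplicial_boundary ys)"
      then obtain i where "zs = delete_nth i ys" by (rule simplicial_boundary_keysD)
      then have "set zs \<subseteq> P" using set_delete_nth[of i ys] ys by (auto simp: simplicial_chains_def)
      then show "T zs = 0" by (rule T_P)
    qed
    then show ?thesis using ys by (simp add: T_P simplicial_chains_def)
  next
    assume "\<exists>xs t. ys = xs @ [t] \<and> (t = t0 \<or> t = t1) \<and> k > 0 \<and> xs \<in> simplicial_chains P lt (k - 1)"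
    then obtain xs t where xs: "ys = xs @ [t]" "xs \<in> simplicial_chains P lt (k - 1)" by blast
    then have "T xs = 0" by (intro T_P) (simp add: simplicial_chains_def)
    then have "frag_extend T (simplicial_boundary ys) = (if t = t0 then simplicial_boundary xs else 0)"
      by (simp add: xs(1) simplicial_boundary_snoc frag_extend_add T_snoc frag_extend_cmul)
    also have "\<dots> = frag_extend simplicial_boundary (T ys)" by (simp add: xs(1) T_def)
    finally show ?thesis by simp
  qed
  have TS: "frag_extend T (frag_extend S c) = c" for c
  proof -
    have "frag_extend T (frag_extend S c) = frag_extend frag_of c"
      unfolding frag_extend_extend by (rule frag_extend_eq) (use t in \<open>simp add: S_def T_def frag_extend_diff\<close>)
    then show ?thesis by (simp flip: frag_expansion)
  qed
  have "cyclic_class ?P lt (Suc s) q (frag_extend S z)"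
    unfolding cyclic_class_def
  proof (intro conjI allI iffI)
    show "frag_extend S z \<in> simplicial_cycles ?P lt (Suc s)"
      by (rule frag_extend_chain_map(1)[OF S_keys S_comm]) (use z in \<open>auto simp: cyclic_class_def\<close>)
    fix j
    have S_cmul: "frag_cmul j (frag_extend S z) = frag_extend S (frag_cmul j z)" by (simp add: frag_extend_cmul)
    show "frag_cmul j (frag_extend S z) \<in> simplicial_boundaries ?P lt (Suc s)" if "int q dvd j"
      unfolding S_cmul
      by (rule frag_extend_chain_map(2)[OF S_keys S_comm]) (use z that in \<open>auto simp: cyclic_class_def\<close>)
    assume B: "frag_cmul j (frag_extend S z) \<in> simplicial_boundaries ?P lt (Suc s)"
    have "frag_extend T (frag_extend S (frag_cmul j z)) \<in> simplicial_boundaries P lt s"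
    proof (rule frag_extend_chain_map(2)[where C = "simplicial_chains ?P lt (Suc (Suc s))"])
      show "frag_extend S (frag_cmul j z) \<in> simplicial_boundaries ?P lt (Suc s)" using B by (simp only: S_cmul)
    qed (fact T_keys T_comm)+
    then show "int q dvd j" using z by (simp add: TS cyclic_class_def)
  qed
  then show ?thesis ..
qed

text \<open>
  The order complex of the elements of types \<open>U\<close>, \<open>V\<close>, \<open>Y\<close>, \<open>W\<close>, \<open>Top\<close> is a Moore space: the
  circle formed by the \<open>U i\<close> and \<open>V i\<close> with \<open>i < 2 * q\<close> is coned off by \<open>Top\<close> and is joined, by the
  mapping cylinder of a map of degree \<open>q\<close>, to the circle formed by \<open>Y 0\<close>, \<open>W 0\<close>, \<open>Y 1\<close>, \<open>W 1\<close>.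
  The \<open>Susp k b\<close> are the points of iterated suspensions.
\<close>
datatype node = U nat | V nat | Y nat | W nat | Top | Susp nat bool

text \<open>The map sending \<open>U i\<close> to \<open>Y (i mod 2)\<close> and \<open>V j\<close>
  to \<open>W (j mod 2)\<close> wraps a circle of \<open>4 * q\<close> vertices \<open>q\<close>
  times around one of four; an even number of indices makes the parities alternate all the way
  round. In the mapping cylinder each element lies below its image and below whatever is above that
  image.\<close>

fun node_less :: "nat \<Rightarrow> node \<Rightarrow> node \<Rightarrow> bool" where
  "node_less q (Susp k a) (Susp l b) = (k < l)"
| "node_less q (Susp k a) _ = False"
| "node_less q _ (Susp l b) = True"
| "node_less q (U i) (V j) = (i = j \<or> i = Suc j mod (2 * q))"
| "node_less q (U i) (Y a) = (a = i mod 2)"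
| "node_less q (U i) (W b) = True"
| "node_less q (U i) Top = True"
| "node_less q (V j) (W b) = (b = j mod 2)"
| "node_less q (V j) Top = True"
| "node_less q (Y a) (W b) = True"
| "node_less q _ _ = False"

fun node_rank :: "node \<Rightarrow> nat" where
  "node_rank (U i) = 1"
| "node_rank (V i) = 2"
| "node_rank (Y i) = 2"
| "node_rank (W i) = 3"
| "node_rank Top = 3"
| "node_rank (Susp k b) = 4 + k"

definition moore_nodes :: "nat \<Rightarrow> node set" where
  "moore_nodes q = U ` {..<2 * q} \<union> V ` {..<2 * q} \<union> {Y 0, Y 1, W 0, W 1, Top}"

text \<open>\<open>q = 0\<close> starts from the empty poset, whose iterated suspensions are
  spheres; otherwise the Moore space is suspended \<open>n\<close> times.\<close>

definition nodes :: "nat \<Rightarrow> nat \<Rightarrow> node set" where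
  "nodes q n = (if q = 0 then {} else moore_nodes q) \<union> {Susp k b |k b. k < n}"

lemma nodes_iff [simp]:
  "U i \<in> nodes q n \<longleftrightarrow> i < 2 * q" "V i \<in> nodes q n \<longleftrightarrow> i < 2 * q"
  "Y a \<in> nodes q n \<longleftrightarrow> q > 0 \<and> a < 2" "W a \<in> nodes q n \<longleftrightarrow> q > 0 \<and> a < 2"
  "Top \<in> nodes q n \<longleftrightarrow> q > 0" "Susp k b \<in> nodes q n \<longleftrightarrow> k < n"
  by (auto simp: nodes_def moore_nodes_def)

lemma node_less_rank: "node_less q x y \<Longrightarrow> node_rank x < node_rank y"
  by (induction q x y rule: node_less.induct) auto

lemma node_less_trans: "node_less q x y \<Longrightarrow> node_less q y z \<Longrightarrow> node_less q x z"
  by (cases x; cases y; cases z) auto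

lemma finite_nodes: "finite (nodes q n)"
proof -
  have "{Susp k b |k b. k < n} = (\<lambda>(k, b). Susp k b) ` ({..<n} \<times> UNIV)" by auto
  then have "finite {Susp k b |k b. k < n}" by simp
  then show ?thesis by (simp add: nodes_def moore_nodes_def)
qed

lemma nodes_Suc: "nodes q (Suc n) = nodes q n \<union> {Susp n False, Susp n True}"
  by (auto simp: nodes_def less_Suc_eq)

lemma cyclic_class_nodes_add:
  "cyclic_class (nodes q n) (node_less q) s q' z \<Longrightarrow> \<exists>z'. cyclic_class (nodes q (n + k)) (node_less q) (s + k) q' z'"
proof (induction k)
  case (Suc k)
  then obtain z' where z': "cyclic_class (nodes q (n + k)) (node_less q) (s + k) q' z'" by blast
  have "node_less q x (Susp (n + k) b)" "\<not> node_less q (Susp (n + k) b) x" if "x \<in> nodes q (n + k)" for x b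
    using that by (cases x; simp)+
  then have "\<exists>z'. cyclic_class (nodes q (n + k) \<union> {Susp (n + k) False, Susp (n + k) True}) (node_less q) (Suc (s + k)) q' z'"
    by (intro cyclic_class_suspension[OF z']) simp_all
  then show ?case by (simp add: nodes_Suc)
qed auto

text \<open>The reduced homology of the empty poset is generated by the empty list in degree
  \<open>-1\<close>, and \<open>s\<close> suspensions move this class to degree
  \<open>s - 1\<close>.\<close>

lemma cyclic_class_free: "\<exists>z. cyclic_class (nodes 0 s) (node_less 0) s 0 z"
proof -
  have "nodes 0 0 = {}" by (simp add: nodes_def)
  then have chains: "simplicial_chains (nodes 0 0) (node_less 0) 0 = {[]}"
    "simplicial_chains (nodes 0 0) (node_less 0) (Suc 0) = {}"
    by (auto simp: simplicial_chains_def)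
  have "cyclic_class (nodes 0 0) (node_less 0) 0 0 (frag_of [])"
    unfolding cyclic_class_def chains
    by (auto simp: chain_cycles_def chain_boundaries_def simplicial_boundary_def)
  from cyclic_class_nodes_add[OF this, of s] show ?thesis by simp
qed

section \<open>The Moore poset and its class of order \<open>q\<close>\<close>

lemma simplicial_boundary_3:
  "simplicial_boundary [a, b, c] = frag_of [b, c] - frag_of [a, c] + frag_of [a, b]"
  by (simp add: simplicial_boundary_def delete_nth_def numeral_3_eq_3)

lemma simplicial_boundary_2: "simplicial_boundary [a, b] = frag_of [b] - frag_of [a]"
  by (simp add: simplicial_boundary_def delete_nth_def numeral_2_eq_2)

lemma sum_mod_2: "(\<Sum>i<2 * q. h (i mod 2)) = frag_cmul (int q) (h 0 + h (1::nat))"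
proof (induction q)
  case (Suc q)
  have "Suc (2 * q) mod 2 = Suc 0" by presburger
  then show ?case using Suc by (simp add: frag_cmul_distrib algebra_simps)
qed simp

lemma bij_betw_Suc_mod: "m > 0 \<Longrightarrow> bij_betw (\<lambda>i. Suc i mod m) {..<m} {..<m}"
proof -
  assume m: "m > 0"
  have "inj_on (\<lambda>i. Suc i mod m) {..<m}"
  proof (rule inj_onI)
    fix i j assume ij: "i \<in> {..<m}" "j \<in> {..<m}" "Suc i mod m = Suc j mod m"
    then show "i = j" by (cases "Suc i = m"; cases "Suc j = m") auto
  qed
  moreover have "(\<lambda>i. Suc i mod m) ` {..<m} \<subseteq> {..<m}" using m by auto
  ultimately show ?thesis by (simp add: bij_betw_def endo_inj_surj)
qed

text \<open>A cocycle modulo \<open>q\<close> with value \<open>1\<close> on the generating cycle.\<close>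
fun moore_cocycle :: "node list \<Rightarrow> int" where
  "moore_cocycle [U i, Top] = - int (i div 2)"
| "moore_cocycle [V i, Top] = - int (i div 2)"
| "moore_cocycle [U i, V j] = (if i \<noteq> j \<and> odd j then - 1 else 0)"
| "moore_cocycle [U i, W b] = (if b = 1 \<and> even i then - 1 else 0)"
| "moore_cocycle [Y a, W b] = (if a = 0 \<and> b = 1 then - 1 else 0)"
| "moore_cocycle _ = 0"

lemma moore_triangles:
  assumes "xs \<in> simplicial_chains (nodes q 0) (node_less q) 3"
  obtains i j where "xs = [U i, V j, Top]" "i < 2 * q" "j < 2 * q" "i = j \<or> i = Suc j mod (2 * q)"
  | i j where "xs = [U i, V j, W (j mod 2)]" "i < 2 * q" "j < 2 * q" "i = j \<or> i = Suc j mod (2 * q)"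
  | i b where "xs = [U i, Y (i mod 2), W b]" "i < 2 * q" "b < 2"
proof -
  obtain x y z where xyz: "xs = [x, y, z]" using assms
    by (auto simp: simplicial_chains_def numeral_3_eq_3 length_Suc_conv)
  have lt: "node_less q x y" "node_less q y z" and mem: "x \<in> nodes q 0" "y \<in> nodes q 0" "z \<in> nodes q 0"
    using assms by (auto simp: simplicial_chains_def xyz)
  show ?thesis
  proof (cases y)
    case (U i)
    then show ?thesis using lt(1) by (cases x) simp_all
  next
    case (V j)
    then obtain i where i: "x = U i" "i = j \<or> i = Suc j mod (2 * q)" using lt(1) by (cases x) simp_all
    have ij: "i < 2 * q" "j < 2 * q" using mem(1,2) i(1) V by simp_all
    have "z = Top \<or> z = W (j mod 2)" using lt(2) mem(3) V by (cases z) simp_all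
    then show ?thesis
    proof
      assume "z = Top"
      then show ?thesis using that(1)[of i j] xyz V i ij by simp
    next
      assume "z = W (j mod 2)"
      then show ?thesis using that(2)[of i j] xyz V i ij by simp
    qed
  next
    case (Y a)
    then obtain i where i: "x = U i" "a = i mod 2" using lt(1) by (cases x) simp_all
    obtain b where b: "z = W b" using lt(2) mem(3) Y by (cases z) simp_all
    have "i < 2 * q" "b < 2" using mem i b by simp_all
    then show ?thesis using that(3)[of i b] xyz Y i b by simp
  next
    case (W b)
    then show ?thesis using lt(2) mem(3) by (cases z) simp_all
  next
    case Top
    then show ?thesis using lt(2) mem(3) by (cases z) simp_all
  next
    case (Susp k b)
    then show ?thesis using mem(2) by simp
  qed
qed

text \<open>The values lie in the free group on \<open>()\<close>, a copy of the integers. They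
  vanish except on the triangle that joins \<open>Top\<close> to the edge closing the large
  circle.\<close>

lemma moore_cocycle_boundary:
  assumes xs: "xs \<in> simplicial_chains (nodes q 0) (node_less q) 3"
  shows "\<exists>k. frag_extend (\<lambda>ys. frag_cmul (moore_cocycle ys) (frag_of ())) (simplicial_boundary xs)
      = frag_cmul (int q * k) (frag_of ())"
proof -
  have bd: "frag_extend (\<lambda>ys. frag_cmul (moore_cocycle ys) (frag_of ())) (simplicial_boundary [a, b, c])
      = frag_cmul (moore_cocycle [b, c] - moore_cocycle [a, c] + moore_cocycle [a, b]) (frag_of ())" for a b c
    by (simp add: simplicial_boundary_3 frag_extend_add frag_extend_diff frag_cmul_distrib frag_cmul_diff_distrib)
  have "\<exists>a b c k. xs = [a, b, c] \<and> moore_cocycle [b, c] - moore_cocycle [a, c] + moore_cocycle [a, b] = int q * k"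
    using xs
  proof (cases rule: moore_triangles)
    case (1 i j)
    \<comment> \<open>Along the circle the values on edges to \<open>Top\<close> drop by one after
      each odd \<open>V j\<close>, which the edge value \<open>- 1\<close> compensates; at the
      closing edge, where \<open>j = 2 * q - 1\<close> and \<open>i = 0\<close>, the accumulated
      drop leaves \<open>- q\<close>.\<close>
    have step: "int (i div 2) - int (j div 2) + (if i \<noteq> j \<and> odd j then - 1 else 0) = int q * (if i = 0 \<and> j \<noteq> 0 then - 1 else 0)"
      if i: "i = Suc j mod (2 * q)" "i \<noteq> j"
    proof (cases "Suc j = 2 * q")
      case True
      then have "i = 0" "odd j" using i by (auto, presburger)
      moreover from this have "j div 2 = q - 1" "j \<noteq> 0" using True by presburger+
      moreover have "q > 0" using True by (cases q) auto
      ultimately show ?thesis by (simp add: of_nat_diff)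
    next
      case False
      then have "i = Suc j" using i 1 by simp
      then show ?thesis by (cases "even j") (auto elim!: evenE oddE)
    qed
    have "\<exists>k. moore_cocycle [V j, Top] - moore_cocycle [U i, Top] + moore_cocycle [U i, V j] = int q * k"
    proof (cases "i = j")
      case True
      then show ?thesis by (intro exI[of _ 0]) simp
    next
      case False
      then show ?thesis using step 1 by (intro exI[of _ "if i = 0 \<and> j \<noteq> 0 then - 1 else 0"]) simp
    qed
    then show ?thesis using 1 by blast
  next
    case (2 i j)
    have par: "even (Suc j mod (2 * q)) \<longleftrightarrow> odd j"
    proof -
      have "even (Suc j mod (2 * q)) \<longleftrightarrow> even (Suc j)"
        by (simp only: even_iff_mod_2_eq_zero mod_mod_cancel dvd_triv_left)
      then show ?thesis by simp
    qed
    have "moore_cocycle [V j, W (j mod 2)] - moore_cocycle [U i, W (j mod 2)] + moore_cocycle [U i, V j] = int q * 0"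
      using 2 par by (auto simp: mod2_eq_if)
    then show ?thesis using 2 by blast
  next
    case (3 i b)
    have "moore_cocycle [Y (i mod 2), W b] - moore_cocycle [U i, W b] + moore_cocycle [U i, Y (i mod 2)] = int q * 0"
      using 3 by (auto simp: mod2_eq_if)
    then show ?thesis using 3 by blast
  qed
  then show ?thesis using bd by metis
qed

text \<open>The cycle \<open>z\<close> runs once around the small circle. Its \<open>q\<close>-fold
  multiple is filled by the disk under \<open>Top\<close> together with the cylinder; conversely the
  cocycle has value 1 on \<open>z\<close> and multiples of \<open>q\<close> on boundaries.\<close>

lemma cyclic_class_moore:
  assumes q: "q > 0"
  shows "\<exists>z. cyclic_class (nodes q 0) (node_less q) 2 q z"
proof -
  let ?P = "nodes q 0" and ?lt = "node_less q" and ?bd = "frag_extend simplicial_boundary"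
  define z where "z = frag_of [Y 0, W 0] - frag_of [Y 1, W 0] + frag_of [Y 1, W 1] - frag_of [Y 0, W 1]"
  define nx where "nx i = Suc i mod (2 * q)" for i
  have nx_lt: "nx i < 2 * q" for i using q by (simp add: nx_def)
  have nx_par: "nx i mod 2 = Suc i mod 2" for i by (simp add: nx_def mod_mod_cancel)
  have P: "U i \<in> ?P" "V i \<in> ?P" if "i < 2 * q" for i using that by simp_all
  have P': "Y (i mod 2) \<in> ?P" "W (i mod 2) \<in> ?P" "Top \<in> ?P" for i
    using q by simp_all
  have C3: "simplicial_chains ?P ?lt 3 = simplicial_chains ?P ?lt (Suc 2)" by (simp add: numeral_3_eq_3 numeral_2_eq_2)
  have YW: "[Y a, W b] \<in> simplicial_chains ?P ?lt 2" if "a \<le> 1" "b \<le> 1" for a b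
    using that P'(1)[of a] P'(2)[of b] by (auto simp: simplicial_chains_def mod2_eq_if le_Suc_eq)
  have z_cycle: "z \<in> simplicial_cycles ?P ?lt 2"
  proof -
    have "frag_subgroup {c. Poly_Mapping.keys c \<subseteq> simplicial_chains ?P ?lt 2}"
      unfolding frag_subgroup_def using keys_diff by fastforce
    then have "z \<in> {c. Poly_Mapping.keys c \<subseteq> simplicial_chains ?P ?lt 2}"
      unfolding z_def by (intro frag_subgroup_diff frag_subgroup_add) (auto simp: YW)
    moreover have "?bd z = 0"
      by (simp add: z_def frag_extend_diff frag_extend_add simplicial_boundary_2)
    ultimately show ?thesis by (simp add: chain_cycles_def)
  qed
  \<comment> \<open>One sector of the filling, between \<open>U i\<close> and its successor: two
    triangles of the disk, and four of the cylinder that carry the arc over to the small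
    circle.\<close>
  define h where "h i = frag_of [U i, V i, Top] - frag_of [U (nx i), V i, Top]
     - (frag_of [U i, V i, W (i mod 2)] - frag_of [U (nx i), V i, W (i mod 2)])
     + (frag_of [U i, Y (i mod 2), W (i mod 2)] - frag_of [U (nx i), Y (nx i mod 2), W (i mod 2)])" for i
  have h_keys: "Poly_Mapping.keys (h i) \<subseteq> simplicial_chains ?P ?lt 3" if i: "i < 2 * q" for i
  proof -
    have "frag_subgroup {c. Poly_Mapping.keys c \<subseteq> simplicial_chains ?P ?lt 3}"
      unfolding frag_subgroup_def using keys_diff by fastforce
    then have "h i \<in> {c. Poly_Mapping.keys c \<subseteq> simplicial_chains ?P ?lt 3}"
      unfolding h_def using P[OF i] P[OF nx_lt[of i]] P'
      by (intro frag_subgroup_diff frag_subgroup_add) (auto simp: simplicial_chains_def nx_def)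
    then show ?thesis by simp
  qed
  have bd_h: "?bd (h i) = (frag_of [U (nx i), Top] - frag_of [U i, Top])
      + (frag_of [U i, Y (i mod 2)] - frag_of [U (nx i), Y (nx i mod 2)])
      + (frag_of [Y (i mod 2), W (i mod 2)] - frag_of [Y (Suc i mod 2), W (i mod 2)])" for i
    by (simp add: h_def frag_extend_diff frag_extend_add simplicial_boundary_3 nx_par)
  \<comment> \<open>A sum over the whole circle is unchanged by the shift, so the terms that involve
    \<open>U\<close> will cancel.\<close>
  have cyc: "(\<Sum>i<2 * q. g (nx i)) = (\<Sum>i<2 * q. g i)" for g :: "nat \<Rightarrow> node list \<Rightarrow>\<^sub>0 int"
    unfolding nx_def using q by (intro sum.reindex_bij_betw bij_betw_Suc_mod) simp
  define b where "b = (\<Sum>i<2 * q. h i)"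
  have "?bd b = (\<Sum>i<2 * q. ?bd (h i))" by (simp add: b_def frag_extend_sum)
  also have "\<dots> = (\<Sum>i<2 * q. frag_of [Y (i mod 2), W (i mod 2)] - frag_of [Y (Suc i mod 2), W (i mod 2)])"
    unfolding bd_h using cyc[of "\<lambda>i. frag_of [U i, Top]"] cyc[of "\<lambda>i. frag_of [U i, Y (i mod 2)]"]
    by (simp add: sum.distrib sum_subtractf)
  also have "\<dots> = (\<Sum>i<2 * q. (\<lambda>a. frag_of [Y a, W a] - frag_of [Y (Suc a mod 2), W a]) (i mod 2))"
    by (intro sum.cong) (auto simp: mod_Suc_eq)
  \<comment> \<open>Each parity occurs \<open>q\<close> times among the \<open>2 * q\<close>
    sectors, and one sector of each parity contributes \<open>z\<close>.\<close>
  also have "\<dots> = frag_cmul (int q) z"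
    using sum_mod_2[of "\<lambda>a. frag_of [Y a, W a] - frag_of [Y (Suc a mod 2), W a]" q]
    by (simp add: z_def add_diff_eq)
  finally have bd_b: "?bd b = frag_cmul (int q) z" .
  have "Poly_Mapping.keys b \<subseteq> simplicial_chains ?P ?lt 3"
    unfolding b_def using keys_sum[of h "{..<2 * q}"] h_keys by blast
  then have qz: "frag_cmul (int q) z \<in> simplicial_boundaries ?P ?lt 2"
    unfolding C3[symmetric] chain_boundaries_def using bd_b by (intro image_eqI[of _ _ b]) auto
  let ?F = "\<lambda>ys. frag_cmul (moore_cocycle ys) (frag_of ())"
  have "frag_cmul j z \<in> simplicial_boundaries ?P ?lt 2 \<longleftrightarrow> int q dvd j" for j
  proof
    assume "int q dvd j"
    then obtain k where "j = k * int q" by (metis dvd_def mult.commute)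
    then have "frag_cmul j z = frag_cmul k (frag_cmul (int q) z)" by (simp add: frag_cmul_cmul)
    then show "frag_cmul j z \<in> simplicial_boundaries ?P ?lt 2"
      using frag_subgroup_cmul[OF frag_subgroup_boundaries qz] by simp
  next
    assume "frag_cmul j z \<in> simplicial_boundaries ?P ?lt 2"
    then obtain c where c: "Poly_Mapping.keys c \<subseteq> simplicial_chains ?P ?lt 3" "frag_cmul j z = ?bd c"
      unfolding C3[symmetric] chain_boundaries_def by blast
    let ?D = "{frag_cmul (int q * k) (frag_of ()) |k. True}"
    have D: "frag_subgroup ?D"
      unfolding frag_subgroup_def
    proof (intro conjI ballI)
      show "0 \<in> ?D" by (intro CollectI exI[of _ 0]) simp
      fix x y assume "x \<in> ?D" "y \<in> ?D"
      then obtain k l where "x = frag_cmul (int q * k) (frag_of ())" "y = frag_cmul (int q * l) (frag_of ())" by blast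
      then have "x - y = frag_cmul (int q * (k - l)) (frag_of ())"
        by (simp add: right_diff_distrib frag_cmul_diff_distrib)
      then show "x - y \<in> ?D" by blast
    qed
    have "frag_extend (\<lambda>xs. frag_extend ?F (simplicial_boundary xs)) c \<in> ?D"
    proof (rule frag_subgroup_extend[OF D])
      fix xs assume "xs \<in> Poly_Mapping.keys c"
      then show "frag_extend ?F (simplicial_boundary xs) \<in> ?D" using c(1) moore_cocycle_boundary[of xs q] by auto
    qed
    then have "frag_extend ?F (frag_cmul j z) \<in> ?D" by (simp add: c(2) frag_extend_extend)
    moreover have "frag_extend ?F z = frag_of ()" by (simp add: z_def frag_extend_diff frag_extend_add)
    ultimately obtain k where "frag_cmul j (frag_of ()) = frag_cmul (int q * k) (frag_of ())"
      by (auto simp: frag_extend_cmul)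
    then have "j = int q * k" by (metis lookup_frag_cmul mult_1_right lookup_frag_of)
    then show "int q dvd j" by simp
  qed
  then show ?thesis using z_cycle by (auto simp: cyclic_class_def)
qed

text \<open>Infinite order comes from spheres, order 1 from the zero cycle, and other finite orders
  from suspensions of a Moore space. The Moore class is carried by chains with two vertices, which
  explains the restriction for \<open>s = 1\<close>.\<close>

lemma cyclic_class_exists:
  assumes s: "s \<ge> 1" and q: "s = 1 \<Longrightarrow> q \<le> 1"
  shows "\<exists>q' n z. cyclic_class (nodes q' n) (node_less q') s q z"
proof -
  consider "q = 0" | "q = 1" | "q > 1" "s \<ge> 2" using s q by linarith
  then show ?thesis
  proof cases
    case 1
    then show ?thesis using cyclic_class_free by blast
  next
    case 2
    have "cyclic_class (nodes 0 0) (node_less 0) s 1 0"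
      unfolding cyclic_class_def using frag_subgroup_zero[OF frag_subgroup_cycles] frag_subgroup_zero[OF frag_subgroup_boundaries]
      by auto
    then show ?thesis using 2 by blast
  next
    case 3
    then have "q > 0" by simp
    then obtain z where z: "cyclic_class (nodes q 0) (node_less q) 2 q z" using cyclic_class_moore by blast
    have "2 + (s - 2) = s" using 3(2) by simp
    then show ?thesis using cyclic_class_nodes_add[OF z, of "s - 2"] by metis
  qed
qed

section \<open>A graph with torsion in its magnitude homology\<close>

text \<open>The graph is the Hasse diagram of the Moore poset for \<open>q = 2\<close> with both
  ends, numbered by \<open>f\<close>. The class of order 2 lives on chains of two elements; the ends
  make this degree 3, and the three levels of the poset give length 4.\<close>

lemma torsion_graph:
  "\<exists>(V :: nat set) E (n::nat) (l::nat).
     simple_graph V E \<and> graph_connected V E \<and> n > 0 \<and> l > 0 \<and>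
     has_torsion (magnitude_homology V (graph_dist V E) n (real l))"
proof -
  let ?P = "nodes 2 0" and ?lt = "node_less 2"
  define r where "r = {(x, y). x \<in> ?P \<and> y \<in> ?P \<and> (x = y \<or> ?lt x y)}"
  have irrefl: "\<not> ?lt x x" for x using node_less_rank[of 2 x x] by auto
  have po: "partial_order_on ?P r"
    unfolding partial_order_on_def preorder_on_def
  proof (intro conjI refl_onI transI antisymI)
    show "(x, z) \<in> r" if "(x, y) \<in> r" "(y, z) \<in> r" for x y z
      using that node_less_trans[of 2 x y z] by (auto simp: r_def)
    show "x = y" if "(x, y) \<in> r" "(y, x) \<in> r" for x y
      using that node_less_trans[of 2 x y x] irrefl by (auto simp: r_def)
  qed (auto simp: r_def)
  have not_Susp: "Susp k b \<notin> ?P" for k b by simp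
  have rI: "(x, y) \<in> r" if "x \<in> ?P" "y \<in> ?P" "?lt x y" for x y using that by (simp add: r_def)
  have ht: "height_function ?P r node_rank 3"
    unfolding height_function_def
  proof (intro conjI allI impI ballI)
    show "node_rank x < node_rank y" if "(x, y) \<in> r" "x \<noteq> y" for x y
      using that node_less_rank by (auto simp: r_def)
    show "node_rank y = Suc (node_rank x)" if cov: "covers r y x" for x y
    proof -
      have xy: "x \<in> ?P" "y \<in> ?P" "?lt x y" using cov by (auto simp: covers_def r_def)
      have no: "c = x \<or> c = y" if "(x, c) \<in> r" "(c, y) \<in> r" for c using cov that by (auto simp: covers_def)
      show ?thesis
      proof (cases x)
        case x: (U i)
        show ?thesis
        proof (cases y)
          case (W b)
          \<comment> \<open>\<open>Y (i mod 2)\<close> lies between \<open>U i\<close> and every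
            \<open>W b\<close>; in the next case \<open>V i\<close> lies between \<open>U i\<close>
            and \<open>Top\<close>. So no cover skips a level.\<close>
          then have "Y (i mod 2) = x \<or> Y (i mod 2) = y" using x xy by (intro no rI) simp_all
          then show ?thesis using x W by simp
        next
          case Top
          then have "V i = x \<or> V i = y" using x xy by (intro no rI) simp_all
          then show ?thesis using x Top by simp
        qed (use x xy in simp_all)
      next
        case x: (V i)
        then show ?thesis using xy by (cases y) simp_all
      next
        case x: (Y i)
        then show ?thesis using xy by (cases y) simp_all
      next
        case x: (W i)
        then show ?thesis using xy by (cases y) simp_all
      next
        case x: Top
        then show ?thesis using xy by (cases y) simp_all
      next
        case (Susp k b)
        then show ?thesis using xy by simp
      qed
    qed
    show "node_rank x = 1" if x: "x \<in> ?P" and min: "\<forall>y. (y, x) \<in> r \<longrightarrow> y = x" for x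
    proof -
      have no: "y \<notin> ?P \<or> \<not> ?lt y x" for y using min x irrefl by (auto simp: r_def)
      show ?thesis
      proof (cases x)
        case (V i)
        then show ?thesis using no[of "U i"] x by simp
      next
        case (Y a)
        then show ?thesis using no[of "U a"] x by simp
      next
        case (W b)
        then show ?thesis using no[of "Y 0"] x by simp
      next
        case Top
        then show ?thesis using no[of "V 0"] x by simp
      qed (use x in simp_all)
    qed
    show "node_rank x = 3" if x: "x \<in> ?P" and max: "\<forall>y. (x, y) \<in> r \<longrightarrow> y = x" for x
    proof -
      have no: "y \<notin> ?P \<or> \<not> ?lt x y" for y using max x irrefl by (auto simp: r_def)
      show ?thesis
      proof (cases x)
        case (U i)
        then show ?thesis using no[of Top] x by simp
      next
        case (V i)
        then show ?thesis using no[of Top] x by simp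
      next
        case (Y a)
        then show ?thesis using no[of "W 0"] x by simp
      qed (use x in simp_all)
    qed
    show "1 \<le> node_rank x" "node_rank x \<le> 3" if "x \<in> ?P" for x
      using that by (cases x; simp)+
    have "Top \<in> ?P" by simp
    then show "(3::nat) = 0" if "?P = {}" using that by blast
  qed
  let ?H = "hat_carrier ?P"
  interpret G: graded_poset ?H "hat_order ?P r" "hat_rank node_rank 3" Hat0
    by (rule hat_graded[OF po ht])
  have "finite ?H" by (simp add: hat_carrier_def finite_nodes)
  then obtain f :: "node hat \<Rightarrow> nat" where f: "inj_on f ?H"
    using finite_imp_inj_to_nat_seg by blast
  define V where "V = f ` ?H"
  define E where "E = {{f a, f b} |a b. covers (hat_order ?P r) b a}"
  have cov_in: "a \<in> ?H \<and> b \<in> ?H \<and> a \<noteq> b" if "covers (hat_order ?P r) b a" for a b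
    using covers_in[OF G.po that] that by (auto simp: covers_def)
  have f_eq: "f a = f b \<longleftrightarrow> a = b" if "a \<in> ?H" "b \<in> ?H" for a b
    using f that by (auto dest: inj_onD)
  have adj: "edge_adj E (f a) (f b) \<longleftrightarrow> G.adj a b" if ab: "a \<in> ?H" "b \<in> ?H" for a b
  proof
    assume "edge_adj E (f a) (f b)"
    then obtain a' b' where c: "{f a, f b} = {f a', f b'}" "covers (hat_order ?P r) b' a'"
      by (auto simp: edge_adj_def E_def)
    then have "a = a' \<and> b = b' \<or> a = b' \<and> b = a'"
      using cov_in[OF c(2)] ab by (auto simp: doubleton_eq_iff f_eq)
    then show "G.adj a b" using c(2) by (auto simp: G.adj_def)
  next
    assume "G.adj a b"
    then show "edge_adj E (f a) (f b)"
      unfolding G.adj_def edge_adj_def E_def by (auto simp: insert_commute)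
  qed
  have walk: "walk V (edge_adj E) (f a) (f b) n \<longleftrightarrow> walk ?H G.adj a b n" if "a \<in> ?H" "b \<in> ?H" for a b n
    unfolding V_def by (rule walk_image[where adj = G.adj and adj' = "edge_adj E", OF f _ that]) (rule adj)
  have simple: "simple_graph V E"
    unfolding simple_graph_def E_def V_def using cov_in f_eq by fastforce
  have conn: "\<exists>n. walk V (edge_adj E) u v n" if uv: "u \<in> V" "v \<in> V" for u v
  proof -
    obtain a b where ab: "a \<in> ?H" "b \<in> ?H" "u = f a" "v = f b" using uv by (auto simp: V_def)
    then show ?thesis using G.connected[OF ab(1,2)] walk by simp
  qed
  have connected: "graph_connected V E" unfolding graph_connected_def using conn by blast
  have metric: "Metric_space V (graph_dist V E)"
    unfolding graph_dist_def by (rule path_dist_Metric_space) (use conn in \<open>auto simp: edge_adj_def insert_commute\<close>)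
  have d: "graph_dist V E (f a) (f b) = hat_dist ?P r a b" if "a \<in> ?H" "b \<in> ?H" for a b
    unfolding graph_dist_def hat_dist_def G.hasse_dist_adj path_dist_def walk[OF that] ..
  let ?lt' = "\<lambda>x y. (x, y) \<in> r \<and> x \<noteq> y"
  interpret hat_embedding V "graph_dist V E" ?P ?lt' "f \<circ> Elem" "f Hat0" "f Hat1"
      "\<lambda>x. real (hat_rank node_rank 3 (inv_into ?H f x))"
    by (rule hat_embedding_inj[OF po ht f V_def metric d])
  have l: "real (hat_rank node_rank 3 (inv_into ?H f (f Hat1))) - real (hat_rank node_rank 3 (inv_into ?H f (f Hat0))) = real 4"
    by (simp add: inv_into_f_f[OF f] hat_rank_def)
  have chains: "simplicial_chains ?P ?lt' s = simplicial_chains ?P ?lt s" for s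
  proof -
    have "sorted_wrt ?lt' xs \<longleftrightarrow> sorted_wrt ?lt xs" if "set xs \<subseteq> ?P" for xs
      using that irrefl by (intro iffI; elim sorted_wrt_mono_rel[rotated]) (auto simp: r_def subset_iff)
    then show ?thesis by (auto simp: simplicial_chains_def)
  qed
  obtain z where z: "cyclic_class ?P ?lt 2 2 z" using cyclic_class_moore[of 2] by auto
  let ?W = "frag_extend (frag_of \<circ> wrap)"
  have zc: "z \<in> chain_cycles (simplicial_chains ?P ?lt' 2) simplicial_boundary"
    using z by (simp add: cyclic_class_def chains)
  let ?Z = "chain_cycles (proper_chains V (graph_dist V E) 3 (real 4)) (magnitude_boundary (graph_dist V E))"
  let ?B = "chain_boundaries (proper_chains V (graph_dist V E) (3 + 1) (real 4)) (magnitude_boundary (graph_dist V E))"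
  have "has_torsion (frag_group ?Z Mod ?B)"
  proof (rule frag_quotient_has_torsion[where a = "?W z" and k = 2, OF frag_subgroup_cycles frag_subgroup_boundaries])
    show "?B \<subseteq> ?Z"
      using magnitude_boundaries_subset[of 3] by simp
    have W: "?W c \<in> ?Z"
      "?W c \<in> ?B \<longleftrightarrow> c \<in> simplicial_boundaries ?P ?lt 2"
      if "c \<in> chain_cycles (simplicial_chains ?P ?lt' 2) simplicial_boundary" for c
      using wrap_cycles[OF that, unfolded l chains] by (simp_all add: numeral_3_eq_3 numeral_2_eq_2)
    show "?W z \<in> ?Z"
      by (rule W(1)[OF zc])
    have dvd: "frag_cmul j z \<in> simplicial_boundaries ?P ?lt 2 \<longleftrightarrow> int 2 dvd j" for j
      using z unfolding cyclic_class_def by blast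
    have "\<not> int 2 dvd 1" by simp
    then have "frag_cmul 1 z \<notin> simplicial_boundaries ?P ?lt 2" using dvd by blast
    then show "?W z \<notin> ?B"
      using W(2)[OF zc] by simp
    have "frag_cmul 2 z \<in> simplicial_boundaries ?P ?lt 2" using dvd[of 2] by simp
    then have "?W (frag_cmul 2 z) \<in> ?B"
      using W(2)[OF frag_subgroup_cmul[OF frag_subgroup_cycles zc]] by blast
    then show "frag_cmul (int 2) (?W z) \<in> ?B"
      by (simp add: frag_extend_cmul)
  qed simp
  then have "has_torsion (magnitude_homology V (graph_dist V E) 3 (real 4))"
    by (simp only: magnitude_homology_def chain_homology_eq)
  then show ?thesis using simple connected
    by (intro exI[of _ V] exI[of _ E] exI[of _ 3] exI[of _ 4]) simp
qed

section \<open>Zeroth homology is torsion-free\<close>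

text \<open>Replacing every 0-simplex by a chosen representative of its class changes a chain by a
  boundary and sends boundaries to zero. If \<open>j * c\<close> is a boundary, then
  \<open>j\<close> times the reduced chain is zero in a free group, hence the reduced chain is
  zero.\<close>

lemma singular_boundaries_0_torsion_free:
  assumes c: "frag_cmul j c \<in> singular_boundaries 0 X" and j: "j \<noteq> 0"
  shows "c \<in> singular_boundaries 0 X"
proof -
  let ?B = "singular_boundaries 0 X"
  note B = frag_subgroup_singular_boundaries[of 0 X]
  define rep where "rep f = (SOME g. frag_of f - frag_of g \<in> ?B)" for f
  have rep: "frag_of f - frag_of (rep f) \<in> ?B" for f
    unfolding rep_def by (rule someI[of _ f]) (simp add: frag_subgroup_zero[OF B])
  have rep_eq: "rep f = rep g" if fg: "frag_of f - frag_of g \<in> ?B" for f g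
  proof -
    have "frag_of f - frag_of h \<in> ?B \<longleftrightarrow> frag_of g - frag_of h \<in> ?B" for h
      by (rule frag_subgroup_diff_iff[OF B]) (use fg in simp)
    then show ?thesis by (simp add: rep_def)
  qed
  let ?\<rho> = "frag_extend (\<lambda>f. frag_of (rep f))"
  have \<rho>: "c - ?\<rho> c \<in> ?B" for c
  proof -
    have "c - ?\<rho> c = frag_extend (\<lambda>f. frag_of f - frag_of (rep f)) c"
    proof (rule frag_induction[OF subset_UNIV, of _ c])
      fix a b :: "'a chain"
      assume "a - ?\<rho> a = frag_extend (\<lambda>f. frag_of f - frag_of (rep f)) a"
        "b - ?\<rho> b = frag_extend (\<lambda>f. frag_of f - frag_of (rep f)) b"
      moreover have "(a - b) - ?\<rho> (a - b) = (a - ?\<rho> a) - (b - ?\<rho> b)" by (simp add: frag_extend_diff)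
      ultimately show "(a - b) - ?\<rho> (a - b) = frag_extend (\<lambda>f. frag_of f - frag_of (rep f)) (a - b)"
        by (simp only: frag_extend_diff)
    qed simp_all
    then show ?thesis using frag_subgroup_extend[OF B rep] by simp
  qed
  have \<rho>_B: "?\<rho> b = 0" if b: "b \<in> ?B" for b
  proof -
    obtain d where d: "singular_chain (Suc 0) X d" "chain_boundary (Suc 0) d = b"
      using b by (auto simp: singular_boundaries_def singular_boundary)
    have "singular_chain (Suc 0) X d \<Longrightarrow> ?\<rho> (chain_boundary (Suc 0) d) = 0"
      unfolding singular_chain_def
    proof (induction d rule: frag_induction)
      case (one f)
      then have "singular_chain (Suc 0) X (frag_of f)" by (simp add: singular_chain_of)
      then have "chain_boundary (Suc 0) (frag_of f) \<in> ?B"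
        by (auto simp: singular_boundaries_def singular_boundary)
      moreover have "chain_boundary (Suc 0) (frag_of f) = frag_of (singular_face 1 0 f) - frag_of (singular_face 1 1 f)"
        by (simp add: chain_boundary_of)
      ultimately show ?case using rep_eq[of "singular_face 1 0 f" "singular_face 1 1 f"]
        by (simp add: frag_extend_diff)
    qed (simp_all add: chain_boundary_diff frag_extend_diff)
    then show ?thesis using d by simp
  qed
  have "frag_cmul j (?\<rho> c) = 0" using \<rho>_B[OF c] by (simp add: frag_extend_cmul)
  then have "?\<rho> c = 0" using j by (simp add: frag_cmul_eq_0_iff)
  then show ?thesis using \<rho>[of c] by simp
qed

section \<open>Disjoint unions\<close>

definition union_less :: "('i \<Rightarrow> 'a \<Rightarrow> 'a \<Rightarrow> bool) \<Rightarrow> 'i \<times> 'a \<Rightarrow> 'i \<times> 'a \<Rightarrow> bool" where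
  "union_less L u v \<longleftrightarrow> fst u = fst v \<and> L (fst u) (snd u) (snd v)"

text \<open>A nonempty chain lies in one member of the family, so \<open>pr \<iota>\<close>, which
  reads the member off the first entry, is a projection that commutes with the boundary. The empty
  chain belongs to every member; \<open>s \<ge> 1\<close> keeps it out, also as a face of the
  filling chains.\<close>

lemma disjoint_union_cycles:
  fixes Q :: "'i \<Rightarrow> 'a set" and L :: "'i \<Rightarrow> 'a \<Rightarrow> 'a \<Rightarrow> bool"
  defines "inc \<iota> \<equiv> frag_extend (frag_of \<circ> map (Pair \<iota>))"
  assumes s: "s \<ge> 1"
  shows "\<iota> \<in> I \<Longrightarrow> z \<in> simplicial_cycles (Q \<iota>) (L \<iota>) s \<Longrightarrow> inc \<iota> z \<in> simplicial_cycles (Sigma I Q) (union_less L) s"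
    and "\<lbrakk>finite J; J \<subseteq> I; \<And>\<iota>. \<iota> \<in> J \<Longrightarrow> y \<iota> \<in> simplicial_cycles (Q \<iota>) (L \<iota>) s\<rbrakk> \<Longrightarrow>
      (\<Sum>\<iota>\<in>J. inc \<iota> (y \<iota>)) \<in> simplicial_boundaries (Sigma I Q) (union_less L) s \<longleftrightarrow>
      (\<forall>\<iota>\<in>J. y \<iota> \<in> simplicial_boundaries (Q \<iota>) (L \<iota>) s)"
proof -
  let ?P = "Sigma I Q" and ?lt = "union_less L"
  have inc_keys: "Poly_Mapping.keys ((frag_of \<circ> map (Pair \<iota>)) xs) \<subseteq> simplicial_chains ?P ?lt k"
    if "\<iota> \<in> I" "xs \<in> simplicial_chains (Q \<iota>) (L \<iota>) k" for \<iota> xs k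
    using that by (auto simp: simplicial_chains_def sorted_wrt_map union_less_def)
  have inc_comm: "frag_extend simplicial_boundary ((frag_of \<circ> map (Pair \<iota>)) xs)
      = frag_extend (frag_of \<circ> map (Pair \<iota>)) (simplicial_boundary xs)" for \<iota> :: 'i and xs :: "'a list"
    by (simp add: simplicial_boundary_map)
  show cyc: "inc \<iota> z \<in> simplicial_cycles ?P ?lt s" if "\<iota> \<in> I" "z \<in> simplicial_cycles (Q \<iota>) (L \<iota>) s" for \<iota> z
    unfolding inc_def
    by (rule frag_extend_chain_map(1)[where C = "simplicial_chains (Q \<iota>) (L \<iota>) s"])
      (use that inc_keys inc_comm in auto)
  have bd: "inc \<iota> b \<in> simplicial_boundaries ?P ?lt s" if "\<iota> \<in> I" "b \<in> simplicial_boundaries (Q \<iota>) (L \<iota>) s" for \<iota> b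
    unfolding inc_def
    by (rule frag_extend_chain_map(2)[where C = "simplicial_chains (Q \<iota>) (L \<iota>) (Suc s)"])
      (use that inc_keys inc_comm in auto)
  define pr where "pr \<iota> ys = (if fst (hd ys) = \<iota> then frag_of (map snd ys) else 0)" for \<iota> :: 'i and ys :: "('i \<times> 'a) list"
  have same: "fst u = fst v" if ys: "ys \<in> simplicial_chains ?P ?lt k" "u \<in> set ys" "v \<in> set ys" for ys k u v
  proof -
    obtain i j where "i < length ys" "j < length ys" "u = ys ! i" "v = ys ! j" using ys(2,3) by (auto simp: in_set_conv_nth)
    then show ?thesis
      using ys(1) by (cases i j rule: linorder_cases)
        (auto simp: simplicial_chains_def sorted_wrt_iff_nth_less union_less_def)
  qed
  have pr_keys: "Poly_Mapping.keys (pr \<iota> ys) \<subseteq> simplicial_chains (Q \<iota>) (L \<iota>) (Suc k)"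
    if ys: "ys \<in> simplicial_chains ?P ?lt (Suc k)" for \<iota> ys k
  proof (cases "fst (hd ys) = \<iota>")
    case True
    have "ys \<noteq> []" using ys by (auto simp: simplicial_chains_def)
    then have fst: "fst u = \<iota>" if "u \<in> set ys" for u
      using same[OF ys that hd_in_set] True by simp
    have "sorted_wrt (\<lambda>u v. L \<iota> (snd u) (snd v)) ys"
      by (rule sorted_wrt_mono_rel[of _ ?lt]) (use ys fst in \<open>auto simp: simplicial_chains_def union_less_def\<close>)
    moreover have "snd u \<in> Q \<iota>" if "u \<in> set ys" for u
      using ys that fst[OF that] by (auto simp: simplicial_chains_def)
    ultimately have "map snd ys \<in> simplicial_chains (Q \<iota>) (L \<iota>) (Suc k)"
      using ys by (auto simp: simplicial_chains_def sorted_wrt_map)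
    then show ?thesis by (simp add: pr_def)
  qed (simp add: pr_def)
  have pr_comm: "frag_extend simplicial_boundary (pr \<iota> ys) = frag_extend (pr \<iota>) (simplicial_boundary ys)"
    if ys: "ys \<in> simplicial_chains ?P ?lt (Suc s)" for \<iota> ys
  proof -
    have hd_face: "fst (hd zs) = fst (hd ys)" if zs: "zs \<in> Poly_Mapping.keys (simplicial_boundary ys)" for zs
    proof -
      obtain i where i: "i < length ys" "zs = delete_nth i ys" using zs by (rule simplicial_boundary_keysD)
      have "length zs = s" using i ys by (simp add: length_delete_nth simplicial_chains_def)
      then have "zs \<noteq> []" using s by auto
      then have "hd zs \<in> set ys" using set_delete_nth[of i ys] i(2) hd_in_set by blast
      moreover have "hd ys \<in> set ys" using ys by (intro hd_in_set) (auto simp: simplicial_chains_def)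
      ultimately show ?thesis using same[OF ys] by blast
    qed
    show ?thesis
    proof (cases "fst (hd ys) = \<iota>")
      case True
      have "frag_extend (pr \<iota>) (simplicial_boundary ys) = frag_extend (frag_of \<circ> map snd) (simplicial_boundary ys)"
        by (rule frag_extend_eq) (use True hd_face in \<open>simp add: pr_def\<close>)
      then show ?thesis using True by (simp add: pr_def simplicial_boundary_map)
    next
      case False
      have "frag_extend (pr \<iota>) (simplicial_boundary ys) = 0"
        by (rule frag_extend_eq_0) (use False hd_face in \<open>simp add: pr_def\<close>)
      then show ?thesis using False by (simp add: pr_def)
    qed
  qed
  have pr_inc: "frag_extend (pr \<kappa>) (inc \<iota> z) = (if \<iota> = \<kappa> then z else 0)"
    if z: "z \<in> simplicial_cycles (Q \<iota>) (L \<iota>) s" for \<iota> \<kappa> z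
  proof -
    have "frag_extend (pr \<kappa>) (inc \<iota> z) = frag_extend (\<lambda>xs. if \<iota> = \<kappa> then frag_of xs else 0) z"
      unfolding inc_def frag_extend_extend
    proof (rule frag_extend_eq)
      fix xs assume "xs \<in> Poly_Mapping.keys z"
      then have "length xs = s" using z by (auto simp: chain_cycles_def simplicial_chains_def)
      then have "xs \<noteq> []" using s by auto
      then show "frag_extend (pr \<kappa>) ((frag_of \<circ> map (Pair \<iota>)) xs) = (if \<iota> = \<kappa> then frag_of xs else 0)"
        by (simp add: pr_def hd_map o_def)
    qed
    also have "\<dots> = (if \<iota> = \<kappa> then z else 0)"
      using frag_expansion[of z] by (simp add: frag_extend_eq_0)
    finally show ?thesis .
  qed
  show "(\<Sum>\<iota>\<in>J. inc \<iota> (y \<iota>)) \<in> simplicial_boundaries ?P ?lt s \<longleftrightarrow> (\<forall>\<iota>\<in>J. y \<iota> \<in> simplicial_boundaries (Q \<iota>) (L \<iota>) s)"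
    if J: "finite J" "J \<subseteq> I" and y: "\<And>\<iota>. \<iota> \<in> J \<Longrightarrow> y \<iota> \<in> simplicial_cycles (Q \<iota>) (L \<iota>) s"
  proof
    assume B: "(\<Sum>\<iota>\<in>J. inc \<iota> (y \<iota>)) \<in> simplicial_boundaries ?P ?lt s"
    show "\<forall>\<kappa>\<in>J. y \<kappa> \<in> simplicial_boundaries (Q \<kappa>) (L \<kappa>) s"
    proof
      fix \<kappa> assume \<kappa>: "\<kappa> \<in> J"
      have "frag_extend (pr \<kappa>) (\<Sum>\<iota>\<in>J. inc \<iota> (y \<iota>)) \<in> simplicial_boundaries (Q \<kappa>) (L \<kappa>) s"
        by (rule frag_extend_chain_map(2)[where C = "simplicial_chains ?P ?lt (Suc s)"])
          (use B pr_keys pr_comm in auto)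
      moreover have "frag_extend (pr \<kappa>) (\<Sum>\<iota>\<in>J. inc \<iota> (y \<iota>)) = (\<Sum>\<iota>\<in>J. if \<iota> = \<kappa> then y \<iota> else 0)"
        unfolding frag_extend_sum[OF J(1)] by (intro sum.cong) (auto simp: pr_inc y)
      ultimately show "y \<kappa> \<in> simplicial_boundaries (Q \<kappa>) (L \<kappa>) s" using J(1) \<kappa> by simp
    qed
  next
    assume "\<forall>\<iota>\<in>J. y \<iota> \<in> simplicial_boundaries (Q \<iota>) (L \<iota>) s"
    then show "(\<Sum>\<iota>\<in>J. inc \<iota> (y \<iota>)) \<in> simplicial_boundaries ?P ?lt s"
      using J(2) bd by (intro frag_subgroup_sum[OF frag_subgroup_boundaries]) blast
  qed
qed

section \<open>Finite posets in finite metric spaces\<close>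

text \<open>The triangle inequality is at stake only if \<open>b\<close> is comparable with
  \<open>a\<close> and with \<open>c\<close>, but these are incomparable. Then \<open>b\<close> lies
  above both or below both, and the detour costs at least twice a rank difference of 1, which pays
  for the added 2.\<close>

lemma finite_poset_hat_embedding:
  assumes fin: "finite P" and trans: "\<And>x y z. lt x y \<Longrightarrow> lt y z \<Longrightarrow> lt x z"
    and rank: "\<And>x y. lt x y \<Longrightarrow> rk x < (rk y :: nat)"
  shows "\<exists>(X :: nat set) d e e0 e1 \<rho>. finite X \<and> \<rho> e0 < \<rho> e1 \<and> hat_embedding X d P lt e e0 e1 \<rho>"
proof -
  define r where "r = {(x, y). x \<in> P \<and> y \<in> P \<and> (x = y \<or> lt x y)}"
  have irrefl: "\<not> lt x x" for x using rank[of x x] by auto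
  have po: "partial_order_on P r"
    unfolding partial_order_on_def preorder_on_def
  proof (intro conjI refl_onI transI antisymI)
    show "(x, z) \<in> r" if "(x, y) \<in> r" "(y, z) \<in> r" for x y z
      using that trans[of x y z] by (auto simp: r_def)
    show "x = y" if "(x, y) \<in> r" "(y, x) \<in> r" for x y
      using that trans[of x y x] irrefl by (auto simp: r_def)
  qed (auto simp: r_def)
  let ?H = "hat_carrier P" and ?O = "hat_order P r"
  obtain K where K: "\<And>x. x \<in> P \<Longrightarrow> rk x \<le> K"
    using fin finite_nat_set_iff_bounded_le[of "rk ` P"] by auto
  \<comment> \<open>\<open>Suc \<circ> rk\<close> leaves rank 0 to \<open>Hat0\<close> alone, and
    \<open>Suc K\<close> puts \<open>Hat1\<close> strictly above all elements.\<close>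
  define \<rho> where "\<rho> a = real (hat_rank (Suc \<circ> rk) (Suc K) a)" for a
  have O: "partial_order_on ?H ?O" by (rule hat_order_partial_order[OF po])
  then have O_in: "a \<in> ?H \<and> b \<in> ?H" if "(a, b) \<in> ?O" for a b
    using that by (auto simp: partial_order_on_def preorder_on_def)
  have O_refl: "(a, a) \<in> ?O" if "a \<in> ?H" for a
    using O that by (auto simp: partial_order_on_def preorder_on_def refl_on_def)
  have O_trans: "(a, c) \<in> ?O" if "(a, b) \<in> ?O" "(b, c) \<in> ?O" for a b c
    using O that by (meson partial_order_on_def preorder_on_def transD)
  have \<rho>_less: "\<rho> a + 1 \<le> \<rho> b" if "(a, b) \<in> ?O" "a \<noteq> b" for a b
  proof -
    have "hat_rank (Suc \<circ> rk) (Suc K) a < hat_rank (Suc \<circ> rk) (Suc K) b"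
      using that by (cases a; cases b) (auto simp: hat_rank_def r_def less_Suc_eq_le K intro: Suc_leI rank)
    then show ?thesis by (simp add: \<rho>_def)
  qed
  define D where "D a b = \<bar>\<rho> a - \<rho> b\<bar> + (if (a, b) \<in> ?O \<or> (b, a) \<in> ?O then 0 else 2)" for a b
  have D_triangle: "D a c \<le> D a b + D b c" for a b c
  proof (cases "(a, c) \<in> ?O \<or> (c, a) \<in> ?O")
    case True
    then show ?thesis by (auto simp: D_def)
  next
    case ac: False
    show ?thesis
    proof (cases "((a, b) \<in> ?O \<or> (b, a) \<in> ?O) \<and> ((b, c) \<in> ?O \<or> (c, b) \<in> ?O)")
      case False
      then show ?thesis by (auto simp: D_def)
    next
      case True
      then consider "(a, b) \<in> ?O" "(c, b) \<in> ?O" | "(b, a) \<in> ?O" "(b, c) \<in> ?O"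
        using ac O_trans by blast
      moreover have "a \<noteq> b" "b \<noteq> c" using True ac by auto
      ultimately have "\<bar>\<rho> a - \<rho> c\<bar> + 2 \<le> \<bar>\<rho> a - \<rho> b\<bar> + \<bar>\<rho> b - \<rho> c\<bar>"
        using \<rho>_less[of a b] \<rho>_less[of c b] \<rho>_less[of b a] \<rho>_less[of b c] by cases auto
      then show ?thesis by (simp add: D_def)
    qed
  qed
  have D_zero: "D a b = 0 \<longleftrightarrow> a = b" if "a \<in> ?H" "b \<in> ?H" for a b
    using O_refl[OF that(1)] \<rho>_less[of a b] \<rho>_less[of b a] by (cases "a = b") (auto simp: D_def)
  have D_eq: "D a b = \<rho> b - \<rho> a \<longleftrightarrow> (a, b) \<in> ?O" if "a \<in> ?H" "b \<in> ?H" for a b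
    using O_refl[OF that(1)] \<rho>_less[of a b] \<rho>_less[of b a] by (cases "a = b") (auto simp: D_def)
  have "finite ?H" using fin by (simp add: hat_carrier_def)
  then obtain f :: "'a hat \<Rightarrow> nat" where f: "inj_on f ?H"
    using finite_imp_inj_to_nat_seg by blast
  let ?X = "f ` ?H" and ?g = "inv_into ?H f"
  have g: "?g (f a) = a" if "a \<in> ?H" for a using f that by (rule inv_into_f_f)
  have "Metric_space ?X (\<lambda>x y. D (?g x) (?g y))"
  proof
    show "(D (?g x) (?g y) = 0) = (x = y)" if "x \<in> ?X" "y \<in> ?X" for x y
      using that by (auto simp: g D_zero)
  qed (auto simp: D_triangle, auto simp: D_def)
  then interpret H: hat_embedding ?X "\<lambda>x y. D (?g x) (?g y)" P "\<lambda>x y. (x, y) \<in> r \<and> x \<noteq> y"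
      "f \<circ> Elem" "f Hat0" "f Hat1" "\<lambda>x. \<rho> (?g x)"
    by (rule hat_embedding_transfer[OF f refl]) (simp_all add: g D_eq, auto simp: D_def)
  have lt_eq: "lt x y \<longleftrightarrow> (x, y) \<in> r \<and> x \<noteq> y" if "x \<in> P" "y \<in> P" for x y
    using that irrefl by (auto simp: r_def)
  have "hat_embedding ?X (\<lambda>x y. D (?g x) (?g y)) P lt (f \<circ> Elem) (f Hat0) (f Hat1) (\<lambda>x. \<rho> (?g x))"
  proof
    show "lt x y = (x \<noteq> y \<and> D (?g ((f \<circ> Elem) x)) (?g ((f \<circ> Elem) y)) = \<rho> (?g ((f \<circ> Elem) y)) - \<rho> (?g ((f \<circ> Elem) x)))"
      if "x \<in> P" "y \<in> P" for x y
      unfolding lt_eq[OF that] by (rule H.lt_iff[OF that])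
  qed (fact H.X_eq H.inj H.e0_e1 | rule H.dist_ge H.e0_e H.e_e1, assumption+)+
  moreover have "\<rho> (?g (f Hat0)) < \<rho> (?g (f Hat1))" by (simp add: g \<rho>_def hat_rank_def)
  ultimately show ?thesis using \<open>finite ?H\<close> by (intro exI conjI) auto
qed

section \<open>Homology of compact manifolds inside magnitude homology\<close>

text \<open>The bound \<open>N\<close> keeps the total number of summands over all degrees finite,
  and the bound on the orders in degree 0 matches the restriction in
  \<open>cyclic_class_exists\<close>.\<close>

lemma compact_manifold_cyclic_decomposition:
  assumes "compact_space M" "Hausdorff_space M" "smooth_atlas m M A"
  shows "\<exists>N (k :: nat \<Rightarrow> nat) g q. (\<forall>p. \<forall>i<k p. g p i \<in> singular_cycles p M) \<and>
    (\<forall>p. \<forall>a\<in>singular_cycles p M. \<exists>n. a - (\<Sum>i<k p. frag_cmul (n i) (g p i)) \<in> singular_boundaries p M) \<and>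
    (\<forall>p n. (\<Sum>i<k p. frag_cmul (n i) (g p i)) \<in> singular_boundaries p M \<longleftrightarrow> (\<forall>i<k p. int (q p i) dvd n i)) \<and>
    (\<forall>p\<ge>N. k p = 0) \<and> (\<forall>i<k 0. q 0 i \<le> (1::nat))"
proof -
  obtain N where N: "\<And>p. p \<ge> N \<Longrightarrow> singular_cycles p M \<subseteq> singular_boundaries p M"
    using compact_manifold_homology_fg(2)[OF assms] by blast
  define good where "good p w \<longleftrightarrow> (case w of (k, g, q) \<Rightarrow>
     (\<forall>i<k. g i \<in> singular_cycles p M) \<and>
     (\<forall>a\<in>singular_cycles p M. \<exists>n. a - (\<Sum>i<k. frag_cmul (n i) (g i)) \<in> singular_boundaries p M) \<and>
     (\<forall>n. (\<Sum>i<k. frag_cmul (n i) (g i)) \<in> singular_boundaries p M \<longleftrightarrow> (\<forall>i<k. int (q i) dvd n i)) \<and>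
     (p \<ge> N \<longrightarrow> k = 0))" for p and w :: "nat \<times> (nat \<Rightarrow> _) \<times> (nat \<Rightarrow> nat)"
  have "\<exists>w. good p w" for p
  proof (cases "p \<ge> N")
    case True
    \<comment> \<open>The empty tuple is given explicitly, because a decomposition of the zero group
      could also consist of trivial summands.\<close>
    have "good p (0, \<lambda>_. 0, \<lambda>_. 0)"
      using N[OF True] frag_subgroup_zero[OF frag_subgroup_singular_boundaries] by (auto simp: good_def)
    then show ?thesis ..
  next
    case False
    show ?thesis
    proof (rule cyclic_decomposition[OF frag_subgroup_singular_cycles frag_subgroup_singular_boundaries
          compact_manifold_homology_fg(1)[OF assms]])
      fix k :: nat and g and q :: "nat \<Rightarrow> nat"
      assume "\<And>i. i < k \<Longrightarrow> g i \<in> singular_cycles p M"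
        "\<And>a. a \<in> singular_cycles p M \<Longrightarrow> \<exists>n. a - (\<Sum>i<k. frag_cmul (n i) (g i)) \<in> singular_boundaries p M"
        "\<And>n. (\<Sum>i<k. frag_cmul (n i) (g i)) \<in> singular_boundaries p M \<longleftrightarrow> (\<forall>i<k. int (q i) dvd n i)"
      then have "good p (k, g, q)" using False by (simp add: good_def)
      then show ?thesis ..
    qed
  qed
  then obtain w where w: "\<And>p. good p (w p)" by metis
  define k where "k p = fst (w p)" for p
  define g where "g p = fst (snd (w p))" for p
  define q where "q p = snd (snd (w p))" for p
  have w': "good p (k p, g p, q p)" for p using w[of p] by (simp add: k_def g_def q_def)
  note good = w'[unfolded good_def, simplified]
  have "q 0 i \<le> 1" if i: "i < k 0" for i
  proof (cases "q 0 i = 0")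
    case False
    have single: "(\<Sum>i'<k 0. frag_cmul (if i' = i then c else 0) (g 0 i')) = frag_cmul c (g 0 i)" for c
    proof -
      have "(\<Sum>i'<k 0. frag_cmul (if i' = i then c else 0) (g 0 i')) = (\<Sum>i'<k 0. if i' = i then frag_cmul c (g 0 i') else 0)"
        by (intro sum.cong) auto
      then show ?thesis using i by simp
    qed
    have dvd: "frag_cmul c (g 0 i) \<in> singular_boundaries 0 M \<longleftrightarrow> int (q 0 i) dvd c" for c
    proof -
      let ?n = "\<lambda>i'. if i' = i then c else 0"
      have "frag_cmul c (g 0 i) \<in> singular_boundaries 0 M \<longleftrightarrow>
          (\<Sum>i'<k 0. frag_cmul (?n i') (g 0 i')) \<in> singular_boundaries 0 M"
        by (simp only: single)
      also have "\<dots> \<longleftrightarrow> (\<forall>i'<k 0. int (q 0 i') dvd ?n i')" by (rule good[of 0, THEN conjunct2, THEN conjunct2, THEN conjunct1, THEN spec])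
      also have "\<dots> \<longleftrightarrow> int (q 0 i) dvd c" using i by auto
      finally show ?thesis .
    qed
    \<comment> \<open>A finite order in degree 0 makes the generator a torsion class, hence a
      boundary, and then the order divides 1.\<close>
    have "frag_cmul (int (q 0 i)) (g 0 i) \<in> singular_boundaries 0 M" using dvd by simp
    then have "g 0 i \<in> singular_boundaries 0 M"
      by (rule singular_boundaries_0_torsion_free) (simp add: False)
    then have "int (q 0 i) dvd 1" using dvd[of 1] by simp
    then show ?thesis by simp
  qed simp
  with good show ?thesis by (intro exI[of _ N] exI[of _ k] exI[of _ g] exI[of _ q]) simp
qed

text \<open>A summand of degree \<open>p\<close> is realised on chains of \<open>p + 1\<close> poset
  elements and so in magnitude degree \<open>p + 2\<close>. Collecting the summands of all degrees
  in one disjoint union gives a single \<open>X\<close> and a single \<open>l\<close>. The union may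
  carry further classes, so the image is a subgroup only.\<close>

lemma compact_manifold_magnitude:
  assumes M: "smooth_manifold m M A" "compact_space M"
  shows "\<exists>(X :: nat set) d (l::real). finite X \<and> Metric_space X d \<and> l > 0 \<and>
     (\<forall>n::nat. n > 0 \<longrightarrow>
       (\<exists>K. subgroup K (magnitude_homology X d n l) \<and>
            (magnitude_homology X d n l)\<lparr>carrier := K\<rparr> \<cong> homology_group (int n - 2) M))"
proof -
  have "Hausdorff_space M" "smooth_atlas m M A" using M(1) by (simp_all add: smooth_manifold_def)
  from compact_manifold_cyclic_decomposition[OF M(2) this]
  obtain N and k :: "nat \<Rightarrow> nat" and g q where
    g': "\<forall>p. \<forall>i<k p. g p i \<in> singular_cycles p M"
    and gen': "\<forall>p. \<forall>a\<in>singular_cycles p M. \<exists>n. a - (\<Sum>i<k p. frag_cmul (n i) (g p i)) \<in> singular_boundaries p M"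
    and rel': "\<forall>p n. (\<Sum>i<k p. frag_cmul (n i) (g p i)) \<in> singular_boundaries p M \<longleftrightarrow> (\<forall>i<k p. int (q p i) dvd n i)"
    and k0': "\<forall>p\<ge>N. k p = 0" and q0': "\<forall>i<k 0. q 0 i \<le> (1::nat)"
    by (elim exE conjE)
  note gen = gen'[rule_format] and rel = rel'[THEN spec, THEN spec] and k0 = k0'[rule_format] and q0 = q0'[rule_format]
  define I where "I = (SIGMA p:{..<N}. {..<k p})"
  have "\<exists>w. cyclic_class (nodes (fst w) (fst (snd w))) (node_less (fst w)) (Suc (fst \<iota>)) (q (fst \<iota>) (snd \<iota>)) (snd (snd w))"
    if "\<iota> \<in> I" for \<iota>
  proof -
    have "\<exists>q' n z. cyclic_class (nodes q' n) (node_less q') (Suc (fst \<iota>)) (q (fst \<iota>) (snd \<iota>)) z"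
    proof (rule cyclic_class_exists)
      assume "Suc (fst \<iota>) = 1"
      then show "q (fst \<iota>) (snd \<iota>) \<le> 1" using that q0 by (auto simp: I_def)
    qed simp
    then show ?thesis by (metis fst_conv snd_conv)
  qed
  then obtain w where w: "\<And>\<iota>. \<iota> \<in> I \<Longrightarrow>
      cyclic_class (nodes (fst (w \<iota>)) (fst (snd (w \<iota>)))) (node_less (fst (w \<iota>))) (Suc (fst \<iota>)) (q (fst \<iota>) (snd \<iota>)) (snd (snd (w \<iota>)))"
    by metis
  define Q where "Q \<iota> = nodes (fst (w \<iota>)) (fst (snd (w \<iota>)))" for \<iota>
  define L where "L \<iota> = node_less (fst (w \<iota>))" for \<iota>
  define z where "z \<iota> = snd (snd (w \<iota>))" for \<iota>
  have cls: "cyclic_class (Q (p, i)) (L (p, i)) (Suc p) (q p i) (z (p, i))" if "i < k p" for p i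
  proof -
    have "(p, i) \<in> I" using that k0[of p] by (cases "p < N") (auto simp: I_def)
    then show ?thesis using w[of "(p, i)"] by (simp add: Q_def L_def z_def)
  qed
  let ?P = "Sigma I Q" and ?lt = "union_less L"
  have "finite I" by (simp add: I_def)
  then have finP: "finite ?P" by (intro finite_SigmaI) (simp_all add: Q_def finite_nodes)
  have lt_trans: "?lt x z" if "?lt x y" "?lt y z" for x y z
    using that node_less_trans by (auto simp: union_less_def L_def)
  have lt_rank: "node_rank (snd x) < node_rank (snd y)" if "?lt x y" for x y
    using that node_less_rank by (auto simp: union_less_def L_def)
  have "\<exists>(X :: nat set) d e e0 e1 \<rho>. finite X \<and> \<rho> e0 < (\<rho> e1 :: real) \<and> hat_embedding X d ?P ?lt e e0 e1 \<rho>"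
  proof (rule finite_poset_hat_embedding[OF finP])
    show "?lt x z" if "?lt x y" "?lt y z" for x y z using lt_trans[OF that] .
    show "node_rank (snd x) < node_rank (snd y)" if "?lt x y" for x y using lt_rank[OF that] .
  qed
  then obtain X :: "nat set" and d e e0 e1 \<rho> where X: "finite X" "\<rho> e0 < (\<rho> e1 :: real)" "hat_embedding X d ?P ?lt e e0 e1 \<rho>"
    by (elim exE conjE)
  interpret hat_embedding X d ?P ?lt e e0 e1 \<rho> by (rule X(3))
  let ?l = "\<rho> e1 - \<rho> e0"
  have Mag: "magnitude_homology X d n ?l = frag_group (chain_cycles (proper_chains X d n ?l) (magnitude_boundary d))
      Mod chain_boundaries (proper_chains X d (Suc n) ?l) (magnitude_boundary d)" for n
    by (simp add: magnitude_homology_def chain_homology_eq)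
  have Mag_group: "group (magnitude_homology X d n ?l)" for n
    unfolding Mag by (rule group_frag_quotient[OF frag_subgroup_cycles frag_subgroup_boundaries magnitude_boundaries_subset])
  have "\<exists>h. h \<in> mon (homology_group (int p) M) (magnitude_homology X d (Suc (Suc p)) ?l)" for p
  proof -
    \<comment> \<open>The poset cycle with coefficients \<open>c\<close> on the classes chosen for
      degree \<open>p\<close>; it obeys the same relations as the combination of the
      \<open>g p i\<close>.\<close>
    define zz where "zz c = (\<Sum>\<iota>\<in>Pair p ` {..<k p}. frag_extend (frag_of \<circ> map (Pair \<iota>)) (frag_cmul (c (snd \<iota>)) (z \<iota>)))" for c
    have sub: "Pair p ` {..<k p} \<subseteq> I" using k0[of p] by (cases "p < N") (auto simp: I_def)
    have cyc: "frag_cmul (c (snd \<iota>)) (z \<iota>) \<in> simplicial_cycles (Q \<iota>) (L \<iota>) (Suc p)" if "\<iota> \<in> Pair p ` {..<k p}" for c \<iota>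
      using that cls by (auto simp: cyclic_class_def intro: frag_subgroup_cmul frag_subgroup_cycles)
    have zz_cycle: "zz c \<in> simplicial_cycles ?P ?lt (Suc p)" for c
      unfolding zz_def
    proof (rule frag_subgroup_sum[OF frag_subgroup_cycles])
      fix \<iota> assume \<iota>: "\<iota> \<in> Pair p ` {..<k p}"
      then have "\<iota> \<in> I" using sub by blast
      then show "frag_extend (frag_of \<circ> map (Pair \<iota>)) (frag_cmul (c (snd \<iota>)) (z \<iota>)) \<in> simplicial_cycles ?P ?lt (Suc p)"
        by (rule disjoint_union_cycles(1)[rotated]) (rule cyc[OF \<iota>], simp)
    qed
    have zz_boundary: "zz c \<in> simplicial_boundaries ?P ?lt (Suc p) \<longleftrightarrow> (\<forall>i<k p. int (q p i) dvd c i)" for c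
    proof -
      have "zz c \<in> simplicial_boundaries ?P ?lt (Suc p) \<longleftrightarrow>
          (\<forall>\<iota>\<in>Pair p ` {..<k p}. frag_cmul (c (snd \<iota>)) (z \<iota>) \<in> simplicial_boundaries (Q \<iota>) (L \<iota>) (Suc p))"
        unfolding zz_def by (rule disjoint_union_cycles(2)) (use sub cyc in auto)
      also have "\<dots> \<longleftrightarrow> (\<forall>i<k p. int (q p i) dvd c i)"
        using cls by (auto simp: cyclic_class_def)
      finally show ?thesis .
    qed
    have zz_diff: "zz c - zz c' = zz (\<lambda>i. c i - c' i)" for c c'
      unfolding zz_def by (simp add: frag_cmul_diff_distrib frag_extend_diff sum_subtractf)
    let ?W = "frag_extend (frag_of \<circ> wrap)"
    show ?thesis
      unfolding Mag homology_group_eq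
    \<comment> \<open>The coefficients of \<open>a\<close> are determined only modulo the orders,
      and the relation admits every choice of them.\<close>
    proof (rule frag_quotient_mon[where R = "\<lambda>a a'. \<exists>c. a - (\<Sum>i<k p. frag_cmul (c i) (g p i)) \<in> singular_boundaries p M \<and> a' = ?W (zz c)",
          OF frag_subgroup_singular_cycles frag_subgroup_singular_boundaries singular_boundaries_subset
          frag_subgroup_cycles frag_subgroup_boundaries magnitude_boundaries_subset])
      show "\<exists>a'\<in>chain_cycles (proper_chains X d (Suc (Suc p)) ?l) (magnitude_boundary d).
          \<exists>c. a - (\<Sum>i<k p. frag_cmul (c i) (g p i)) \<in> singular_boundaries p M \<and> a' = ?W (zz c)"
        if "a \<in> singular_cycles p M" for a
        using gen[OF that] wrap_cycles(1)[OF zz_cycle] by blast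
    next
      fix a b a' b'
      assume "\<exists>c. a - (\<Sum>i<k p. frag_cmul (c i) (g p i)) \<in> singular_boundaries p M \<and> a' = ?W (zz c)"
        "\<exists>c. b - (\<Sum>i<k p. frag_cmul (c i) (g p i)) \<in> singular_boundaries p M \<and> b' = ?W (zz c)"
      then obtain c c' where c: "a - (\<Sum>i<k p. frag_cmul (c i) (g p i)) \<in> singular_boundaries p M" "a' = ?W (zz c)"
        and c': "b - (\<Sum>i<k p. frag_cmul (c' i) (g p i)) \<in> singular_boundaries p M" "b' = ?W (zz c')" by blast
      have "(a - b) - (\<Sum>i<k p. frag_cmul (c i - c' i) (g p i)) \<in> singular_boundaries p M"
        using frag_subgroup_diff[OF frag_subgroup_singular_boundaries c(1) c'(1)]
        by (simp add: frag_cmul_diff_distrib sum_subtractf algebra_simps)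
      moreover have "a' - b' = ?W (zz (\<lambda>i. c i - c' i))"
        unfolding c(2) c'(2) zz_diff[symmetric] frag_extend_diff ..
      ultimately show "\<exists>c. (a - b) - (\<Sum>i<k p. frag_cmul (c i) (g p i)) \<in> singular_boundaries p M \<and> a' - b' = ?W (zz c)"
        by (intro exI[of _ "\<lambda>i. c i - c' i"] conjI)
    next
      fix a a'
      assume "\<exists>c. a - (\<Sum>i<k p. frag_cmul (c i) (g p i)) \<in> singular_boundaries p M \<and> a' = ?W (zz c)"
      then obtain c where c: "a - (\<Sum>i<k p. frag_cmul (c i) (g p i)) \<in> singular_boundaries p M" "a' = ?W (zz c)" by blast
      have "a \<in> singular_boundaries p M \<longleftrightarrow> (\<forall>i<k p. int (q p i) dvd c i)"
        using frag_subgroup_diff_iff[OF frag_subgroup_singular_boundaries c(1)] rel by blast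
      then show "a \<in> singular_boundaries p M \<longleftrightarrow>
          a' \<in> chain_boundaries (proper_chains X d (Suc (Suc (Suc p))) ?l) (magnitude_boundary d)"
        using wrap_cycles(2)[OF zz_cycle, of c] zz_boundary c(2) by blast
    qed
  qed
  then have sub: "\<exists>K. subgroup K (magnitude_homology X d (Suc (Suc p)) ?l) \<and>
      (magnitude_homology X d (Suc (Suc p)) ?l)\<lparr>carrier := K\<rparr> \<cong> homology_group (int p) M" for p
    using mon_imp_subgroup_iso[OF group_relative_homology_group Mag_group] by blast
  \<comment> \<open>For \<open>n = 1\<close> the homology group has degree \<open>- 1\<close> and is
    trivial, so the constant map embeds it.\<close>
  have sub1: "\<exists>K. subgroup K (magnitude_homology X d 1 ?l) \<and>
      (magnitude_homology X d 1 ?l)\<lparr>carrier := K\<rparr> \<cong> homology_group (- 1) M"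
  proof (rule mon_imp_subgroup_iso[OF group_relative_homology_group Mag_group])
    interpret G: group "magnitude_homology X d 1 ?l" by (rule Mag_group)
    show "(\<lambda>_. \<one>\<^bsub>magnitude_homology X d 1 ?l\<^esub>) \<in> mon (homology_group (- 1) M) (magnitude_homology X d 1 ?l)"
      by (auto simp: mon_def hom_def relative_homology_group_def singleton_group_def simp del: One_nat_def)
  qed
  have "\<exists>K. subgroup K (magnitude_homology X d n ?l) \<and>
      (magnitude_homology X d n ?l)\<lparr>carrier := K\<rparr> \<cong> homology_group (int n - 2) M" if "n > 0" for n
  proof (cases "n = 1")
    case True
    then show ?thesis using sub1 by simp
  next
    case False
    then have "n = Suc (Suc (n - 2))" "int n - 2 = int (n - 2)" using that by auto
    then show ?thesis using sub[of "n - 2"] by metis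
  qed
  then show ?thesis
    using X(1,2) Metric_space_axioms by (intro exI[of _ X] exI[of _ d] exI[of _ ?l]) auto
qed

theorem corollary5p12:
  shows "(\<forall>(P :: 'a set) r (n::nat).
            ranked_poset P r \<longrightarrow> n \<ge> 1 \<longrightarrow>
            (\<exists>h. h \<in> mon (reduced_order_homology P r (int n - 2))
                       (magnitude_homology (hat_carrier P) (hat_dist P r) n
                          (hat_dist P r Hat0 Hat1))))
       \<and> (\<forall>(M :: 'b topology) A m.
            smooth_manifold m M A \<longrightarrow> compact_space M \<longrightarrow>
            (\<exists>(X :: nat set) d (l::real).
               finite X \<and> Metric_space X d \<and> l > 0 \<and>
               (\<forall>n::nat. n > 0 \<longrightarrow>
                 (\<exists>K. subgroup K (magnitude_homology X d n l) \<and>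
                      (magnitude_homology X d n l)\<lparr>carrier := K\<rparr> \<cong> homology_group (int n - 2) M))))
       \<and> (\<exists>(V :: nat set) E (n::nat) (l::nat).
            simple_graph V E \<and> graph_connected V E \<and> n > 0 \<and> l > 0 \<and>
            has_torsion (magnitude_homology V (graph_dist V E) n (real l)))"
  by (intro conjI allI impI torsion_graph)
    (rule reduced_homology_embeds, assumption+, rule compact_manifold_magnitude, assumption+)

end
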